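(* Let $a,b\in\mathbb R\setminus\{0\}$ and $$W(x)=e^{-x^2}\begin{pmatrix}(ax^2+bx)^2+1&-x(ax+b)\\-x(ax+b)&1\end{pmatrix},\qquad x\in\mathbb R.$$ Then $W$ is a strong Darboux transformation of $\widetilde W(x)=e^{-x^2}I$ (of size $2\times2$, on $\mathbb R$). Moreover, $\mathcal D(W)$ contains a differential operator of order $6$ and contains no differential operator of positive order less than $6$; in particular $\mathcal D(W)$ contains no second-order differential operator, i.e. $W$ is not a solution of the Matrix Bochner Problem.
   Context: For a weight matrix $W$ of size $N$ on an interval $(x_0,x_1)$ put $\langle P,Q\rangle_W=\int_{x_0}^{x_1}P(x)W(x)Q(x)^*\,dx$ for $P,Q\in\operatorname{Mat}_N(\mathbb C[x])$. The monic orthogonal polynomials of $W$ are the unique $P_n\in\operatorname{Mat}_N(\mathbb C[x])$, $n\ge0$, of degree $n$ with leading coefficient $I$ and $\langle P_n,P_m\rangle_W=0$ for $n\ne m$. Differential operators $D=\sum_{i=0}^s\partial^iF_i(x)$, $\partial=d/dx$, act on the right on matrix functions: $P\cdot D=\sum_i P^{(i)}F_i$, and products satisfy $P\cdot(D_1D_2)=(P\cdot D_1)\cdot D_2$. The order of $D$ is the largest $s$ with $F_s\ne0$. $\operatorname{Mat}_N(\Omega[x])$ is the algebra of such operators with coefficients $F_i\in\operatorname{Mat}_N(\mathbb C[x])$. $$\mathcal D(W)=\{D\in\operatorname{Mat}_N(\Omega[x]): P_n\cdot D=\Lambda_n(D)P_n\text{ for some }\Lambda_n(D)\in\operatorname{Mat}_N(\mathbb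 C),\ \forall n\ge0\}.$$ A weight matrix $W$ is a solution of the Matrix Bochner Problem if $\mathcal D(W)$ contains a second-order differential operator. The formal adjoint ${}^*$ is the involution (reversing products) extending the Hermitian conjugate on matrix functions and sending $\partial I$ to $-\partial I$. An operator $\mathcal V\in\operatorname{Mat}_N(\Omega[x])$ is degree-preserving if $\deg(P\cdot\mathcal V)=\deg P$ for all $P\in\operatorname{Mat}_N(\mathbb C[x])$. Strong Darboux transformation (general definition): for weight matrices $W_1,W_2$ of size $N$ on the same interval, $W_2$ is a strong Darboux transformation of $W_1$ if there is a degree-preserving differential operator $\mathcal V\in\operatorname{Mat}_N(\Omega[x])$ with nonsingular leading coefficient (i.e. the coefficient of its highest power of $\partial$ is a matrix polynomial whose determinant is not identically zero) such that $D=\mathcal V\mathcal N\in\mathcal D(W_1)$, where $\mathcal N=W_2\mathcal V^*W_1^{-1}$ (so $Q\cdot\mathcal N=\sum_j(-1)^j(QW_2F_j^* )^{(j)}W_1^{-1}$ if $\mathcal V=\sum_j\partial^jF_j$) is a differential operator satisfying $\langle P\cdot\mathcal V,Q\rangle_{W_2}=\langle P,Q\cdot\mathcal N\rangle_{W_1}$ for all $P,Q\in\operatorname{Mat}_N(\mathbb C[x])$. *)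

theory Defs
  imports "HOL-Analysis.Analysis" "HOL-Computational_Algebra.Polynomial"
begin

text \<open>
  Conventions. \<open>Mat_N(\<complex>)\<close> is \<^typ>\<open>complex ^ 'n ^ 'n\<close> and \<open>Mat_N(\<complex>[x])\<close> is
  \<^typ>\<open>complex poly ^ 'n ^ 'n\<close>, with \<open>N = CARD('n)\<close> and the matrix product \<open>**\<close>.
  A differential operator \<open>\<Sum>\<^sub>i \<partial>\<^sup>i F\<^sub>i\<close> with matrix polynomial coefficients is the polynomial
  (in the indeterminate \<open>\<partial>\<close>) whose \<open>i\<close>-th coefficient is \<open>F\<^sub>i\<close>. Only the additive structure
  of this polynomial type is used: operators are composed with \<open>dop_mult\<close> below.
  The interval \<open>(x\<^sub>0,x\<^sub>1)\<close> is represented by the set \<open>I\<close> of its points.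
\<close>

type_synonym 'n cmat = "complex ^ 'n ^ 'n"
type_synonym 'n pmat = "complex poly ^ 'n ^ 'n"
type_synonym 'n dop = "'n pmat poly"


subsection \<open>Matrices and matrix polynomials\<close>

definition cadj :: "('n::finite) cmat \<Rightarrow> 'n cmat" where
  "cadj A = (\<chi> i j. cnj (A $ j $ i))"

definition posdef :: "('n::finite) cmat \<Rightarrow> bool" where
  "posdef A \<longleftrightarrow> cadj A = A \<and>
     (\<forall>v. v \<noteq> 0 \<longrightarrow> 0 < Re (\<Sum>i\<in>UNIV. \<Sum>j\<in>UNIV. cnj (v $ i) * A $ i $ j * v $ j))"

definition peval :: "('n::finite) pmat \<Rightarrow> real \<Rightarrow> 'n cmat" where
  "peval P x = (\<chi> i j. poly (P $ i $ j) (complex_of_real x))"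

definition pconst :: "('n::finite) cmat \<Rightarrow> 'n pmat" where
  "pconst A = (\<chi> i j. [:A $ i $ j:])"

definition pcoeff :: "('n::finite) pmat \<Rightarrow> nat \<Rightarrow> 'n cmat" where
  "pcoeff P k = (\<chi> i j. coeff (P $ i $ j) k)"

definition pdegree :: "('n::finite) pmat \<Rightarrow> nat" where
  "pdegree P = Max (range (\<lambda>(i, j). degree (P $ i $ j)))"

definition pmat_deriv :: "('n::finite) pmat \<Rightarrow> 'n pmat" where
  "pmat_deriv P = (\<chi> i j. pderiv (P $ i $ j))"


subsection \<open>Weight matrices and their orthogonal polynomials\<close>

text \<open>Iterated derivative of a matrix function of a real variable.\<close>

definition fderiv :: "nat \<Rightarrow> (real \<Rightarrow> ('n::finite) cmat) \<Rightarrow> real \<Rightarrow> 'n cmat" where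
  "fderiv k f = ((\<lambda>g x. vector_derivative g (at x)) ^^ k) f"

definition weight_matrix :: "real set \<Rightarrow> (real \<Rightarrow> ('n::finite) cmat) \<Rightarrow> bool" where
  "weight_matrix I W \<longleftrightarrow>
     open I \<and> is_interval I \<and> I \<noteq> {} \<and>
     (\<forall>k. \<forall>x\<in>I. fderiv k W differentiable (at x)) \<and>
     (AE x in lborel. x \<in> I \<longrightarrow> posdef (W x)) \<and>
     (\<forall>k. set_integrable lborel I (\<lambda>x. x ^ k *\<^sub>R W x))"

definition winner :: "real set \<Rightarrow> (real \<Rightarrow> ('n::finite) cmat) \<Rightarrow> 'n pmat \<Rightarrow> 'n pmat \<Rightarrow> 'n cmat" where
  "winner I W P Q = set_lebesgue_integral lborel I (\<lambda>x. peval P x ** W x ** cadj (peval Q x))"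

definition monic_orthogonal :: "real set \<Rightarrow> (real \<Rightarrow> ('n::finite) cmat) \<Rightarrow> (nat \<Rightarrow> 'n pmat) \<Rightarrow> bool" where
  "monic_orthogonal I W P \<longleftrightarrow>
     (\<forall>n. pdegree (P n) = n \<and> pcoeff (P n) n = mat 1) \<and>
     (\<forall>n m. n \<noteq> m \<longrightarrow> winner I W (P n) (P m) = 0)"

definition monic_ops :: "real set \<Rightarrow> (real \<Rightarrow> ('n::finite) cmat) \<Rightarrow> nat \<Rightarrow> 'n pmat" where
  "monic_ops I W = (THE P. monic_orthogonal I W P)"


subsection \<open>Differential operators acting on the right\<close>

definition dop_act :: "('n::finite) pmat \<Rightarrow> 'n dop \<Rightarrow> 'n pmat"  (infixl "\<cdot>\<^sub>D" 75) where
  "P \<cdot>\<^sub>D D = (\<Sum>i\<le>degree D. (pmat_deriv ^^ i) P ** coeff D i)"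

text \<open>The order is the degree in \<open>\<partial>\<close>; the zero operator gets order 0.\<close>

abbreviation dop_order :: "('n::finite) dop \<Rightarrow> nat" where
  "dop_order D \<equiv> degree D"

text \<open>
  By the Leibniz rule \<open>(P\<^sup>(\<^sup>i\<^sup>) F)\<^sup>(\<^sup>j\<^sup>) G = \<Sum>\<^sub>k (j choose k) P\<^sup>(\<^sup>i\<^sup>+\<^sup>k\<^sup>) F\<^sup>(\<^sup>j\<^sup>-\<^sup>k\<^sup>) G\<close>; see
  \<open>dop_act_mult\<close> below.
\<close>

definition dop_mult :: "('n::finite) dop \<Rightarrow> 'n dop \<Rightarrow> 'n dop"  (infixl "\<odot>" 77) where
  "D \<odot> E = (\<Sum>i\<le>degree D. \<Sum>j\<le>degree E. \<Sum>k\<le>j.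
     monom (mat (of_nat (j choose k)) ** (pmat_deriv ^^ (j - k)) (coeff D i) ** coeff E j) (i + k))"

definition bochner_algebra :: "real set \<Rightarrow> (real \<Rightarrow> ('n::finite) cmat) \<Rightarrow> 'n dop set" where
  "bochner_algebra I W =
     {D. \<forall>n. \<exists>\<Lambda>. monic_ops I W n \<cdot>\<^sub>D D = pconst \<Lambda> ** monic_ops I W n}"

definition matrix_bochner_solution :: "real set \<Rightarrow> (real \<Rightarrow> ('n::finite) cmat) \<Rightarrow> bool" where
  "matrix_bochner_solution I W \<longleftrightarrow> (\<exists>D \<in> bochner_algebra I W. dop_order D = 2)"


subsection \<open>Strong Darboux transformations\<close>

text \<open>With the convention \<open>deg 0 = -\<infinity>\<close>: nonzero polynomials are not annihilated.\<close>

definition degree_preserving :: "('n::finite) dop \<Rightarrow> bool" where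
  "degree_preserving V \<longleftrightarrow> (\<forall>P. P \<noteq> 0 \<longrightarrow> P \<cdot>\<^sub>D V \<noteq> 0 \<and> pdegree (P \<cdot>\<^sub>D V) = pdegree P)"

text \<open>
  \<open>N = W\<^sub>2 V\<^sup>* W\<^sub>1\<inverse>\<close>, i.e. \<open>Q\<cdot>N = \<Sum>\<^sub>j (-1)\<^sup>j (Q W\<^sub>2 F\<^sub>j\<^sup>*)\<^sup>(\<^sup>j\<^sup>) W\<^sub>1\<inverse>\<close> for \<open>V = \<Sum>\<^sub>j \<partial>\<^sup>j F\<^sub>j\<close>, at the
  (almost all) points where \<open>W\<^sub>1\<close> is invertible. Both sides are differential operators in \<open>Q\<close>,
  so that agreement on all matrix polynomials means equality of the operators.
\<close>

definition is_weight_adjoint ::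
    "real set \<Rightarrow> (real \<Rightarrow> ('n::finite) cmat) \<Rightarrow> (real \<Rightarrow> 'n cmat) \<Rightarrow> 'n dop \<Rightarrow> 'n dop \<Rightarrow> bool" where
  "is_weight_adjoint I W1 W2 V N \<longleftrightarrow>
     (\<forall>Q. \<forall>x\<in>I. invertible (W1 x) \<longrightarrow>
        peval (Q \<cdot>\<^sub>D N) x =
        (\<Sum>j\<le>degree V. (-1) ^ j *\<^sub>R
            fderiv j (\<lambda>t. peval Q t ** W2 t ** cadj (peval (coeff V j) t)) x)
          ** matrix_inv (W1 x))"

text \<open>
  \<open>N\<close> is taken with matrix polynomial coefficients. This is no restriction: \<open>V\<close> is degree-preserving
  and \<open>V N\<close> maps matrix polynomials to matrix polynomials, hence so does \<open>N\<close>.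
\<close>

definition strong_darboux ::
    "real set \<Rightarrow> (real \<Rightarrow> ('n::finite) cmat) \<Rightarrow> (real \<Rightarrow> 'n cmat) \<Rightarrow> bool" where
  "strong_darboux I W1 W2 \<longleftrightarrow>
     weight_matrix I W1 \<and> weight_matrix I W2 \<and>
     (\<exists>V N. degree_preserving V \<and> det (lead_coeff V) \<noteq> 0 \<and>
        is_weight_adjoint I W1 W2 V N \<and>
        V \<odot> N \<in> bochner_algebra I W1 \<and>
        (\<forall>P Q. winner I W2 (P \<cdot>\<^sub>D V) Q = winner I W1 P (Q \<cdot>\<^sub>D N)))"


subsection \<open>The two weights\<close>

definition hermite_weight :: "real \<Rightarrow> 2 cmat" where
  "hermite_weight x = exp (- x\<^sup>2) *\<^sub>R mat 1"

definition W_ab :: "real \<Rightarrow> real \<Rightarrow> real \<Rightarrow> 2 cmat" where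
  "W_ab a b x = exp (- x\<^sup>2) *\<^sub>R
     vector [vector [complex_of_real ((a * x\<^sup>2 + b * x)\<^sup>2 + 1), complex_of_real (- x * (a * x + b))],
             vector [complex_of_real (- x * (a * x + b)), 1]]"


subsection \<open>The product of operators is composition of the right actions\<close>

lemma pmat_deriv_add: "pmat_deriv (P + Q) = pmat_deriv P + pmat_deriv Q"
  by (simp add: pmat_deriv_def vec_eq_iff pderiv_add)

lemma pmat_deriv_zero [simp]: "pmat_deriv 0 = 0"
  by (simp add: pmat_deriv_def vec_eq_iff)

lemma pmat_deriv_pow_zero [simp]: "(pmat_deriv ^^ n) 0 = 0"
  by (induction n) auto

lemma pmat_deriv_pow_add: "(pmat_deriv ^^ n) (P + Q) = (pmat_deriv ^^ n) P + (pmat_deriv ^^ n) Q"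
  by (induction n) (auto simp: pmat_deriv_add)

lemma pmat_deriv_pow_sum: "(pmat_deriv ^^ n) (sum f A) = (\<Sum>x\<in>A. (pmat_deriv ^^ n) (f x))"
  by (induction A rule: infinite_finite_induct) (auto simp: pmat_deriv_pow_add)

lemma pmat_deriv_mult:
  "pmat_deriv (P ** Q) = pmat_deriv P ** Q + P ** pmat_deriv (Q :: ('n::finite) pmat)"
proof -
  have "pderiv (sum f A) = (\<Sum>x\<in>A. pderiv (f x))" for f :: "'n \<Rightarrow> complex poly" and A
    by (induction A rule: infinite_finite_induct) (auto simp: pderiv_add)
  then show ?thesis
    by (simp add: pmat_deriv_def matrix_matrix_mult_def vec_eq_iff pderiv_mult
        sum.distrib[symmetric] add.commute mult.commute)
qed

lemma mat_mult_entry: "(mat c ** A) $ i $ j = c * (A :: ('n::finite) pmat) $ i $ j"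
proof -
  have "(mat c ** A) $ i $ j = (\<Sum>k\<in>UNIV. if k = i then c * A $ k $ j else 0)"
    unfolding matrix_matrix_mult_def mat_def vec_lambda_beta by (intro sum.cong) auto
  then show ?thesis by simp
qed

lemma mat_mult_commute: "(P :: ('n::finite) pmat) ** (mat c ** A) = mat c ** (P ** (A :: 'n pmat))"
proof -
  have "(P ** (mat c ** A)) $ i $ j = (\<Sum>k\<in>UNIV. P $ i $ k * (mat c ** A) $ k $ j)" for i j
    by (simp add: matrix_matrix_mult_def[of P])
  also have "\<dots> i j = c * (P ** A) $ i $ j" for i j
    unfolding mat_mult_entry
    by (simp add: matrix_matrix_mult_def sum_distrib_left mult.left_commute)
  finally show ?thesis by (simp add: vec_eq_iff mat_mult_entry)
qed

lemma mat_mult_add: "mat (c + d) ** A = mat c ** A + mat d ** (A :: ('n::finite) pmat)"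
  by (simp add: vec_eq_iff mat_mult_entry distrib_right)

lemma pmat_deriv_of_nat_mult: "pmat_deriv (mat (of_nat c) ** A) = mat (of_nat c) ** pmat_deriv A"
  by (simp add: pmat_deriv_def vec_eq_iff mat_mult_entry pderiv_mult)

lemma pmat_add_rdistrib: "(A + B) ** C = A ** C + B ** (C :: ('n::finite) pmat)"
  by (simp add: matrix_matrix_mult_def vec_eq_iff distrib_right sum.distrib)

lemma matrix_mult_sum_left: "sum f A ** (B :: ('n::finite) pmat) = (\<Sum>x\<in>A. f x ** B)"
  by (induction A rule: infinite_finite_induct) (auto simp: pmat_add_rdistrib)

lemma matrix_mult_sum_right: "(B :: ('n::finite) pmat) ** sum f A = (\<Sum>x\<in>A. B ** f x)"
  by (induction A rule: infinite_finite_induct) (auto simp: matrix_add_ldistrib)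

lemma pmat_deriv_sum: "pmat_deriv (sum f A) = (\<Sum>x\<in>A. pmat_deriv (f x))"
  using pmat_deriv_pow_sum[of 1 f A] by simp

lemma pmat_leibniz:
  "(pmat_deriv ^^ n) (P ** Q) =
     (\<Sum>k\<le>n. mat (of_nat (n choose k)) ** ((pmat_deriv ^^ k) P ** (pmat_deriv ^^ (n - k)) Q))"
proof (induction n)
  case (Suc n)
  let ?t = "\<lambda>c k l. mat (of_nat c) ** ((pmat_deriv ^^ k) P ** (pmat_deriv ^^ l) Q)"
  have "(pmat_deriv ^^ Suc n) (P ** Q) =
      (\<Sum>k\<le>n. ?t (n choose k) (Suc k) (n - k)) + (\<Sum>k\<le>n. ?t (n choose k) k (Suc n - k))"
    by (simp add: Suc.IH pmat_deriv_sum pmat_deriv_of_nat_mult)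
      (simp add: pmat_deriv_mult matrix_add_ldistrib sum.distrib Suc_diff_le)
  also have "(\<Sum>k\<le>n. ?t (n choose k) k (Suc n - k)) = (\<Sum>k\<le>Suc n. ?t (n choose k) k (Suc n - k))"
    by (simp add: vec_eq_iff mat_mult_entry)
  also have "\<dots> = ?t 1 0 (Suc n) + (\<Sum>k\<le>n. ?t (n choose Suc k) (Suc k) (n - k))"
    by (subst sum.atMost_Suc_shift) simp
  also have "(\<Sum>k\<le>n. ?t (n choose k) (Suc k) (n - k)) +
       (?t 1 0 (Suc n) + (\<Sum>k\<le>n. ?t (n choose Suc k) (Suc k) (n - k))) =
      ?t 1 0 (Suc n) + (\<Sum>k\<le>n. ?t (Suc n choose Suc k) (Suc k) (n - k))"
    by (simp add: sum.distrib mat_mult_add del: funpow.simps)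
  also have "\<dots> = (\<Sum>k\<le>Suc n. ?t (Suc n choose k) k (Suc n - k))"
    by (subst sum.atMost_Suc_shift) simp
  finally show ?case .
qed simp

lemma dop_act_bound:
  assumes "degree D \<le> n"
  shows "P \<cdot>\<^sub>D D = (\<Sum>i\<le>n. (pmat_deriv ^^ i) P ** coeff D i)"
  unfolding dop_act_def using assms
  by (intro sum.mono_neutral_left) (auto simp: coeff_eq_0)

lemma dop_act_add: "P \<cdot>\<^sub>D (D + E) = P \<cdot>\<^sub>D D + P \<cdot>\<^sub>D E"
proof -
  define n where "n = max (degree D) (degree E)"
  have "degree D \<le> n" "degree E \<le> n" "degree (D + E) \<le> n"
    by (auto simp: n_def degree_add_le)
  then show ?thesis
    by (simp add: dop_act_bound matrix_add_ldistrib sum.distrib)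
qed

lemma dop_act_0 [simp]: "P \<cdot>\<^sub>D 0 = 0"
  by (simp add: dop_act_def)

lemma dop_act_sum: "P \<cdot>\<^sub>D (sum f A) = (\<Sum>x\<in>A. P \<cdot>\<^sub>D f x)"
  by (induction A rule: infinite_finite_induct) (auto simp: dop_act_add)

lemma dop_act_monom: "P \<cdot>\<^sub>D monom F i = (pmat_deriv ^^ i) P ** F"
proof -
  have "P \<cdot>\<^sub>D monom F i = (\<Sum>k\<le>i. if k = i then (pmat_deriv ^^ k) P ** F else 0)"
    by (subst dop_act_bound[OF degree_monom_le]) (intro sum.cong, auto)
  then show ?thesis by simp
qed

lemma dop_act_mult: "P \<cdot>\<^sub>D (D \<odot> E) = (P \<cdot>\<^sub>D D) \<cdot>\<^sub>D E"
proof -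
  have "(P \<cdot>\<^sub>D D) \<cdot>\<^sub>D E =
      (\<Sum>j\<le>degree E. \<Sum>i\<le>degree D. \<Sum>k\<le>j. (pmat_deriv ^^ (i + k)) P **
        (mat (of_nat (j choose k)) ** (pmat_deriv ^^ (j - k)) (coeff D i) ** coeff E j))"
    by (simp add: dop_act_def pmat_deriv_pow_sum pmat_leibniz matrix_mult_sum_left
        mat_mult_commute matrix_mul_assoc[symmetric] funpow_add[symmetric, THEN fun_cong, unfolded o_def]
        add.commute)
  also have "\<dots> = P \<cdot>\<^sub>D (D \<odot> E)"
    unfolding dop_mult_def dop_act_sum dop_act_monom by (rule sum.swap)
  finally show ?thesis by simp
qed

end

theory Submission
  imports Defs "HOL-Probability.Distributions"
begin

text \<open>
  Write \<open>W = e\<^bsup>-x\<^sup>2\<^esup> T T\<^sup>*\<close> with \<open>T\<close> unipotent and upper triangular, \<open>p = a x\<^sup>2 + b x\<close> in its corner. In the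
  coordinates \<open>(u, w) = (u, v) T\<close> orthogonality for \<open>W\<close> becomes orthogonality for the scalar Gaussian, and the
  two rows of degree \<open>n\<close> orthogonal to all lower degrees have at most three Hermite components in each entry,
  with coefficients polynomial in \<open>n\<close>. Hence they arise from \<open>H\<^sub>n I\<close> by a differential operator \<open>V\<close> of order
  four, which gives the Darboux transformation; the operator of order six is found in the same coordinates.

  For the lower bound, an operator in the algebra of \<open>W\<close> and its adjoint both preserve degrees. This confines
  the matrix elements of its entries in the Hermite basis to a few diagonals, polynomial in the index \<open>n\<close> and
  tied together by linear relations. If the order is at most five, evaluation at \<open>0\<close> shows that the
  operator acts on the rows of degree \<open>n\<close> by matrices of size \<open>O(n\<^sup>2)\<close>, and comparing degrees in \<open>n\<close> leaves
  only scalars.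
\<close>

text \<open>The threshold six comes from halving. By the Hermite equation every two derivatives at 0
  cost one factor of the index \<open>n\<close>, so order at most five allows growth
  \<open>n^2\<close>, while order six allows the cubic growth that \<open>e6\<close> indeed has.
  Only even indices are usable, since Hermite polynomials of odd index vanish at 0. This costs
  nothing: a polynomial in \<open>n\<close> is determined by its values, and its degree is bounded
  by its growth, along the indices \<open>2 * m + 4\<close>, which also satisfy the bounds
  \<open>n >= 3\<close> of the diagonal relations. Both parameters matter in the lower bound. Since
  a \<noteq> 0, the quantity \<open>qq\<close> grows like \<open>n^2\<close>, so that the
  multipliers in the relations outgrow the data they are compared with. Since b \<noteq> 0, the
  constants that survive these comparisons are forced to vanish. The work is done with a linear form
  on polynomials; Lebesgue integrals enter only through the moments.\<close>

subsection \<open>The Gaussian functional on polynomials\<close>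

definition gauss_moment :: "nat \<Rightarrow> real" where
  "gauss_moment k = (if even k then sqrt pi * (fact k / (2 ^ k * fact (k div 2))) else 0)"

lemma has_integral_gauss_moment:
  "has_bochner_integral lborel (\<lambda>x. exp (- x\<^sup>2) * x ^ k) (gauss_moment k)"
proof (cases "even k")
  case True
  then obtain m where "k = 2 * m" by auto
  then show ?thesis
    using has_bochner_integral_even_function[OF gaussian_moment_even_pos[where k = m]]
    by (simp add: gauss_moment_def)
next
  case False
  then obtain m where "k = 2 * m + 1" by (auto elim: oddE)
  then show ?thesis
    using has_bochner_integral_odd_function[OF gaussian_moment_odd_pos[where k = m]]
    by (simp add: gauss_moment_def)
qed

text \<open>Integration by parts at the level of moments; it is the source of every adjointness
  statement for \<open>gint\<close>.\<close>

lemma gauss_moment_Suc_Suc: "2 * gauss_moment (Suc (Suc k)) = real (Suc k) * gauss_moment k"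
proof (cases "even k")
  case True
  then obtain m where m: "k = 2 * m" by auto
  have "fact (Suc (Suc k)) = (2 * real (Suc m)) * (real (Suc k) * fact k)"
    by (simp add: m algebra_simps)
  moreover have "fact (Suc (Suc k) div 2) = real (Suc m) * fact m"
    by (simp add: m)
  ultimately show ?thesis
    using True by (simp add: gauss_moment_def m divide_simps del: of_nat_Suc fact_Suc)
qed (simp add: gauss_moment_def)

text \<open>Integration against the Gaussian, encoded as a linear form on coefficients, so that
  integrability never has to be discussed. The link with the Lebesgue integral is
  \<open>has_integral_gmat\<close>.\<close>

definition gint :: "complex poly \<Rightarrow> complex" where
  "gint f = (\<Sum>i\<le>degree f. complex_of_real (gauss_moment i) * coeff f i)"

lemma gint_bound:
  "degree f \<le> n \<Longrightarrow> gint f = (\<Sum>i\<le>n. complex_of_real (gauss_moment i) * coeff f i)"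
  unfolding gint_def by (intro sum.mono_neutral_left) (auto simp: coeff_eq_0)

lemma gint_add: "gint (f + g) = gint f + gint g"
  by (simp add: gint_bound[of _ "max (degree f) (degree g)"] degree_add_le distrib_left sum.distrib)

lemma gint_smult: "gint (smult c f) = c * gint f"
  by (simp add: gint_bound[of _ "degree f"] sum_distrib_left mult.left_commute)

lemma gint_0 [simp]: "gint 0 = 0"
  by (simp add: gint_def)

lemma gint_minus: "gint (- f) = - gint f"
  using gint_smult[of "-1" f] by simp

lemma gint_diff: "gint (f - g) = gint f - gint g"
  using gint_add[of f "- g"] by (simp add: gint_minus)

lemma gint_sum: "gint (sum f A) = (\<Sum>x\<in>A. gint (f x))"
  by (induction A rule: infinite_finite_induct) (auto simp: gint_add)

lemma gint_pderiv: "gint (pderiv f) = 2 * gint ([:0, 1:] * f)"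
proof -
  let ?n = "degree f" and ?m = "\<lambda>i. complex_of_real (gauss_moment i)"
  have rec: "2 * ?m (Suc (Suc i)) = of_nat (Suc i) * ?m i" for i
    using gauss_moment_Suc_Suc[of i, THEN arg_cong[where f = complex_of_real]] by simp
  have "gint (pderiv f) = (\<Sum>i\<le>?n. ?m i * coeff (pderiv f) i)"
    by (rule gint_bound) (simp add: degree_pderiv)
  also have "\<dots> = (\<Sum>i\<le>?n. 2 * ?m (Suc (Suc i)) * coeff f (Suc i))"
    by (simp only: coeff_pderiv rec) (simp add: algebra_simps)
  \<comment> \<open>The summand added for index 0 carries the odd moment
    \<open>gauss_moment (Suc 0)\<close>, which is zero.\<close>
  also have "\<dots> = (\<Sum>i\<le>Suc ?n. 2 * ?m (Suc i) * coeff f i)"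
    by (subst sum.atMost_Suc_shift) (simp add: gauss_moment_def[of "Suc 0"])
  also have "\<dots> = (\<Sum>i\<le>Suc (Suc ?n). 2 * ?m i * coeff ([:0, 1:] * f) i)"
    by (subst (2) sum.atMost_Suc_shift) simp
  also have "\<dots> = 2 * gint ([:0, 1:] * f)"
    by (subst gint_bound[of _ "Suc (Suc ?n)"]) (auto simp: sum_distrib_left mult.assoc degree_pCons_eq_if
        intro: order.trans[OF degree_mult_le])
  finally show ?thesis .
qed

text \<open>The adjoint of \<partial> for the Gaussian form is
  \<open>2x - \<partial>\<close>.\<close>

lemma gint_pderiv_mult:
  "gint (pderiv f * g) = gint (f * ([:0, 2:] * g - pderiv g))"
proof -
  have "gint (f * pderiv g + g * pderiv f) = 2 * gint ([:0, 1:] * (f * g))"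
    using gint_pderiv[of "f * g"] by (simp only: pderiv_mult)
  also have "\<dots> = gint (smult 2 ([:0, 1:] * (f * g)))"
    by (simp only: gint_smult)
  also have "smult 2 ([:0, 1:] * (f * g)) = f * ([:0, 2:] * g)"
    by (simp add: algebra_simps)
  finally show ?thesis
    by (simp add: gint_add gint_diff right_diff_distrib algebra_simps)
qed

subsection \<open>Monic Hermite polynomials\<close>

text \<open>The physicists' Hermite polynomials divided by \<open>2 ^ n\<close>. The operator
  \<open>x - \<partial>/2\<close> of the recursion is half the adjoint of \<partial>, which makes
  orthogonality a matter of integration by parts.\<close>

fun herm :: "nat \<Rightarrow> complex poly" where
  "herm 0 = 1"
| "herm (Suc n) = [:0, 1:] * herm n - smult (1/2) (pderiv (herm n))"

declare herm.simps(2) [simp del]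

lemma degree_herm_aux: "degree (herm n) = n \<and> coeff (herm n) n = 1"
proof (induction n)
  case (Suc n)
  have c: "coeff (herm (Suc n)) (Suc n) = 1"
    using Suc by (simp add: herm.simps coeff_pderiv coeff_eq_0)
  have "degree (herm (Suc n)) \<le> Suc n"
    unfolding herm.simps using Suc
    by (intro degree_diff_le order.trans[OF degree_mult_le] order.trans[OF degree_smult_le])
       (auto simp: degree_pderiv)
  moreover have "degree (herm (Suc n)) \<ge> Suc n" using c by (intro le_degree) simp
  ultimately show ?case using c by simp
qed simp

lemma degree_herm [simp]: "degree (herm n) = n"
  and coeff_herm [simp]: "coeff (herm n) n = 1"
  using degree_herm_aux by auto

lemma pderiv_herm: "pderiv (herm n) = smult (of_nat n) (herm (n - 1))"
proof (induction n)
  case (Suc n)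
  have "pderiv (herm (Suc n)) = herm n + ([:0, 1:] * pderiv (herm n) - smult (1/2) (pderiv (pderiv (herm n))))"
    by (simp add: herm.simps pderiv_diff pderiv_smult pderiv_pCons pderiv_mult)
  also have "[:0, 1:] * pderiv (herm n) - smult (1/2) (pderiv (pderiv (herm n)))
      = smult (of_nat n) (herm n)"
  proof (cases n)
    case (Suc m)
    then show ?thesis
      unfolding Suc.IH by (simp add: herm.simps pderiv_smult smult_diff_right algebra_simps)
  qed simp
  finally show ?case by (simp add: smult_add_left)
qed simp

lemma pderiv_herm_Suc: "pderiv (herm (Suc n)) = smult (of_nat (Suc n)) (herm n)"
  by (simp add: pderiv_herm)

text \<open>Hermite's equation. It turns a factor \<open>n\<close> in front of \<open>herm n\<close>
  into the operator \<open>x \<partial> - \<partial>^2/2\<close>, and conversely reduces higher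
  derivatives of \<open>herm n\<close>.\<close>

lemma herm_eigen: "[:0, 1:] * pderiv (herm n) - smult (1/2) (pderiv (pderiv (herm n))) = smult (of_nat n) (herm n)"
proof (cases n)
  case (Suc m)
  have "[:0, 1:] * pderiv (herm n) - smult (1/2) (pderiv (pderiv (herm n)))
      = smult (of_nat n) ([:0, 1:] * herm m - smult (1/2) (pderiv (herm m)))"
    unfolding Suc pderiv_herm_Suc pderiv_smult by (simp add: smult_diff_right algebra_simps)
  then show ?thesis
    unfolding Suc herm.simps(2) .
qed simp

lemma x_herm: "[:0, 1:] * herm n = herm (Suc n) + smult (of_nat n / 2) (herm (n - 1))"
  by (simp add: herm.simps pderiv_herm)

text \<open>The creation operator moves to the other factor as \<partial>/2. Each use lowers the
  degree of \<open>g\<close>, which yields both the orthogonality and the norms.\<close>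

lemma gint_herm_Suc_mult: "gint (herm (Suc n) * g) = gint (herm n * pderiv g) / 2"
proof -
  have "gint (herm (Suc n) * g) = gint (herm n * ([:0, 1:] * g)) - gint (pderiv (herm n) * g) / 2"
    by (simp add: herm.simps left_diff_distrib gint_diff gint_smult algebra_simps)
  also have "gint (pderiv (herm n) * g) = 2 * gint (herm n * ([:0, 1:] * g)) - gint (herm n * pderiv g)"
    unfolding gint_pderiv_mult right_diff_distrib gint_diff
    by (subst gint_smult[symmetric]) (simp add: algebra_simps)
  finally show ?thesis by (simp add: field_simps)
qed

lemma gint_herm_eq_0: "degree g < n \<Longrightarrow> gint (herm n * g) = 0"
proof (induction n arbitrary: g)
  case (Suc n)
  show ?case
  proof (cases "degree g = 0")
    case True
    then have "pderiv g = 0" by (simp add: pderiv_eq_0_iff)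
    then show ?thesis by (simp add: gint_herm_Suc_mult)
  next
    case False
    then show ?thesis using Suc by (simp add: gint_herm_Suc_mult degree_pderiv)
  qed
qed simp

definition herm_norm :: "nat \<Rightarrow> real" where
  "herm_norm n = sqrt pi * fact n / 2 ^ n"

lemma herm_norm_pos: "herm_norm n > 0"
  by (simp add: herm_norm_def)

lemma herm_norm_nz [simp]: "herm_norm n \<noteq> 0"
  by (simp add: herm_norm_def)

lemma herm_norm_Suc: "herm_norm (Suc n) = real (Suc n) / 2 * herm_norm n"
  by (simp add: herm_norm_def field_simps)

lemma gint_herm_top: "degree g \<le> n \<Longrightarrow> gint (herm n * g) = of_real (herm_norm n) * coeff g n"
proof (induction n arbitrary: g)
  case 0
  then obtain c where "g = [:c:]" by (auto elim: degree_eq_zeroE)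
  then show ?case by (simp add: gint_def herm_norm_def gauss_moment_def)
next
  case (Suc n)
  then have "gint (herm (Suc n) * g) = of_real (herm_norm n) * coeff (pderiv g) n / 2"
    by (simp add: gint_herm_Suc_mult degree_pderiv)
  then show ?case by (simp add: coeff_pderiv herm_norm_Suc)
qed

lemma gint_herm_herm: "gint (herm m * herm n) = (if m = n then of_real (herm_norm n) else 0)"
proof -
  have "gint (herm m * herm n) = 0" if "n < m" for m n
    using that by (simp add: gint_herm_eq_0)
  from this[of m n] this[of n m] show ?thesis
    by (cases m n rule: linorder_cases) (auto simp: gint_herm_top mult.commute[of "herm m" "herm n"])
qed

lemma herm_expansion:
  "degree f \<le> n \<Longrightarrow> f = (\<Sum>k\<le>n. smult (gint (herm k * f) / of_real (herm_norm k)) (herm k))"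
proof (induction n arbitrary: f)
  case 0
  then obtain c where "f = [:c:]" by (auto elim: degree_eq_zeroE)
  then show ?case using gint_herm_top[of f 0] by (simp add: one_pCons)
next
  case (Suc n)
  let ?c = "coeff f (Suc n)"
  let ?g = "f - smult ?c (herm (Suc n))"
  have "degree ?g < Suc n"
  proof (rule degree_lessI)
    show "?g \<noteq> 0 \<or> 0 < Suc n" by simp
    show "\<forall>k\<ge>Suc n. coeff ?g k = 0"
    proof (intro allI impI)
      fix k assume "k \<ge> Suc n"
      then consider "k = Suc n" | "k > Suc n" by linarith
      then show "coeff ?g k = 0"
        using Suc.prems by cases (auto simp: coeff_eq_0)
    qed
  qed
  then have "degree ?g \<le> n" by simp
  from Suc.IH[OF this] have "?g = (\<Sum>k\<le>n. smult (gint (herm k * ?g) / of_real (herm_norm k)) (herm k))" .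
  also have "\<dots> = (\<Sum>k\<le>n. smult (gint (herm k * f) / of_real (herm_norm k)) (herm k))"
  proof (intro sum.cong refl)
    fix k assume "k \<in> {..n}"
    then show "smult (gint (herm k * ?g) / of_real (herm_norm k)) (herm k) =
        smult (gint (herm k * f) / of_real (herm_norm k)) (herm k)"
      by (simp add: right_diff_distrib gint_diff gint_smult gint_herm_herm)
  qed
  finally show ?case
    using gint_herm_top[OF Suc.prems] by (simp add: algebra_simps)
qed

text \<open>The degree filtration becomes a vanishing condition on Hermite components, so it can be
  read off matrix elements.\<close>

lemma degree_le_iff_gint: "degree f \<le> n \<longleftrightarrow> (\<forall>k>n. gint (herm k * f) = 0)"
proof
  assume R: "\<forall>k>n. gint (herm k * f) = 0"
  show "degree f \<le> n"
  proof (rule ccontr)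
    assume "\<not> degree f \<le> n"
    then have "gint (herm (degree f) * f) = 0" using R by simp
    then have "f = 0" by (simp add: gint_herm_top)
    then show False using \<open>\<not> degree f \<le> n\<close> by simp
  qed
qed (auto intro: gint_herm_eq_0)

lemma gint_lower_eq_0:
  assumes "\<And>k. k < n \<Longrightarrow> gint (herm k * f) = 0" "degree g < n"
  shows "gint (g * f) = 0"
proof -
  have "gint (g * f) = gint (\<Sum>k\<le>degree g. smult (gint (herm k * g) / of_real (herm_norm k)) (herm k * f))"
    by (subst herm_expansion[of g "degree g"]) (auto simp: sum_distrib_right)
  also have "\<dots> = 0" using assms by (simp add: gint_sum gint_smult)
  finally show ?thesis .
qed

section \<open>Complex conjugation of polynomials and positivity of the Gaussian form\<close>

lemma map_poly_cnj_mult: "map_poly cnj (p * q) = map_poly cnj p * map_poly cnj q"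
  by (rule poly_ext) simp
lemma map_poly_cnj_add: "map_poly cnj (p + q) = map_poly cnj p + map_poly cnj q"
  by (rule poly_ext) simp
lemma map_poly_cnj_cnj [simp]: "map_poly cnj (map_poly cnj p) = p"
  by (rule poly_ext) simp
lemma degree_map_poly_cnj [simp]: "degree (map_poly cnj p) = degree p"
  by (simp add: degree_map_poly)
lemma map_poly_cnj_sum: "map_poly cnj (sum f A) = (\<Sum>x\<in>A. map_poly cnj (f x))"
  by (induction A rule: infinite_finite_induct) (auto simp: map_poly_cnj_add)
lemma pderiv_map_poly_cnj: "pderiv (map_poly cnj p) = map_poly cnj (pderiv p)"
  by (rule poly_eqI) (simp add: coeff_pderiv coeff_map_poly)
lemma map_poly_cnj_diff: "map_poly cnj (p - q) = map_poly cnj p - map_poly cnj q"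
  by (rule poly_ext) simp
lemma map_poly_cnj_smult: "map_poly cnj (smult c q) = smult (cnj c) (map_poly cnj q)"
  by (rule poly_ext) simp

lemma map_poly_cnj_herm [simp]: "map_poly cnj (herm n) = herm n"
  by (induction n) (simp_all add: herm.simps map_poly_cnj_diff map_poly_cnj_mult map_poly_cnj_smult
      pderiv_map_poly_cnj[symmetric] map_poly_pCons)

lemma gint_cnj: "gint (map_poly cnj f) = cnj (gint f)"
  by (simp add: gint_def coeff_map_poly)

lemma gint_norm_square:
  assumes "degree f \<le> n"
  shows "gint (f * map_poly cnj f) = of_real (\<Sum>k\<le>n. (cmod (gint (herm k * f)))\<^sup>2 / herm_norm k)"
proof -
  let ?c = "\<lambda>k. gint (herm k * f) / of_real (herm_norm k)"
  have "gint (f * map_poly cnj f) = gint (\<Sum>k\<le>n. smult (?c k) (herm k * map_poly cnj f))"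
    by (subst (1) herm_expansion[OF assms]) (simp add: sum_distrib_right)
  also have "\<dots> = (\<Sum>k\<le>n. ?c k * gint (map_poly cnj (herm k * f)))"
    by (simp add: gint_sum gint_smult map_poly_cnj_mult)
  also have "\<dots> = of_real (\<Sum>k\<le>n. (cmod (gint (herm k * f)))\<^sup>2 / herm_norm k)"
    unfolding of_real_sum gint_cnj
    by (intro sum.cong refl) (simp add: complex_norm_square[symmetric])
  finally show ?thesis .
qed

lemma gint_norm_square_nonneg:
  "\<exists>r\<ge>0. gint (f * map_poly cnj f) = complex_of_real r \<and> (r = 0 \<longrightarrow> f = 0)"
proof -
  let ?r = "\<Sum>k\<le>degree f. (cmod (gint (herm k * f)))\<^sup>2 / herm_norm k"
  have nn: "(cmod (gint (herm k * f)))\<^sup>2 / herm_norm k \<ge> 0" for k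
    using herm_norm_pos[of k] by simp
  have "f = 0" if "?r = 0"
  proof -
    have "\<forall>k\<in>{..degree f}. (cmod (gint (herm k * f)))\<^sup>2 / herm_norm k = 0"
      using that nn by (subst (asm) sum_nonneg_eq_0_iff) auto
    then have "gint (herm (degree f) * f) = 0" by simp
    then show "f = 0" by (simp add: gint_herm_top)
  qed
  then show ?thesis
    using gint_norm_square[of f "degree f"] nn by (intro exI[of _ ?r]) (auto intro: sum_nonneg)
qed

subsection \<open>Matrix polynomials against the Gaussian functional\<close>

definition cadjp :: "('n::finite) pmat \<Rightarrow> 'n pmat" where
  "cadjp P = (\<chi> i j. map_poly cnj (P $ j $ i))"

definition gmat :: "('n::finite) pmat \<Rightarrow> 'n cmat" where
  "gmat P = (\<chi> i j. gint (P $ i $ j))"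

lemma matrix_mult_entry: "(A ** B) $ i $ j = (\<Sum>k\<in>UNIV. A $ i $ k * B $ k $ j)"
  by (simp add: matrix_matrix_mult_def)

lemma pconst_mult_entry: "(pconst c ** P) $ i $ j = (\<Sum>k\<in>UNIV. smult (c $ i $ k) (P $ k $ j))"
  by (simp add: matrix_mult_entry pconst_def)

lemma cadjp_cadjp [simp]: "cadjp (cadjp P) = P"
  by (simp add: cadjp_def vec_eq_iff)

lemma cadjp_mult: "cadjp (P ** Q) = cadjp Q ** cadjp P"
  by (simp add: cadjp_def vec_eq_iff matrix_mult_entry map_poly_cnj_sum map_poly_cnj_mult mult.commute)

lemma cadjp_add: "cadjp (P + Q) = cadjp P + cadjp Q"
  by (simp add: cadjp_def vec_eq_iff map_poly_cnj_add)

lemma cadjp_mat1 [simp]: "cadjp (mat 1) = mat 1"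
  by (simp add: cadjp_def vec_eq_iff mat_def map_poly_pCons)

lemma cadj_0 [simp]: "cadj 0 = 0"
  by (simp add: cadj_def vec_eq_iff)

lemma gmat_cadjp: "gmat (cadjp P) = cadj (gmat P)"
  by (simp add: gmat_def cadjp_def cadj_def vec_eq_iff gint_cnj)

lemma gmat_add: "gmat (P + Q) = gmat P + gmat Q"
  by (simp add: gmat_def vec_eq_iff gint_add)

lemma gmat_0 [simp]: "gmat 0 = 0"
  by (simp add: gmat_def vec_eq_iff)

lemma gmat_sum: "gmat (sum f A) = (\<Sum>x\<in>A. gmat (f x))"
  by (induction A rule: infinite_finite_induct) (auto simp: gmat_add)

lemma gmat_pconst_mult: "gmat (pconst c ** P) = c ** gmat P"
  by (simp add: gmat_def vec_eq_iff pconst_mult_entry matrix_mult_entry[of c] gint_sum gint_smult)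

lemma peval_mult: "peval (P ** Q) x = peval P x ** peval Q x"
  by (simp add: peval_def vec_eq_iff matrix_mult_entry poly_sum)

lemma cadj_peval: "cadj (peval P x) = peval (cadjp P) x"
  by (simp add: peval_def cadj_def cadjp_def vec_eq_iff)

lemma peval_eq_sum:
  assumes "\<And>i j. degree (P $ i $ j) \<le> n"
  shows "peval P x = (\<Sum>l\<le>n. x ^ l *\<^sub>R pcoeff P l)"
proof -
  have "poly (P $ i $ j) (of_real x) = (\<Sum>l\<le>n. x ^ l *\<^sub>R coeff (P $ i $ j) l)" for i j
    unfolding poly_altdef
    by (simp add: scaleR_conv_of_real)
       (use assms in \<open>auto intro!: sum.mono_neutral_cong_left simp: coeff_eq_0 mult.commute le_degree\<close>)
  then show ?thesis
    by (simp add: vec_eq_iff peval_def pcoeff_def)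
qed

lemma degree_entry_bound: "\<exists>n. \<forall>i j. degree ((P :: ('n::finite) pmat) $ i $ j) \<le> n"
proof (intro exI allI)
  fix i j
  show "degree (P $ i $ j) \<le> (\<Sum>i\<in>UNIV. \<Sum>j\<in>UNIV. degree (P $ i $ j))"
    by (rule order.trans[OF member_le_sum[of j UNIV "\<lambda>j. degree (P $ i $ j)"]
          member_le_sum[of i UNIV "\<lambda>i. \<Sum>j\<in>UNIV. degree (P $ i $ j)"]]) auto
qed

text \<open>The bridge from the algebraic functional to the Lebesgue integral. The extra power of
  \<open>x\<close> serves the moment condition in \<open>weight_matrix\<close>.\<close>

lemma has_integral_gmat:
  "has_bochner_integral lborel (\<lambda>x. (exp (- x\<^sup>2) * x ^ m) *\<^sub>R peval P x) (gmat (mat ([:0, 1:] ^ m) ** P))"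
proof -
  obtain n where n: "\<And>i j. degree (P $ i $ j) \<le> n" using degree_entry_bound[of P] by blast
  have "has_bochner_integral lborel (\<lambda>x. \<Sum>l\<le>n. (exp (- x\<^sup>2) * x ^ (m + l)) *\<^sub>R pcoeff P l)
      (\<Sum>l\<le>n. gauss_moment (m + l) *\<^sub>R pcoeff P l)"
    by (intro has_bochner_integral_sum has_bochner_integral_scaleR_left has_integral_gauss_moment)
  also have "(\<lambda>x. \<Sum>l\<le>n. (exp (- x\<^sup>2) * x ^ (m + l)) *\<^sub>R pcoeff P l)
      = (\<lambda>x. (exp (- x\<^sup>2) * x ^ m) *\<^sub>R peval P x)"
    by (simp add: peval_eq_sum[OF n] scaleR_sum_right power_add mult.assoc)
  also have "(\<Sum>l\<le>n. gauss_moment (m + l) *\<^sub>R pcoeff P l) = gmat (mat ([:0, 1:] ^ m) ** P)"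
  proof -
    have "gint ([:0, 1:] ^ m * P $ i $ j) = (\<Sum>l\<le>n. gauss_moment (m + l) *\<^sub>R coeff (P $ i $ j) l)" for i j
    proof -
      have m: "[:0, 1:] ^ m = monom (1::complex) m" by (simp add: monom_altdef)
      have "degree (monom 1 m * P $ i $ j) \<le> m + n"
        using n[of i j] degree_mult_le[of "monom 1 m" "P $ i $ j"] by (simp add: degree_monom_eq)
      then have "gint (monom 1 m * P $ i $ j) =
          (\<Sum>l\<in>{0..m + n}. of_real (gauss_moment l) * coeff (monom 1 m * P $ i $ j) l)"
        by (simp add: gint_bound atLeast0AtMost)
      also have "\<dots> = (\<Sum>l\<in>{0+m..n+m}. of_real (gauss_moment l) * coeff (monom 1 m * P $ i $ j) l)"
        by (rule sum.mono_neutral_right) (auto simp: coeff_monom_mult)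
      also have "\<dots> = (\<Sum>l\<le>n. gauss_moment (m + l) *\<^sub>R coeff (P $ i $ j) l)"
        by (subst sum.shift_bounds_cl_nat_ivl)
           (simp add: coeff_monom_mult atLeast0AtMost scaleR_conv_of_real add.commute)
      finally show ?thesis by (simp add: m)
    qed
    then show ?thesis
      by (simp add: vec_eq_iff gmat_def mat_mult_entry pcoeff_def)
  qed
  finally show ?thesis .
qed

lemma integral_gmat: "(LINT x|lborel. exp (- x\<^sup>2) *\<^sub>R peval P x) = gmat P"
  using has_integral_gmat[of 0 P] by (simp add: has_bochner_integral_integral_eq)

lemma matrix_scaleR_left: "(c *\<^sub>R A) ** B = c *\<^sub>R (A ** (B :: ('n::finite) cmat))"
  by (simp add: vec_eq_iff matrix_mult_entry scaleR_sum_right)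

lemma matrix_scaleR_right: "A ** (c *\<^sub>R B) = c *\<^sub>R (A ** (B :: ('n::finite) cmat))"
  by (simp add: vec_eq_iff matrix_mult_entry scaleR_sum_right)

lemma winner_gauss:
  assumes "\<And>x. W x = exp (- x\<^sup>2) *\<^sub>R peval S x"
  shows "winner UNIV W P Q = gmat (P ** S ** cadjp Q)"
  unfolding winner_def set_lebesgue_integral_def assms cadj_peval
  by (simp add: matrix_scaleR_left matrix_scaleR_right peval_mult[symmetric] integral_gmat)

subsection \<open>Derivatives of polynomials times the Gaussian\<close>

text \<open>The operator \<open>2x - \<partial>\<close>: up to sign it is \<partial> conjugated by
  the Gaussian, and it is the adjoint of \<partial> for \<open>gmat\<close>.\<close>

definition gdelta :: "('n::finite) pmat \<Rightarrow> 'n pmat" where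
  "gdelta P = mat [:0, 2:] ** P - pmat_deriv P"

lemma has_vector_derivative_gauss:
  fixes P :: "('n::finite) pmat"
  shows "((\<lambda>t. exp (- t\<^sup>2) *\<^sub>R peval P t) has_vector_derivative - (exp (- x\<^sup>2) *\<^sub>R peval (gdelta P) x)) (at x)"
proof -
  have 1: "((\<lambda>t. exp (- t\<^sup>2) *\<^sub>R poly p (complex_of_real t)) has_vector_derivative
      - (exp (- x\<^sup>2) *\<^sub>R poly ([:0, 2:] * p - pderiv p) (of_real x))) (at x)" for p
  proof -
    have "((\<lambda>t. poly p (complex_of_real t)) has_vector_derivative poly (pderiv p) (of_real x)) (at x)"
      using field_vector_diff_chain_at[of complex_of_real 1 x "poly p" "poly (pderiv p) (of_real x)"]
        has_vector_derivative_of_real[of "\<lambda>x. x" 1 "at x"]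
      by (auto simp: o_def intro: derivative_eq_intros)
    moreover have "((\<lambda>t. exp (- t\<^sup>2)) has_real_derivative - 2 * x * exp (- x\<^sup>2)) (at x)"
      by (auto intro!: derivative_eq_intros)
    ultimately have "((\<lambda>t. exp (- t\<^sup>2) *\<^sub>R poly p (complex_of_real t)) has_vector_derivative
        exp (- x\<^sup>2) *\<^sub>R poly (pderiv p) (of_real x) + (- 2 * x * exp (- x\<^sup>2)) *\<^sub>R poly p (of_real x)) (at x)"
      by (intro has_vector_derivative_scaleR)
    also have "exp (- x\<^sup>2) *\<^sub>R poly (pderiv p) (of_real x) + (- 2 * x * exp (- x\<^sup>2)) *\<^sub>R poly p (of_real x)
        = - (exp (- x\<^sup>2) *\<^sub>R poly ([:0, 2:] * p - pderiv p) (of_real x))"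
      by (simp add: scaleR_conv_of_real algebra_simps)
    finally show ?thesis .
  qed
  have comp: "(f has_vector_derivative D) (at x)"
    if "\<And>i j. ((\<lambda>t. f t $ i $ j) has_vector_derivative D $ i $ j) (at x)" for f :: "real \<Rightarrow> 'n cmat" and D
    using that unfolding has_vector_derivative_def
    by (subst has_derivative_componentwise_within[of f])
       (auto simp: Basis_vec_def inner_axis has_derivative_componentwise_within[of "\<lambda>t. f t $ _ $ _"])
  show ?thesis
    by (rule comp) (use 1 in \<open>simp add: peval_def gdelta_def mat_mult_entry pmat_deriv_def del: mult_pCons_left\<close>)
qed

lemma fderiv_gauss:
  "fderiv k (\<lambda>t. exp (- t\<^sup>2) *\<^sub>R peval P t) = (\<lambda>t. (-1) ^ k *\<^sub>R (exp (- t\<^sup>2) *\<^sub>R peval ((gdelta ^^ k) P) t))"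
proof (induction k)
  case (Suc k)
  have "((\<lambda>t. (-1) ^ k *\<^sub>R (exp (- t\<^sup>2) *\<^sub>R peval ((gdelta ^^ k) P) t)) has_vector_derivative
      (-1) ^ k *\<^sub>R - (exp (- x\<^sup>2) *\<^sub>R peval (gdelta ((gdelta ^^ k) P)) x)) (at x)" for x
    by (intro bounded_linear.has_vector_derivative[OF bounded_linear_scaleR_right] has_vector_derivative_gauss)
  then have "vector_derivative (\<lambda>t. (-1) ^ k *\<^sub>R (exp (- t\<^sup>2) *\<^sub>R peval ((gdelta ^^ k) P) t)) (at x) =
      (-1) ^ k *\<^sub>R - (exp (- x\<^sup>2) *\<^sub>R peval (gdelta ((gdelta ^^ k) P)) x)" for x
    by (rule vector_derivative_at)
  moreover have "fderiv (Suc k) f = (\<lambda>x. vector_derivative (fderiv k f) (at x))" for f :: "real \<Rightarrow> 'a cmat"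
    by (simp add: fderiv_def)
  ultimately show ?case
    by (simp add: Suc del: funpow.simps) simp
qed (simp add: fderiv_def)

lemma fderiv_gauss_differentiable:
  "fderiv k (\<lambda>t. exp (- t\<^sup>2) *\<^sub>R peval P t) differentiable (at x)"
  unfolding fderiv_gauss
  by (rule differentiableI_vector,
      rule bounded_linear.has_vector_derivative[OF bounded_linear_scaleR_right has_vector_derivative_gauss])

lemma gmat_deriv_mult: "gmat (pmat_deriv P ** R) = gmat (P ** gdelta R)"
proof -
  have "(P ** gdelta R) $ i $ j = (\<Sum>k\<in>UNIV. P $ i $ k * ([:0, 2:] * R $ k $ j - pderiv (R $ k $ j)))" for i j
    by (simp add: matrix_mult_entry[of P] gdelta_def mat_mult_entry pmat_deriv_def del: mult_pCons_left)
  moreover have "(pmat_deriv P ** R) $ i $ j = (\<Sum>k\<in>UNIV. pderiv (P $ i $ k) * R $ k $ j)" for i j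
    by (simp add: matrix_mult_entry pmat_deriv_def)
  ultimately show ?thesis
    by (simp add: vec_eq_iff gmat_def gint_sum gint_pderiv_mult del: mult_pCons_left)
qed

lemma gmat_deriv_pow_mult: "gmat ((pmat_deriv ^^ k) P ** R) = gmat (P ** (gdelta ^^ k) R)"
  by (induction k arbitrary: R) (simp_all add: gmat_deriv_mult flip: funpow_swap1)

lemma cadjp_gdelta: "cadjp (gdelta R) = gdelta (cadjp R)"
  by (simp add: cadjp_def gdelta_def vec_eq_iff mat_mult_entry pmat_deriv_def map_poly_cnj_diff
      map_poly_cnj_mult pderiv_map_poly_cnj map_poly_pCons del: mult_pCons_left)

lemma cadjp_gdelta_pow: "cadjp ((gdelta ^^ k) R) = (gdelta ^^ k) (cadjp R)"
  by (induction k) (simp_all add: cadjp_gdelta)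

subsection \<open>Orthogonal polynomials of a factorized Gaussian weight\<close>

text \<open>A strict bound, so that \<open>deg_below 0\<close> singles out the zero matrix;
  \<open>pdegree\<close> cannot tell zero from a constant.\<close>

definition deg_below :: "nat \<Rightarrow> ('n::finite) pmat \<Rightarrow> bool" where
  "deg_below n P \<longleftrightarrow> (\<forall>k\<ge>n. pcoeff P k = 0)"

lemma deg_below_iff_coeff: "deg_below n P \<longleftrightarrow> (\<forall>k\<ge>n. \<forall>i j. coeff (P $ i $ j) k = 0)"
  by (simp add: deg_below_def pcoeff_def vec_eq_iff)

lemma pcoeff_add: "pcoeff (P + Q) k = pcoeff P k + pcoeff Q k"
  and pcoeff_diff: "pcoeff (P - Q) k = pcoeff P k - pcoeff Q k"
  and pcoeff_0 [simp]: "pcoeff 0 k = 0"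
  by (simp_all add: pcoeff_def vec_eq_iff)

lemma pcoeff_pconst_mult: "pcoeff (pconst c ** P) k = c ** pcoeff P k"
  by (simp add: pcoeff_def vec_eq_iff pconst_mult_entry matrix_mult_entry[of c] coeff_sum)

lemma deg_below_add: "deg_below n P \<Longrightarrow> deg_below n Q \<Longrightarrow> deg_below n (P + Q)"
  and deg_below_diff: "deg_below n P \<Longrightarrow> deg_below n Q \<Longrightarrow> deg_below n (P - Q)"
  and deg_below_0 [simp]: "deg_below n 0"
  and deg_below_pconst_mult: "deg_below n P \<Longrightarrow> deg_below n (pconst c ** P)"
  and deg_below_mono: "deg_below n P \<Longrightarrow> n \<le> m \<Longrightarrow> deg_below m P"
  by (simp_all add: deg_below_def pcoeff_add pcoeff_diff pcoeff_pconst_mult)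

lemma deg_below_sum: "(\<And>x. x \<in> A \<Longrightarrow> deg_below n (f x)) \<Longrightarrow> deg_below n (sum f A)"
  by (induction A rule: infinite_finite_induct) (auto simp: deg_below_add)

lemma deg_below_zeroD: "deg_below 0 P \<Longrightarrow> P = 0"
  by (simp add: deg_below_iff_coeff vec_eq_iff poly_eq_iff)

lemma pdegree_le_iff: "pdegree P \<le> n \<longleftrightarrow> (\<forall>i j. degree (P $ i $ j) \<le> n)"
  unfolding pdegree_def by (subst Max_le_iff) auto

lemma pdegree_le_iff_below: "pdegree P \<le> n \<longleftrightarrow> deg_below (Suc n) P"
proof -
  have "degree p \<le> n \<longleftrightarrow> (\<forall>k\<ge>Suc n. coeff p k = 0)" for p :: "complex poly"
    using degree_le[of n p] by (auto simp: coeff_eq_0 Suc_le_eq)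
  then show ?thesis unfolding pdegree_le_iff deg_below_iff_coeff by blast
qed

lemma pdegree_eqI: "deg_below (Suc n) P \<Longrightarrow> pcoeff P n \<noteq> 0 \<Longrightarrow> pdegree P = n"
  using pdegree_le_iff_below[of P n] pdegree_le_iff_below[of P "pdegree P"]
  unfolding deg_below_def by (metis antisym not_less_eq_eq order_refl)

lemma deg_below_bound: "\<exists>n. deg_below n P"
  using pdegree_le_iff_below by blast

lemma pconst_mult: "pconst (A ** B) = pconst A ** pconst B"
proof -
  have "(pconst A ** pconst B) $ i $ j = pconst (A ** B) $ i $ j" for i j
    unfolding pconst_mult_entry by (simp add: pconst_def matrix_mult_entry[of A] sum_to_poly)
  then show ?thesis by (simp add: vec_eq_iff)
qed
lemma pconst_mat1 [simp]: "pconst (mat 1) = mat 1"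
  by (simp add: pconst_def vec_eq_iff mat_def)
lemma pconst_0 [simp]: "pconst 0 = 0"
  by (simp add: pconst_def vec_eq_iff)

lemma pmat_deriv_pconst_mult: "pmat_deriv (pconst c ** P) = pconst c ** pmat_deriv P"
proof -
  have "pmat_deriv (pconst c) = 0" by (simp add: pmat_deriv_def pconst_def vec_eq_iff)
  then show ?thesis by (simp add: pmat_deriv_mult)
qed

lemma pmat_deriv_pow_pconst_mult: "(pmat_deriv ^^ k) (pconst c ** P) = pconst c ** (pmat_deriv ^^ k) P"
  by (induction k) (auto simp: pmat_deriv_pconst_mult)

lemma dop_act_pconst_mult: "(pconst c ** P) \<cdot>\<^sub>D D = pconst c ** (P \<cdot>\<^sub>D D)"
  by (simp add: dop_act_def pmat_deriv_pow_pconst_mult matrix_mult_sum_right matrix_mul_assoc)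

lemma dop_act_add_left: "(P + Q) \<cdot>\<^sub>D D = P \<cdot>\<^sub>D D + Q \<cdot>\<^sub>D D"
  by (simp add: dop_act_def pmat_deriv_pow_add pmat_add_rdistrib sum.distrib)

lemma dop_act_zero_left [simp]: "0 \<cdot>\<^sub>D D = 0"
  by (simp add: dop_act_def)

lemma dop_act_sum_left: "(sum f A) \<cdot>\<^sub>D D = (\<Sum>x\<in>A. f x \<cdot>\<^sub>D D)"
  by (induction A rule: infinite_finite_induct) (auto simp: dop_act_add_left)

lemma matrix_inv_mult:
  assumes "invertible A"
  shows "A ** matrix_inv A = mat 1" "matrix_inv A ** A = mat 1"
  using someI_ex[OF assms[unfolded invertible_def]] unfolding matrix_inv_def by auto

text \<open>Leading coefficients are removed one after the other. The coefficients stand on the left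
  because constant left factors commute with the right action of operators.\<close>

lemma deg_below_expansion:
  assumes B: "\<And>k. deg_below (Suc k) (B k)" "\<And>k. invertible (pcoeff (B k) k)"
    and "deg_below n P"
  shows "\<exists>c. P = (\<Sum>k<n. pconst (c k) ** B k)"
  using assms(3)
proof (induction n arbitrary: P)
  case 0
  then show ?case by (simp add: deg_below_zeroD)
next
  case (Suc n)
  define d where "d = pcoeff P n ** matrix_inv (pcoeff (B n) n)"
  have "pcoeff (P - pconst d ** B n) n = 0"
    using matrix_inv_mult(2)[OF B(2)[of n]]
    by (simp add: pcoeff_diff pcoeff_pconst_mult d_def flip: matrix_mul_assoc)
  moreover have "deg_below (Suc n) (P - pconst d ** B n)"
    using Suc.prems B(1) by (intro deg_below_diff deg_below_pconst_mult) auto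
  ultimately have "deg_below n (P - pconst d ** B n)"
    unfolding deg_below_def by (metis antisym not_less_eq_eq)
  from Suc.IH[OF this] obtain c where "P - pconst d ** B n = (\<Sum>k<n. pconst (c k) ** B k)" ..
  then have "P = (\<Sum>k<Suc n. pconst ((c(n := d)) k) ** B k)"
    by (simp add: algebra_simps)
  then show ?case by (rule exI[of _ "c(n := d)"])
qed

text \<open>Right multiplication by \<open>T\<close> carries the weighted form to the plain Gaussian
  form; the right inverse \<open>Ti\<close> makes this map injective and hence the form
  definite.\<close>

locale gauss_weight =
  fixes T Ti :: "('n::finite) pmat" and W :: "real \<Rightarrow> 'n cmat"
  assumes weight: "\<And>x. W x = exp (- x\<^sup>2) *\<^sub>R peval (T ** cadjp T) x"
    and T_inverse: "T ** Ti = mat 1"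
begin

definition ip :: "'n pmat \<Rightarrow> 'n pmat \<Rightarrow> 'n cmat" where
  "ip P Q = gmat ((P ** T) ** cadjp (Q ** T))"

lemma winner_eq_ip: "winner UNIV W P Q = ip P Q"
  unfolding winner_gauss[of W, OF weight] ip_def cadjp_mult by (simp add: matrix_mul_assoc)

lemma ip_add: "ip (P + Q) R = ip P R + ip Q R"
  by (simp add: ip_def pmat_add_rdistrib gmat_add)

lemma ip_0 [simp]: "ip 0 R = 0"
  by (simp add: ip_def)

lemma ip_sum: "ip (sum f A) R = (\<Sum>x\<in>A. ip (f x) R)"
  by (induction A rule: infinite_finite_induct) (auto simp: ip_add)

lemma ip_pconst: "ip (pconst c ** P) Q = c ** ip P Q"
  by (simp add: ip_def gmat_pconst_mult flip: matrix_mul_assoc)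

lemma ip_adj: "ip Q P = cadj (ip P Q)"
  by (simp add: ip_def cadjp_mult flip: gmat_cadjp)

text \<open>A diagonal entry of \<open>ip P P\<close> is the sum of the squared Gaussian norms of
  one row of \<open>P ** T\<close>, so its vanishing kills that row.\<close>

lemma ip_self_eq_0: assumes "ip P P = 0" shows "P = 0"
proof -
  let ?R = "P ** T"
  have "?R $ i $ k = 0" for i k
  proof -
    have "\<forall>k. \<exists>r\<ge>0. gint (?R $ i $ k * map_poly cnj (?R $ i $ k)) = complex_of_real r \<and> (r = 0 \<longrightarrow> ?R $ i $ k = 0)"
      using gint_norm_square_nonneg by blast
    then obtain r where r: "\<And>k. r k \<ge> 0" "\<And>k. r k = 0 \<Longrightarrow> ?R $ i $ k = 0"
      "\<And>k. gint (?R $ i $ k * map_poly cnj (?R $ i $ k)) = complex_of_real (r k)"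
      by metis
    have "ip P P $ i $ i = (\<Sum>k\<in>UNIV. gint (?R $ i $ k * map_poly cnj (?R $ i $ k)))"
      by (simp add: ip_def gmat_def matrix_mult_entry[of ?R] cadjp_def gint_sum)
    then have "complex_of_real (\<Sum>k\<in>UNIV. r k) = 0"
      using assms by (simp add: r)
    then have "(\<Sum>k\<in>UNIV. r k) = 0" by (simp only: of_real_eq_0_iff)
    then show ?thesis using r by (simp add: sum_nonneg_eq_0_iff)
  qed
  then have "?R = 0" by (simp add: vec_eq_iff)
  then have "P ** T ** Ti = 0" by simp
  then show ?thesis by (simp add: T_inverse flip: matrix_mul_assoc)
qed

end

locale gauss_orthogonal_basis = gauss_weight +
  fixes B :: "nat \<Rightarrow> 'a pmat"
  assumes B_degree: "\<And>n. deg_below (Suc n) (B n)"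
    and B_lead: "\<And>n. invertible (pcoeff (B n) n)"
    and B_orth: "\<And>n Q. deg_below n Q \<Longrightarrow> ip (B n) Q = 0"
begin

lemma ip_B_right: "deg_below n Q \<Longrightarrow> ip Q (B n) = 0"
  by (simp add: ip_adj[of _ "B n"] B_orth)

lemma orthogonal_expansion:
  assumes "\<And>Q. deg_below n Q \<Longrightarrow> ip P Q = 0" "deg_below N P"
  shows "\<exists>c. P = (\<Sum>k\<in>{n..<N}. pconst (c k) ** B k)"
proof -
  obtain c where c: "P = (\<Sum>k<N. pconst (c k) ** B k)"
    using deg_below_expansion[OF B_degree B_lead assms(2)] by blast
  \<comment> \<open>\<open>R\<close> collects the components below \<open>n\<close>. It is
    orthogonal to \<open>P\<close> and to \<open>U\<close>, hence to itself. The \<open>min\<close>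
    covers \<open>N < n\<close>, where the range of \<open>U\<close> is empty.\<close>
  define R where "R = (\<Sum>k<min n N. pconst (c k) ** B k)"
  define U where "U = (\<Sum>k\<in>{n..<N}. pconst (c k) ** B k)"
  have PRU: "P = R + U"
    unfolding c R_def U_def
    by (subst sum.union_disjoint[symmetric]) (auto intro!: sum.cong)
  have R: "deg_below n R"
    unfolding R_def by (intro deg_below_sum deg_below_pconst_mult deg_below_mono[OF B_degree]) auto
  have "ip U R = 0"
    unfolding U_def ip_sum ip_pconst
    by (intro sum.neutral ballI) (simp add: B_orth deg_below_mono[OF R])
  moreover have "ip P R = 0" using assms(1) R by simp
  ultimately have "ip R R = 0" using ip_add[of R U R] by (simp add: PRU)
  then have "R = 0" by (rule ip_self_eq_0)
  then show ?thesis using PRU U_def by auto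
qed

lemma orthogonal_multiple:
  assumes "\<And>Q. deg_below n Q \<Longrightarrow> ip P Q = 0" "deg_below (Suc n) P"
  shows "\<exists>c. P = pconst c ** B n"
  using orthogonal_expansion[of n P "Suc n"] assms by simp blast

text \<open>Normalising leading coefficients gives a monic orthogonal family; the uniqueness needed
  for the definite description comes from \<open>orthogonal_multiple\<close>.\<close>

lemma monic_ops_eq: "monic_ops UNIV W n = pconst (matrix_inv (pcoeff (B n) n)) ** B n"
proof -
  define P where "P n = pconst (matrix_inv (pcoeff (B n) n)) ** B n" for n
  have lead: "pcoeff (P n) n = mat 1" for n
    using matrix_inv_mult(2)[OF B_lead[of n]] by (simp add: P_def pcoeff_pconst_mult)
  have below: "deg_below (Suc n) (P n)" for n
    by (simp add: P_def deg_below_pconst_mult B_degree)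
  have mat1: "mat 1 \<noteq> (0 :: 'a cmat)"
    by (simp add: vec_eq_iff mat_def)
  have low: "ip (P n) Q = 0" if "deg_below n Q" for n Q
    by (simp add: P_def ip_pconst B_orth that)
  have "ip (P n) (P m) = 0" if "n \<noteq> m" for n m
  proof (cases "m < n")
    case True
    then show ?thesis by (intro low deg_below_mono[OF below]) auto
  next
    case False
    then have "ip (P m) (P n) = 0" using that by (intro low deg_below_mono[OF below]) auto
    then show ?thesis by (simp add: ip_adj[of "P n"])
  qed
  then have P: "monic_orthogonal UNIV W P"
    unfolding monic_orthogonal_def winner_eq_ip using lead below mat1 by (auto intro!: pdegree_eqI)
  have "P' = P" if "monic_orthogonal UNIV W P'" for P'
  proof
    fix n
    have P': "deg_below (Suc n) (P' n)" "pcoeff (P' n) n = mat 1" "n \<noteq> m \<Longrightarrow> ip (P' n) (P' m) = 0" for n m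
      using that unfolding monic_orthogonal_def winner_eq_ip
      by (auto simp flip: pdegree_le_iff_below)
    have "ip (P' n) Q = 0" if Q: "deg_below n Q" for Q
    proof -
      have "invertible (mat 1 :: 'a cmat)"
        unfolding invertible_def by (intro exI[of _ "mat 1"]) simp
      then obtain c where "Q = (\<Sum>k<n. pconst (c k) ** P' k)"
        using deg_below_expansion[OF P'(1) _ Q] P'(2) by auto
      then have "ip Q (P' n) = 0"
        by (auto simp: ip_sum ip_pconst P'(3) intro!: sum.neutral)
      then show ?thesis by (simp add: ip_adj[of "P' n"])
    qed
    then obtain c where c: "P' n = pconst c ** B n"
      using orthogonal_multiple P'(1) by blast
    then have "c ** pcoeff (B n) n = mat 1"
      using P'(2)[of n] by (simp add: pcoeff_pconst_mult)
    then have "c ** pcoeff (B n) n ** matrix_inv (pcoeff (B n) n) = matrix_inv (pcoeff (B n) n)"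
      by simp
    then have "c = matrix_inv (pcoeff (B n) n)"
      using matrix_inv_mult(1)[OF B_lead[of n]] by (simp flip: matrix_mul_assoc)
    then show "P' n = P n" by (simp add: c P_def)
  qed
  then have "monic_ops UNIV W = P"
    unfolding monic_ops_def by (intro the_equality P)
  then show ?thesis by (simp add: P_def)
qed

text \<open>Passing from the monic family to \<open>B\<close> only conjugates the eigenvalue
  matrices, so no explicit monic polynomials are needed.\<close>

lemma bochner_algebra_iff:
  "D \<in> bochner_algebra UNIV W \<longleftrightarrow> (\<forall>n. \<exists>c. B n \<cdot>\<^sub>D D = pconst c ** B n)"
proof -
  have "(\<exists>c. monic_ops UNIV W n \<cdot>\<^sub>D D = pconst c ** monic_ops UNIV W n) \<longleftrightarrow>
      (\<exists>c. B n \<cdot>\<^sub>D D = pconst c ** B n)" for n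
  proof -
    let ?A = "pcoeff (B n) n" and ?I = "matrix_inv (pcoeff (B n) n)"
    have inv: "?A ** ?I = mat 1" "?I ** ?A = mat 1" using matrix_inv_mult[OF B_lead] by auto
    show ?thesis
    proof
      assume "\<exists>c. monic_ops UNIV W n \<cdot>\<^sub>D D = pconst c ** monic_ops UNIV W n"
      then obtain c where c: "pconst ?I ** (B n \<cdot>\<^sub>D D) = pconst (c ** ?I) ** B n"
        by (auto simp: monic_ops_eq dop_act_pconst_mult pconst_mult matrix_mul_assoc)
      have "B n \<cdot>\<^sub>D D = pconst (?A ** ?I) ** (B n \<cdot>\<^sub>D D)" by (simp add: inv)
      also have "\<dots> = pconst ?A ** (pconst ?I ** (B n \<cdot>\<^sub>D D))"
        unfolding pconst_mult by (rule matrix_mul_assoc[symmetric])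
      also have "\<dots> = pconst (?A ** (c ** ?I)) ** B n"
        unfolding c pconst_mult by (simp only: matrix_mul_assoc)
      finally show "\<exists>c. B n \<cdot>\<^sub>D D = pconst c ** B n" ..
    next
      assume "\<exists>c. B n \<cdot>\<^sub>D D = pconst c ** B n"
      then obtain c where c: "B n \<cdot>\<^sub>D D = pconst c ** B n" ..
      have "monic_ops UNIV W n \<cdot>\<^sub>D D = pconst (?I ** c) ** B n"
        by (simp add: monic_ops_eq dop_act_pconst_mult c pconst_mult matrix_mul_assoc)
      also have "\<dots> = pconst (?I ** c ** (?A ** ?I)) ** B n" by (simp add: inv)
      also have "\<dots> = pconst (?I ** c ** ?A) ** monic_ops UNIV W n"
        by (simp add: monic_ops_eq pconst_mult matrix_mul_assoc)
      finally show "\<exists>c. monic_ops UNIV W n \<cdot>\<^sub>D D = pconst c ** monic_ops UNIV W n" ..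
    qed
  qed
  then show ?thesis by (simp add: bochner_algebra_def)
qed

lemma bochner_deg_below:
  assumes "D \<in> bochner_algebra UNIV W" "deg_below n P"
  shows "deg_below n (P \<cdot>\<^sub>D D)"
proof -
  obtain c where "P = (\<Sum>k<n. pconst (c k) ** B k)"
    using deg_below_expansion[OF B_degree B_lead assms(2)] by blast
  moreover obtain m where "\<And>k. B k \<cdot>\<^sub>D D = pconst (m k) ** B k"
    using assms(1) unfolding bochner_algebra_iff by metis
  ultimately show ?thesis
    by (auto simp: dop_act_sum_left dop_act_pconst_mult
        intro!: deg_below_sum deg_below_pconst_mult deg_below_mono[OF B_degree])
qed

text \<open>What is orthogonal to degrees below \<open>n\<close> is spanned by the
  \<open>B k\<close> with \<open>k >= n\<close>, which the operator keeps. This expresses that the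
  adjoint preserves degrees without constructing an adjoint inside the algebra.\<close>

lemma bochner_orthogonal:
  assumes "D \<in> bochner_algebra UNIV W" "\<And>Q. deg_below n Q \<Longrightarrow> ip P Q = 0" "deg_below n R"
  shows "ip (P \<cdot>\<^sub>D D) R = 0"
proof -
  obtain N where "deg_below N P" using deg_below_bound by blast
  then obtain c where "P = (\<Sum>k\<in>{n..<N}. pconst (c k) ** B k)"
    using orthogonal_expansion[OF assms(2)] by blast
  moreover obtain m where "\<And>k. B k \<cdot>\<^sub>D D = pconst (m k) ** B k"
    using assms(1) unfolding bochner_algebra_iff by metis
  ultimately show ?thesis
    by (auto simp: dop_act_sum_left dop_act_pconst_mult ip_sum ip_pconst
        B_orth deg_below_mono[OF assms(3)] intro!: sum.neutral)
qed

end

subsection \<open>Leading coefficients of degree-filtered operators\<close>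

text \<open>The falling factorial \<open>n (n - 1) ... (n - i + 1)\<close>, formed with complex
  differences so that it vanishes by itself for \<open>i > n\<close>.\<close>

definition dfall :: "nat \<Rightarrow> nat \<Rightarrow> complex" where
  "dfall n i = (\<Prod>j<i. of_nat n - of_nat j)"

lemma dfall_eq_0: "n < i \<Longrightarrow> dfall n i = 0"
  by (auto simp: dfall_def intro!: prod_zero bexI[of _ n])

lemma coeff_higher_pderiv_dfall: "i \<le> n \<Longrightarrow> coeff ((pderiv ^^ i) f) (n - i) = dfall n i * coeff f n"
proof (induction i)
  case (Suc i)
  then have "Suc (n - Suc i) = n - i" by simp
  then have "coeff ((pderiv ^^ Suc i) f) (n - Suc i) = of_nat (n - i) * coeff ((pderiv ^^ i) f) (n - i)"
    by (simp add: coeff_pderiv del: of_nat_Suc)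
  then show ?case using Suc by (simp add: dfall_def of_nat_diff)
qed (simp add: dfall_def)

lemma coeff_mult_top:
  assumes "\<And>k. k > m \<Longrightarrow> coeff u k = (0 :: complex)" "\<And>k. k > i \<Longrightarrow> coeff g k = 0"
  shows "coeff (u * g) (m + i) = coeff u m * coeff g i"
    and "k > m + i \<Longrightarrow> coeff (u * g) k = 0"
proof -
  have z: "coeff u l * coeff g (k - l) = 0" if "l \<le> k" "k \<ge> m + i" "l \<noteq> m \<or> k \<noteq> m + i" for k l
  proof -
    have "l > m \<or> k - l > i" using that by linarith
    then show ?thesis using assms by auto
  qed
  have "coeff (u * g) (m + i) = (\<Sum>l\<le>m + i. if l = m then coeff u m * coeff g i else 0)"
    unfolding coeff_mult by (intro sum.cong refl) (use z[of _ "m + i"] in auto)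
  then show "coeff (u * g) (m + i) = coeff u m * coeff g i" by simp
  show "coeff (u * g) k = 0" if "k > m + i"
    unfolding coeff_mult using that z by (intro sum.neutral) auto
qed

lemma coeff_higher_pderiv_mult:
  assumes f: "\<And>k. k > n \<Longrightarrow> coeff f k = (0 :: complex)" and g: "\<And>k. k > i \<Longrightarrow> coeff g k = 0"
  shows "coeff ((pderiv ^^ i) f * g) n = dfall n i * coeff f n * coeff g i"
    and "k > n \<Longrightarrow> coeff ((pderiv ^^ i) f * g) k = 0"
proof -
  have d: "k > n - i \<Longrightarrow> coeff ((pderiv ^^ i) f) k = 0" for k
    using f[of "k + i"] by (simp add: coeff_higher_pderiv)
  show "coeff ((pderiv ^^ i) f * g) n = dfall n i * coeff f n * coeff g i"
  proof (cases "i \<le> n")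
    case True
    then show ?thesis
      using coeff_mult_top(1)[of "n - i" "(pderiv ^^ i) f" i g] d g
      by (simp add: coeff_higher_pderiv_dfall)
  next
    case False
    then have "(pderiv ^^ i) f = 0" using f by (simp add: poly_eq_iff coeff_higher_pderiv)
    then show ?thesis using False by (simp add: dfall_eq_0)
  qed
  show "coeff ((pderiv ^^ i) f * g) k = 0" if "k > n"
  proof (cases "i \<le> n")
    case True
    then show ?thesis
      using coeff_mult_top(2)[of "n - i" "(pderiv ^^ i) f" i g k] d g that by simp
  next
    case False
    then have "(pderiv ^^ i) f = 0" using f by (simp add: poly_eq_iff coeff_higher_pderiv)
    then show ?thesis by simp
  qed
qed

text \<open>The matrix by which \<open>D\<close> multiplies leading coefficients of degree
  \<open>n\<close> on the right, as long as its \<open>i\<close>-th coefficient has degree at most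
  \<open>i\<close>.\<close>

definition dop_lead :: "('n::finite) dop \<Rightarrow> nat \<Rightarrow> 'n cmat" where
  "dop_lead D n = (\<chi> r s. \<Sum>i\<le>degree D. dfall n i * coeff (coeff D i $ r $ s) i)"

lemma pmat_deriv_pow_entry: "((pmat_deriv ^^ k) P) $ i $ j = (pderiv ^^ k) (P $ i $ j)"
  by (induction k) (simp_all add: pmat_deriv_def)

lemma dop_act_entry:
  "(P \<cdot>\<^sub>D D) $ i $ j = (\<Sum>l\<le>degree D. \<Sum>k\<in>UNIV. (pderiv ^^ l) (P $ i $ k) * coeff D l $ k $ j)"
  by (simp add: dop_act_def matrix_mult_entry pmat_deriv_pow_entry)

lemma
  assumes P: "deg_below (Suc n) P" and D: "\<And>i. i \<le> degree D \<Longrightarrow> pdegree (coeff D i) \<le> i"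
  shows pcoeff_dop_act: "pcoeff (P \<cdot>\<^sub>D D) n = pcoeff P n ** dop_lead D n"
    and deg_below_dop_act: "deg_below (Suc n) (P \<cdot>\<^sub>D D)"
proof -
  have f: "k > n \<Longrightarrow> coeff (P $ r $ s) k = 0" for k r s
    using P by (simp add: deg_below_iff_coeff)
  have g: "k > i \<Longrightarrow> coeff (coeff D i $ r $ s) k = 0" if "i \<le> degree D" for i k r s
    using D[OF that] by (simp add: pdegree_le_iff_below deg_below_iff_coeff)
  show "deg_below (Suc n) (P \<cdot>\<^sub>D D)"
    unfolding deg_below_iff_coeff dop_act_entry coeff_sum
    by (intro allI impI sum.neutral ballI coeff_higher_pderiv_mult(2)[OF f g]) auto
  have "pcoeff (P \<cdot>\<^sub>D D) n $ r $ s = (pcoeff P n ** dop_lead D n) $ r $ s" for r s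
  proof -
    have "pcoeff (P \<cdot>\<^sub>D D) n $ r $ s =
        (\<Sum>i\<le>degree D. \<Sum>k\<in>UNIV. dfall n i * coeff (P $ r $ k) n * coeff (coeff D i $ k $ s) i)"
      unfolding pcoeff_def dop_act_entry vec_lambda_beta coeff_sum
      by (intro sum.cong refl coeff_higher_pderiv_mult(1)[OF f g]) auto
    then show ?thesis
      by (subst (asm) sum.swap)
        (simp add: matrix_mult_entry dop_lead_def pcoeff_def sum_distrib_left mult.left_commute mult.assoc)
  qed
  then show "pcoeff (P \<cdot>\<^sub>D D) n = pcoeff P n ** dop_lead D n"
    by (simp add: vec_eq_iff)
qed

lemma degree_preservingI:
  assumes D: "\<And>i. i \<le> degree D \<Longrightarrow> pdegree (coeff D i) \<le> i" and inv: "\<And>n. invertible (dop_lead D n)"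
  shows "degree_preserving D"
  unfolding degree_preserving_def
proof (intro allI impI conjI)
  fix P :: "'a pmat" assume "P \<noteq> 0"
  define n where "n = pdegree P"
  have below: "deg_below (Suc n) P" by (simp add: n_def flip: pdegree_le_iff_below)
  have "pcoeff P n \<noteq> 0"
  proof
    assume "pcoeff P n = 0"
    then have *: "deg_below n P" using below unfolding deg_below_def by (metis antisym not_less_eq_eq)
    then show False
      using \<open>P \<noteq> 0\<close> pdegree_le_iff_below[of P "n - 1"] by (cases n) (auto simp: n_def dest: deg_below_zeroD)
  qed
  moreover have "pcoeff P n = pcoeff P n ** dop_lead D n ** matrix_inv (dop_lead D n)"
    using matrix_inv_mult(1)[OF inv[of n]] by (simp flip: matrix_mul_assoc)
  ultimately have "pcoeff P n ** dop_lead D n \<noteq> 0" by auto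
  then have nz: "pcoeff (P \<cdot>\<^sub>D D) n \<noteq> 0"
    by (simp add: pcoeff_dop_act[OF below D])
  then show "P \<cdot>\<^sub>D D \<noteq> 0" by auto
  show "pdegree (P \<cdot>\<^sub>D D) = pdegree P"
    using pdegree_eqI[OF deg_below_dop_act[OF below D] nz] by (simp add: n_def)
qed

subsection \<open>The formal adjoint of an operator\<close>

lemma mat_mult_right: "P ** mat c = mat c ** (P :: ('n::finite) pmat)"
  using mat_mult_commute[of P c "mat 1"] by simp

definition dop_delta :: "('n::finite) dop" where
  "dop_delta = monom (mat [:0, 2:]) 0 + monom (mat (- 1)) 1"

lemma dop_act_delta: "P \<cdot>\<^sub>D dop_delta = gdelta P"
proof -
  have "mat (- 1) ** A = - A" for A :: "'a pmat"
    by (simp add: vec_eq_iff mat_mult_entry)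
  then show ?thesis
    by (simp add: dop_delta_def dop_act_add dop_act_monom mat_mult_right gdelta_def)
qed

primrec dop_delta_pow :: "nat \<Rightarrow> ('n::finite) dop" where
  "dop_delta_pow 0 = monom (mat 1) 0"
| "dop_delta_pow (Suc n) = dop_delta_pow n \<odot> dop_delta"

lemma dop_act_delta_pow: "P \<cdot>\<^sub>D dop_delta_pow n = (gdelta ^^ n) P"
  by (induction n) (simp_all add: dop_act_monom dop_act_mult dop_act_delta)

text \<open>This is \<open>W2 V^* W1^{-1}\<close> for \<open>W1 = e^{-x^2} I\<close> and
  \<open>W2 = e^{-x^2} S\<close>: the exponentials cancel and turn \<open>(-\<partial>)^j\<close>
  into \<open>(2x - \<partial>)^j\<close>.\<close>

definition gauss_adjoint :: "('n::finite) pmat \<Rightarrow> 'n dop \<Rightarrow> 'n dop" where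
  "gauss_adjoint S V = (\<Sum>j\<le>degree V. monom (S ** cadjp (coeff V j)) 0 \<odot> dop_delta_pow j)"

lemma dop_act_gauss_adjoint:
  "Q \<cdot>\<^sub>D gauss_adjoint S V = (\<Sum>j\<le>degree V. (gdelta ^^ j) (Q ** S ** cadjp (coeff V j)))"
  by (simp add: gauss_adjoint_def dop_act_sum dop_act_mult dop_act_monom dop_act_delta_pow matrix_mul_assoc)

lemma peval_sum: "peval (sum f A) x = (\<Sum>i\<in>A. peval (f i) x)"
  by (simp add: peval_def vec_eq_iff poly_sum)

lemma matrix_inv_scaleR_mat1:
  assumes "c \<noteq> 0" shows "matrix_inv (c *\<^sub>R (mat 1 :: ('n::finite) cmat)) = inverse c *\<^sub>R mat 1"
proof -
  let ?A = "c *\<^sub>R (mat 1 :: 'n cmat)"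
  have inv: "?A ** (inverse c *\<^sub>R mat 1) = mat 1" "(inverse c *\<^sub>R mat 1) ** ?A = mat 1"
    using assms by (simp_all add: matrix_scaleR_left matrix_scaleR_right)
  then have "invertible ?A" unfolding invertible_def by blast
  then have "matrix_inv ?A ** (?A ** (inverse c *\<^sub>R mat 1)) = inverse c *\<^sub>R mat 1"
    unfolding matrix_mul_assoc by (simp add: matrix_inv_mult)
  then show ?thesis by (simp add: inv)
qed

lemma is_weight_adjoint_gauss:
  assumes "\<And>x. W x = exp (- x\<^sup>2) *\<^sub>R peval S x"
  shows "is_weight_adjoint I (\<lambda>x. exp (- x\<^sup>2) *\<^sub>R mat 1) W V (gauss_adjoint S V)"
  unfolding is_weight_adjoint_def
proof (intro allI ballI impI)
  fix Q :: "'a pmat" and x :: real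
  have "fderiv j (\<lambda>t. peval Q t ** W t ** cadj (peval (coeff V j) t)) x =
      (-1) ^ j *\<^sub>R (exp (- x\<^sup>2) *\<^sub>R peval ((gdelta ^^ j) (Q ** S ** cadjp (coeff V j))) x)" for j
    unfolding fderiv_gauss[THEN fun_cong, symmetric]
    by (simp add: assms cadj_peval matrix_scaleR_left matrix_scaleR_right peval_mult)
  then show "peval (Q \<cdot>\<^sub>D gauss_adjoint S V) x =
       (\<Sum>j\<le>degree V. (- 1) ^ j *\<^sub>R fderiv j (\<lambda>t. peval Q t ** W t ** cadj (peval (coeff V j) t)) x) **
       matrix_inv (exp (- x\<^sup>2) *\<^sub>R mat 1)"
    by (simp add: matrix_inv_scaleR_mat1 matrix_scaleR_right dop_act_gauss_adjoint peval_sum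
        flip: power_mult_distrib scaleR_sum_right)
qed

lemma gmat_gauss_adjoint:
  assumes S: "cadjp S = S"
  shows "gmat ((P \<cdot>\<^sub>D V) ** S ** cadjp Q) = gmat (P ** cadjp (Q \<cdot>\<^sub>D gauss_adjoint S V))"
proof -
  have cs: "cadjp (sum f A) = (\<Sum>x\<in>A. cadjp (f x))" for f :: "nat \<Rightarrow> 'a pmat" and A
    by (induction A rule: infinite_finite_induct) (simp_all add: cadjp_add, simp_all add: cadjp_def vec_eq_iff)
  have "gmat ((P \<cdot>\<^sub>D V) ** S ** cadjp Q) =
      (\<Sum>j\<le>degree V. gmat ((pmat_deriv ^^ j) P ** (coeff V j ** S ** cadjp Q)))"
    by (simp add: dop_act_def matrix_mult_sum_left gmat_sum matrix_mul_assoc)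
  also have "\<dots> = (\<Sum>j\<le>degree V. gmat (P ** (gdelta ^^ j) (coeff V j ** S ** cadjp Q)))"
    by (simp only: gmat_deriv_pow_mult)
  also have "\<dots> = gmat (P ** cadjp (Q \<cdot>\<^sub>D gauss_adjoint S V))"
    by (simp add: dop_act_gauss_adjoint cs matrix_mult_sum_right gmat_sum
        cadjp_gdelta_pow cadjp_mult S matrix_mul_assoc)
  finally show ?thesis .
qed

section \<open>Conditions on a weight matrix, the Hermite basis and the general Darboux
  criterion\<close>

lemma peval_mat1 [simp]: "peval (mat 1) x = mat 1"
  by (simp add: peval_def mat_def vec_eq_iff)

lemma (in gauss_weight) weight_matrix: "weight_matrix UNIV W"
  unfolding weight_matrix_def
proof (intro conjI allI ballI AE_I2 impI)
  have W: "W = (\<lambda>x. exp (- x\<^sup>2) *\<^sub>R peval (T ** cadjp T) x)" by (simp add: fun_eq_iff weight)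
  show "fderiv k W differentiable (at x)" for k x
    unfolding W by (rule fderiv_gauss_differentiable)
  show "set_integrable lborel UNIV (\<lambda>x. x ^ k *\<^sub>R W x)" for k
    using has_integral_gmat[of k "T ** cadjp T"]
    by (auto simp: set_integrable_def W mult.commute intro: integrable.intros)
  show "posdef (W x)" for x
    unfolding posdef_def
  proof (intro conjI allI impI)
    show "cadj (W x) = W x"
    proof -
      have "cadj (c *\<^sub>R A) = c *\<^sub>R cadj A" for c and A :: "'n cmat"
        by (simp add: cadj_def vec_eq_iff)
      then show ?thesis by (simp add: W cadj_peval cadjp_mult)
    qed
    fix v :: "complex ^ 'n" assume "v \<noteq> 0"
    let ?t = "\<lambda>i k. peval T x $ i $ k"
    \<comment> \<open>The vector \<open>T^* v\<close> at the point \<open>x\<close>; the quadratic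
      form of \<open>W\<close> at \<open>v\<close> is the Gaussian times its squared length.\<close>
    define y where "y k = (\<Sum>j\<in>UNIV. cnj (?t j k) * v $ j)" for k
    have "(\<Sum>i\<in>UNIV. \<Sum>j\<in>UNIV. cnj (v $ i) * W x $ i $ j * v $ j) =
        exp (- x\<^sup>2) *\<^sub>R (\<Sum>i\<in>UNIV. \<Sum>j\<in>UNIV. \<Sum>k\<in>UNIV. cnj (v $ i) * ?t i k * (cnj (?t j k) * v $ j))"
      by (simp add: W peval_mult matrix_mult_entry sum_distrib_left sum_distrib_right scaleR_sum_right
          mult_ac flip: cadj_peval) (simp add: cadj_def mult_ac)
    also have "(\<Sum>i\<in>UNIV. \<Sum>j\<in>UNIV. \<Sum>k\<in>UNIV. cnj (v $ i) * ?t i k * (cnj (?t j k) * v $ j)) =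
        (\<Sum>k\<in>UNIV. \<Sum>i\<in>UNIV. \<Sum>j\<in>UNIV. cnj (v $ i) * ?t i k * (cnj (?t j k) * v $ j))"
      by (rule trans[OF sum.cong[OF refl sum.swap] sum.swap])
    also have "\<dots> = (\<Sum>k\<in>UNIV. cnj (y k) * y k)"
      unfolding y_def cnj_sum sum_product by (simp add: mult_ac)
    also have "\<dots> = of_real (\<Sum>k\<in>UNIV. (cmod (y k))\<^sup>2)"
      unfolding of_real_sum by (intro sum.cong refl) (simp only: complex_norm_square mult.commute)
    finally have "Re (\<Sum>i\<in>UNIV. \<Sum>j\<in>UNIV. cnj (v $ i) * W x $ i $ j * v $ j) =
        exp (- x\<^sup>2) * (\<Sum>k\<in>UNIV. (cmod (y k))\<^sup>2)"
      by simp
    moreover have "(\<Sum>k\<in>UNIV. (cmod (y k))\<^sup>2) \<noteq> 0"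
    proof
      assume "(\<Sum>k\<in>UNIV. (cmod (y k))\<^sup>2) = 0"
      then have y: "y k = 0" for k by (simp add: sum_nonneg_eq_0_iff)
      have inv: "peval T x ** peval Ti x = mat 1" by (simp add: T_inverse flip: peval_mult)
      have "v $ i = 0" for i
      proof -
        have "(\<Sum>k\<in>UNIV. cnj (peval Ti x $ k $ i) * y k) =
            (\<Sum>j\<in>UNIV. cnj ((peval T x ** peval Ti x) $ j $ i) * v $ j)"
          unfolding y_def sum_distrib_left matrix_mult_entry
          by (subst sum.swap) (simp add: sum_distrib_left sum_distrib_right mult_ac)
        also have "\<dots> = (\<Sum>j\<in>UNIV. if j = i then v $ j else 0)"
          unfolding inv by (intro sum.cong refl) (simp add: mat_def)
        finally show ?thesis by (simp add: y)
      qed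
      then show False using \<open>v \<noteq> 0\<close> by (simp add: vec_eq_iff)
    qed
    moreover have "(\<Sum>k\<in>UNIV. (cmod (y k))\<^sup>2) \<ge> 0" by (intro sum_nonneg) simp
    ultimately show "0 < Re (\<Sum>i\<in>UNIV. \<Sum>j\<in>UNIV. cnj (v $ i) * W x $ i $ j * v $ j)"
      by simp
  qed
qed auto

lemma pcoeff_mat: "pcoeff (mat p) k = mat (coeff p k)"
  by (simp add: pcoeff_def mat_def vec_eq_iff)

lemma invertible_mat1: "invertible (mat 1 :: ('n::finite) cmat)"
  unfolding invertible_def by (intro exI[of _ "mat 1"]) simp

interpretation hermite_weight: gauss_weight "mat 1" "mat 1"
  "\<lambda>x. exp (- x\<^sup>2) *\<^sub>R (mat 1 :: ('n::finite) cmat)"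
  by unfold_locales simp_all

interpretation hermite: gauss_orthogonal_basis "mat 1" "mat 1"
  "\<lambda>x. exp (- x\<^sup>2) *\<^sub>R (mat 1 :: ('n::finite) cmat)" "\<lambda>n. mat (herm n)"
proof
  show "deg_below (Suc n) (mat (herm n) :: 'n pmat)" for n
    by (simp add: deg_below_def pcoeff_mat coeff_eq_0)
  show "invertible (pcoeff (mat (herm n) :: 'n pmat) n)" for n
    by (simp add: pcoeff_mat invertible_mat1)
next
  fix n and Q :: "'n pmat" assume Q: "deg_below n Q"
  have "gint (herm n * cadjp Q $ i $ j) = 0" for i j
  proof (cases "Q $ j $ i = 0")
    case False
    have "degree (Q $ j $ i) < n"
    proof (rule ccontr)
      assume "\<not> degree (Q $ j $ i) < n"
      then have "coeff (Q $ j $ i) (degree (Q $ j $ i)) = 0"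
        using Q by (simp add: deg_below_iff_coeff)
      then show False using False by simp
    qed
    then show ?thesis by (simp add: gint_herm_eq_0 cadjp_def)
  qed (simp add: cadjp_def)
  then show "hermite_weight.ip (mat (herm n)) Q = 0"
    by (simp add: hermite_weight.ip_def gmat_def vec_eq_iff mat_mult_entry)
qed

text \<open>The adjoint relation turns a Gaussian pairing with \<open>herm n\<close> acted on by
  \<open>V\<close> and then \<open>N\<close> into a pairing with \<open>B n\<close> for
  \<open>W\<close>. Orthogonality of the \<open>B n\<close> thus becomes the eigenvalue property of
  the product.\<close>

lemma (in gauss_orthogonal_basis) strong_darboux_hermite:
  assumes V: "degree_preserving V" "det (lead_coeff V) \<noteq> 0" and B: "\<And>n. B n = mat (herm n) \<cdot>\<^sub>D V"
  shows "strong_darboux UNIV (\<lambda>x. exp (- x\<^sup>2) *\<^sub>R mat 1) W"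
proof -
  let ?N = "gauss_adjoint (T ** cadjp T) V"
  have adj: "winner UNIV W (P \<cdot>\<^sub>D V) Q = winner UNIV (\<lambda>x. exp (- x\<^sup>2) *\<^sub>R mat 1) P (Q \<cdot>\<^sub>D ?N)" for P Q
    unfolding winner_gauss[of W, OF weight] hermite_weight.winner_eq_ip hermite_weight.ip_def
    by (subst gmat_gauss_adjoint) (simp_all add: cadjp_mult)
  have below: "deg_below n P \<Longrightarrow> deg_below n (P \<cdot>\<^sub>D V)" for n P
  proof (cases n)
    case (Suc m)
    moreover assume "deg_below n P"
    ultimately show ?thesis
      using V(1) unfolding degree_preserving_def
      by (metis deg_below_0 dop_act_zero_left pdegree_le_iff_below)
  qed (auto dest: deg_below_zeroD)
  have "V \<odot> ?N \<in> bochner_algebra UNIV (\<lambda>x. exp (- x\<^sup>2) *\<^sub>R mat 1)"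
    unfolding hermite.bochner_algebra_iff
  proof
    fix n
    let ?P = "mat (herm n) \<cdot>\<^sub>D (V \<odot> ?N)"
    have P: "hermite_weight.ip Q ?P = ip (Q \<cdot>\<^sub>D V) (B n)" for Q
      using adj[of Q "B n"] by (simp add: dop_act_mult B hermite_weight.winner_eq_ip winner_eq_ip)
    \<comment> \<open>Orthogonality to lower degrees: \<open>V\<close> does not raise the degree of
      \<open>Q\<close>, and \<open>B n\<close> is orthogonal to all lower degrees.\<close>
    have 1: "hermite_weight.ip ?P Q = 0" if "deg_below n Q" for Q
      using P[of Q] ip_B_right[OF below[OF that]] by (simp add: hermite_weight.ip_adj[of ?P])
    \<comment> \<open>The degree bound: the Hermite components of index \<open>m > n\<close> are
      pairings of \<open>B m\<close> with \<open>B n\<close>.\<close>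
    have "hermite_weight.ip (mat (herm m)) ?P = 0" if "m > n" for m
      unfolding P B[symmetric] using that by (intro B_orth deg_below_mono[OF B_degree]) auto
    then have 2: "hermite_weight.ip ?P (mat (herm m)) = 0" if "m > n" for m
      using that by (simp add: hermite_weight.ip_adj[of ?P])
    have 3: "gint (?P $ i $ j * herm m) = 0" if "m > n" for m i j
    proof -
      have "cadjp (mat (herm m)) = (mat (herm m) :: 'a pmat)"
        by (simp add: cadjp_def mat_def vec_eq_iff)
      then have "hermite_weight.ip ?P (mat (herm m)) $ i $ j = gint (herm m * ?P $ i $ j)"
        by (simp add: hermite_weight.ip_def gmat_def mat_mult_right[of ?P] mat_mult_entry)
      then show ?thesis using 2[OF that] by (simp add: mult.commute)
    qed
    have "degree (?P $ i $ j) \<le> n" for i j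
      using 3 by (simp add: degree_le_iff_gint mult.commute)
    then have "deg_below (Suc n) ?P"
      by (simp flip: pdegree_le_iff_below add: pdegree_le_iff)
    then show "\<exists>c. ?P = pconst c ** mat (herm n)"
      using 1 by (rule hermite.orthogonal_multiple[rotated])
  qed
  moreover have "is_weight_adjoint UNIV (\<lambda>x. exp (- x\<^sup>2) *\<^sub>R mat 1) W V ?N"
    by (rule is_weight_adjoint_gauss) (rule weight)
  ultimately show ?thesis
    unfolding strong_darboux_def using V adj weight_matrix hermite_weight.weight_matrix by blast
qed

subsection \<open>The weight and its Darboux operator\<close>

definition mat2 :: "'a::zero \<Rightarrow> 'a \<Rightarrow> 'a \<Rightarrow> 'a \<Rightarrow> 'a ^ 2 ^ 2" where
  "mat2 p q r s = vector [vector [p, q], vector [r, s]]"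

lemma mat2_nth [simp]:
  "mat2 p q r s $ 1 $ 1 = p" "mat2 p q r s $ 1 $ 2 = q"
  "mat2 p q r s $ 2 $ 1 = r" "mat2 p q r s $ 2 $ 2 = s"
  by (simp_all add: mat2_def)

lemma mat_2_nth [simp]:
  "(mat c :: 'a::zero ^ 2 ^ 2) $ 1 $ 1 = c" "(mat c :: 'a ^ 2 ^ 2) $ 1 $ 2 = 0"
  "(mat c :: 'a ^ 2 ^ 2) $ 2 $ 1 = 0" "(mat c :: 'a ^ 2 ^ 2) $ 2 $ 2 = c"
  by (simp_all add: mat_def)

lemma mat2_eq_iff: "A = B \<longleftrightarrow> A $ 1 $ 1 = B $ 1 $ 1 \<and> A $ 1 $ 2 = B $ 1 $ 2
    \<and> A $ 2 $ 1 = B $ 2 $ 1 \<and> A $ 2 $ 2 = (B :: 'a ^ 2 ^ 2) $ 2 $ 2"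
  by (auto simp: vec_eq_iff forall_2)

lemma matrix_mult_entry_2: "(A ** (B :: 'a::semiring_1 ^ 2 ^ 2)) $ i $ j = A $ i $ 1 * B $ 1 $ j + A $ i $ 2 * B $ 2 $ j"
  by (simp add: matrix_matrix_mult_def sum_2)

lemma pderiv_numeral_pow:
  "(pderiv ^^ 2) f = pderiv (pderiv f)" "(pderiv ^^ 3) f = pderiv (pderiv (pderiv f))"
  "(pderiv ^^ 4) f = pderiv (pderiv (pderiv (pderiv f)))"
  "(pderiv ^^ 5) f = pderiv (pderiv (pderiv (pderiv (pderiv f))))"
  "(pderiv ^^ 6) f = pderiv (pderiv (pderiv (pderiv (pderiv (pderiv f)))))"
  by (simp_all add: numeral_eq_Suc)

text \<open>Modulo the Hermite equation all derivatives and successors are combinations of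
  \<open>herm n\<close> and its first derivative. Operator identities on \<open>herm n\<close>
  thereby become ring identities at each point \<open>z\<close>.\<close>

lemma poly_herm_rules:
  fixes z :: complex and n :: nat
  defines "h0 \<equiv> poly (herm n) z" and "h1 \<equiv> poly (pderiv (herm n)) z"
  shows "poly (pderiv (pderiv (herm n))) z = 2 * (z * h1 - of_nat n * h0)"
    and "poly (pderiv (pderiv (pderiv (herm n)))) z = 2 * (h1 + z * (2 * (z * h1 - of_nat n * h0)) - of_nat n * h1)"
    and "poly (pderiv (pderiv (pderiv (pderiv (herm n))))) z
      = 2 * (2 * (2 * (z * h1 - of_nat n * h0)) + z * (2 * (h1 + z * (2 * (z * h1 - of_nat n * h0)) - of_nat n * h1))
        - of_nat n * (2 * (z * h1 - of_nat n * h0)))"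
    and "poly (herm (Suc n)) z = z * h0 - h1 / 2"
    and "poly (herm (Suc (Suc n))) z = z * (z * h0 - h1 / 2) - (of_nat n + 1) / 2 * h0"
proof -
  have e: "pderiv (pderiv (herm n)) = smult 2 ([:0, 1:] * pderiv (herm n) - smult (of_nat n) (herm n))"
    unfolding herm_eigen[of n, symmetric] by (simp add: smult_diff_right)
  show 2: "poly (pderiv (pderiv (herm n))) z = 2 * (z * h1 - of_nat n * h0)"
    by (subst e) (simp add: h0_def h1_def)
  have e3: "pderiv (pderiv (pderiv (herm n))) = smult 2 (pderiv (herm n) + [:0, 1:] * pderiv (pderiv (herm n))
      - smult (of_nat n) (pderiv (herm n)))"
    by (subst e) (simp add: pderiv_smult pderiv_diff pderiv_mult pderiv_pCons)
  show 3: "poly (pderiv (pderiv (pderiv (herm n)))) z = 2 * (h1 + z * (2 * (z * h1 - of_nat n * h0)) - of_nat n * h1)"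
    by (subst e3) (simp add: 2 h1_def)
  have e4: "pderiv (pderiv (pderiv (pderiv (herm n)))) = smult 2 (smult 2 (pderiv (pderiv (herm n)))
      + [:0, 1:] * pderiv (pderiv (pderiv (herm n))) - smult (of_nat n) (pderiv (pderiv (herm n))))"
    by (subst e3) (simp add: pderiv_smult pderiv_diff pderiv_add pderiv_mult pderiv_pCons numeral_poly)
  show "poly (pderiv (pderiv (pderiv (pderiv (herm n))))) z
      = 2 * (2 * (2 * (z * h1 - of_nat n * h0)) + z * (2 * (h1 + z * (2 * (z * h1 - of_nat n * h0)) - of_nat n * h1))
        - of_nat n * (2 * (z * h1 - of_nat n * h0)))"
    by (subst e4) (simp add: 2 3)
  show 1: "poly (herm (Suc n)) z = z * h0 - h1 / 2"
    by (simp add: herm.simps h0_def h1_def)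
  show "poly (herm (Suc (Suc n))) z = z * (z * h0 - h1 / 2) - (of_nat n + 1) / 2 * h0"
    unfolding herm.simps(2)[of "Suc n"] by (simp add: 1 pderiv_herm_Suc h0_def algebra_simps)
qed

locale ab_weight =
  fixes a b :: real
  assumes a_nz: "a \<noteq> 0" and b_nz: "b \<noteq> 0"
begin

abbreviation "ac \<equiv> complex_of_real a"
abbreviation "bc \<equiv> complex_of_real b"

definition pp :: "complex poly" where "pp = [:0, bc, ac:]"

definition T :: "2 pmat" where "T = mat2 1 (- pp) 0 1"
definition Ti :: "2 pmat" where "Ti = mat2 1 pp 0 1"

lemma T_nth [simp]: "T $ 1 $ 1 = 1" "T $ 1 $ 2 = - pp" "T $ 2 $ 1 = 0" "T $ 2 $ 2 = 1"
  and Ti_nth [simp]: "Ti $ 1 $ 1 = 1" "Ti $ 1 $ 2 = pp" "Ti $ 2 $ 1 = 0" "Ti $ 2 $ 2 = 1"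
  by (simp_all add: T_def Ti_def)

lemma T_Ti: "T ** Ti = mat 1" and Ti_T: "Ti ** T = mat 1"
  by (simp_all add: T_def Ti_def mat2_eq_iff matrix_mult_entry_2)

lemma W_ab_factor: "W_ab a b x = exp (- x\<^sup>2) *\<^sub>R peval (T ** cadjp T) x"
  unfolding W_ab_def
  by (simp add: mat2_eq_iff peval_def cadjp_def matrix_mult_entry_2 T_def pp_def map_poly_pCons)
    (simp add: power2_eq_square algebra_simps)

sublocale gauss_weight T Ti "W_ab a b"
  by unfold_locales (simp_all add: W_ab_factor T_Ti)

text \<open>Origin of the coefficients: in the rows \<open>eu1\<close>, \<open>ew1\<close>,
  \<open>eu2\<close>, \<open>ew2\<close> below, each factor \<open>n\<close> is replaced by
  \<open>x \<partial> - \<partial>^2/2\<close> and each step to the next index by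
  \<open>x - \<partial>/2\<close>; the result is multiplied by \<open>Ti\<close> on the
  right.\<close>

definition V :: "2 dop" where
  "V = [: mat2 2 [:2 * ac:] 0 2,
          mat2 0 [:bc, 3 * ac:] [:bc, - ac:] [:0, bc\<^sup>2 - 3 * ac\<^sup>2 / 2:],
          mat2 [:3 * ac\<^sup>2 / 4:] [:- ac, 3 * ac\<^sup>2 * bc / 4, 3 * ac ^ 3 / 4:] [:ac:] [:3 * ac\<^sup>2 / 4, ac * bc, - ac\<^sup>2 / 2:],
          mat2 [:0, ac\<^sup>2 / 4:] [:0, 0, ac\<^sup>2 * bc / 4, ac ^ 3 / 4:] 0 [:0, 3 * ac\<^sup>2 / 4:],
          mat2 [:- ac\<^sup>2 / 8:] [:0, - ac\<^sup>2 * bc / 8, - (ac ^ 3 / 8):] 0 [:- ac\<^sup>2 / 8:] :]"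

lemma degree_V: "degree V = 4" and coeff_V_4: "coeff V 4 = mat2 [:- ac\<^sup>2 / 8:] [:0, - ac\<^sup>2 * bc / 8, - (ac ^ 3 / 8):] 0 [:- ac\<^sup>2 / 8:]"
proof -
  have "mat2 [:- ac\<^sup>2 / 8:] [:0, - ac\<^sup>2 * bc / 8, - (ac ^ 3 / 8):] 0 [:- ac\<^sup>2 / 8:] \<noteq> 0"
    using a_nz by (simp add: mat2_eq_iff)
  then show "degree V = 4"
    unfolding V_def degree_pCons_eq_if by simp
  show "coeff V 4 = mat2 [:- ac\<^sup>2 / 8:] [:0, - ac\<^sup>2 * bc / 8, - (ac ^ 3 / 8):] 0 [:- ac\<^sup>2 / 8:]"
    by (simp add: V_def numeral_eq_Suc)
qed

lemma det_lead_V: "det (lead_coeff V) \<noteq> 0"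
  using a_nz by (simp add: degree_V coeff_V_4 det_2)

lemma pdegree_V: "i \<le> degree V \<Longrightarrow> pdegree (coeff V i) \<le> i"
proof -
  assume "i \<le> degree V"
  then have "i \<in> {0, 1, 2, 3, 4}" by (auto simp: degree_V)
  then show ?thesis
    by (auto simp: pdegree_le_iff forall_2 V_def numeral_eq_Suc degree_pCons_eq_if)
qed

lemma dop_lead_V: "dop_lead V n = mat2 2
   (2 * ac + 3 * ac * of_nat n + 3 * ac ^ 3 / 4 * (of_nat n * (of_nat n - 1)) + ac ^ 3 / 4 * (of_nat n * (of_nat n - 1) * (of_nat n - 2)))
   (- ac * of_nat n)
   (2 + (bc\<^sup>2 - 3 * ac\<^sup>2 / 2) * of_nat n - ac\<^sup>2 / 2 * (of_nat n * (of_nat n - 1)))"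
proof -
  have four: "{..4::nat} = {0, 1, 2, 3, 4}" by auto
  show ?thesis
    by (simp add: dop_lead_def mat2_eq_iff degree_V four V_def numeral_eq_Suc dfall_def numeral_poly algebra_simps)
qed

text \<open>Since \<open>a\<close> and \<open>b\<close> are real, the determinant is 4 plus
  nonnegative terms.\<close>

lemma invertible_dop_lead_V: "invertible (dop_lead V n)"
proof -
  have "det (dop_lead V n) = of_real (4 + 2 * b\<^sup>2 * real n + 2 * a\<^sup>2 * (real n)\<^sup>2
      + a ^ 4 / 4 * ((real n)\<^sup>2 * (((real n)\<^sup>2 - 1))))"
    unfolding dop_lead_V det_2 mat2_nth
    by (simp add: power2_eq_square power3_eq_cube power4_eq_xxxx field_simps)
  moreover have "(real n)\<^sup>2 * ((real n)\<^sup>2 - 1) \<ge> 0"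
    by (cases "n = 0") (auto simp: one_le_power)
  then have "0 \<le> a ^ 4 / 4 * ((real n)\<^sup>2 * (((real n)\<^sup>2 - 1)))"
    by (intro mult_nonneg_nonneg[of "a ^ 4 / 4"]) simp
  then have "4 + 2 * b\<^sup>2 * real n + 2 * a\<^sup>2 * (real n)\<^sup>2
      + a ^ 4 / 4 * ((real n)\<^sup>2 * (((real n)\<^sup>2 - 1))) > 0"
    by (intro add_pos_nonneg) auto
  ultimately show ?thesis
    by (simp only: invertible_det_nz of_real_eq_0_iff)
qed

definition B :: "nat \<Rightarrow> 2 pmat" where "B n = mat (herm n) \<cdot>\<^sub>D V"

text \<open>Rows \<open>(u, w) = (u, v) T\<close> with \<open>(u, v)\<close> of degree \<open>n\<close> and orthogonal to lower degrees are exactly the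
  combinations of \<open>(eu1 n, ew1 n)\<close> and \<open>(eu2 n, ew2 n)\<close>: orthogonality says that \<open>w\<close> and \<open>u - pp w\<close> have
  no Hermite components below \<open>n\<close>, and the degree condition bounds those of \<open>u\<close> and \<open>w + pp u\<close> above.\<close>

definition eu1 :: "nat \<Rightarrow> complex poly" where
  "eu1 n = smult 2 (herm n) + smult (ac\<^sup>2 / 4 * (of_nat n + 1)) (pderiv (pderiv (herm n)))"
definition ew1 :: "nat \<Rightarrow> complex poly" where
  "ew1 n = smult (- 2 * ac) (herm (Suc (Suc n))) + smult (- 2 * bc) (herm (Suc n)) + smult (ac * (of_nat n + 1)) (herm n)"
definition eu2 :: "nat \<Rightarrow> complex poly" where
  "eu2 n = smult (- ac * of_nat n) (herm n) + smult bc (pderiv (herm n)) + smult (ac / 2) (pderiv (pderiv (herm n)))"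
definition ew2 :: "nat \<Rightarrow> complex poly" where
  "ew2 n = smult (ac\<^sup>2 * of_nat n) (herm (Suc (Suc n))) + smult 2 (herm n)"

lemma B_T: "B n ** T = mat2 (eu1 n) (ew1 n) (eu2 n) (ew2 n)"
proof -
  have five: "{..4::nat} = {0, 1, 2, 3, 4}" by auto
  have nth: "coeff V 0 = mat2 2 [:2 * ac:] 0 2"
    "coeff V (Suc 0) = mat2 0 [:bc, 3 * ac:] [:bc, - ac:] [:0, bc\<^sup>2 - 3 * ac\<^sup>2 / 2:]"
    "coeff V 2 = mat2 [:3 * ac\<^sup>2 / 4:] [:- ac, 3 * ac\<^sup>2 * bc / 4, 3 * ac ^ 3 / 4:] [:ac:] [:3 * ac\<^sup>2 / 4, ac * bc, - ac\<^sup>2 / 2:]"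
    "coeff V 3 = mat2 [:0, ac\<^sup>2 / 4:] [:0, 0, ac\<^sup>2 * bc / 4, ac ^ 3 / 4:] 0 [:0, 3 * ac\<^sup>2 / 4:]"
    by (simp_all add: V_def numeral_eq_Suc)
  note simps = matrix_mult_entry_2[of "mat (herm n) \<cdot>\<^sub>D V"] B_def dop_act_entry degree_V five nth coeff_V_4 sum_2
      pderiv_numeral_pow T_def pp_def poly_herm_rules[of n] eu1_def ew1_def eu2_def ew2_def
  have "poly ((B n ** T) $ 1 $ 1) z = poly (eu1 n) z" for z
    by (simp add: simps) (simp add: field_simps power2_eq_square power3_eq_cube)
  moreover have "poly ((B n ** T) $ 1 $ 2) z = poly (ew1 n) z" for z
    by (simp add: simps) (simp add: field_simps power2_eq_square power3_eq_cube)
  moreover have "poly ((B n ** T) $ 2 $ 1) z = poly (eu2 n) z" for z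
    by (simp add: simps) (simp add: field_simps power2_eq_square power3_eq_cube)
  moreover have "poly ((B n ** T) $ 2 $ 2) z = poly (ew2 n) z" for z
    by (simp add: simps) (simp add: field_simps power2_eq_square power3_eq_cube)
  ultimately show ?thesis
    unfolding mat2_eq_iff mat2_nth by (intro conjI poly_ext) auto
qed

lemma gint_pderiv2_mult:
  "gint (pderiv (pderiv f) * g) = gint (f * ([:-2, 0, 4:] * g + pderiv (pderiv g) - [:0, 4:] * pderiv g))"
proof -
  let ?d = "[:0, 2:] * g - pderiv g"
  have eq: "[:0, 2:] * ?d - pderiv ?d = [:-2, 0, 4:] * g + pderiv (pderiv g) - [:0, 4:] * pderiv g"
    by (rule poly_ext) (simp add: pderiv_diff pderiv_mult pderiv_pCons pderiv_smult algebra_simps)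
  show ?thesis unfolding gint_pderiv_mult eq ..
qed

lemma degree_lt_pderiv: "((g :: complex poly) = 0 \<or> degree g < n) \<Longrightarrow> (pderiv g = 0 \<or> Suc (degree (pderiv g)) < n)"
  by (cases "degree g = 0") (auto simp: pderiv_eq_0_iff degree_pderiv)

text \<open>Multiplication by \<open>pp\<close> raises degrees by two, so only pairings of
  \<open>herm n\<close> and \<open>herm (Suc n)\<close> with \<open>x g\<close> and
  \<open>x^2 g\<close> can survive; the coefficients of the rows make these cancel.\<close>

lemma e_orthogonal:
  assumes g: "g = 0 \<or> degree g < n"
  shows "gint (ew1 n * g) = 0" "gint ((eu1 n - pp * ew1 n) * g) = 0"
    and "gint (ew2 n * g) = 0" "gint ((eu2 n - pp * ew2 n) * g) = 0"
proof -
  have z: "gint (herm m * q) = 0" if "q = 0 \<or> degree q < m" for m q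
    using that by (auto intro: gint_herm_eq_0)
  have x: "[:0, 1:] * q = 0 \<or> degree ([:0, 1:] * q) < Suc m" if "q = 0 \<or> degree q < m" for q :: "complex poly" and m
    using that by (auto simp: degree_pCons_eq_if)
  have S: "q = 0 \<or> degree q < Suc m" if "q = 0 \<or> degree q < m" for q :: "complex poly" and m
    using that by auto
  let ?X = "[:0, 1:] :: complex poly"
  have xg: "?X * g = 0 \<or> degree (?X * g) < Suc n" using x[OF g] .
  have xxg: "?X * (?X * g) = 0 \<or> degree (?X * (?X * g)) < Suc (Suc n)" using x[OF xg] .
  have dg: "pderiv g = 0 \<or> Suc (degree (pderiv g)) < n" using degree_lt_pderiv[OF g] .
  have xdg: "?X * pderiv g = 0 \<or> degree (?X * pderiv g) < n"
    using dg by (auto simp: degree_pCons_eq_if)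
  have dg': "pderiv g = 0 \<or> degree (pderiv g) < n" using dg by auto
  have ddg: "pderiv (pderiv g) = 0 \<or> degree (pderiv (pderiv g)) < n"
    using degree_lt_pderiv[OF dg'] by auto
  note zs = z[OF g] z[OF S[OF g]] z[OF S[OF S[OF g]]] z[OF xg] z[OF S[OF xg]] z[OF xxg] z[OF dg'] z[OF xdg] z[OF ddg]
  show "gint (ew1 n * g) = 0" "gint (ew2 n * g) = 0"
    using zs unfolding ew1_def ew2_def
    by (simp_all add: distrib_right left_diff_distrib gint_add gint_diff gint_minus gint_smult del: mult_pCons_left)
  have pp: "pp * q * g = smult ac (q * (?X * (?X * g))) + smult bc (q * (?X * g))" for q
    by (rule poly_ext) (simp add: pp_def algebra_simps)
  have d1: "gint (pderiv (herm n) * g) = 2 * gint (herm n * (?X * g))"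
  proof -
    have eq: "herm n * ([:0, 2:] * g - pderiv g) = smult 2 (herm n * (?X * g)) - herm n * pderiv g"
      by (rule poly_ext) (simp add: algebra_simps)
    show ?thesis unfolding gint_pderiv_mult eq gint_diff gint_smult zs by simp
  qed
  have d2: "gint (pderiv (pderiv (herm n)) * g) = 4 * gint (herm n * (?X * (?X * g)))"
  proof -
    have eq: "herm n * ([:-2, 0, 4:] * g + pderiv (pderiv g) - [:0, 4:] * pderiv g) =
        smult 4 (herm n * (?X * (?X * g))) - smult 2 (herm n * g) + herm n * pderiv (pderiv g)
          - smult 4 (herm n * (?X * pderiv g))"
      by (rule poly_ext) (simp add: algebra_simps)
    show ?thesis unfolding gint_pderiv2_mult eq gint_diff gint_add gint_smult zs by simp
  qed
  \<comment> \<open>Links the surviving pairings: integration by parts in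
    \<open>herm (Suc n)' = (n + 1) herm n\<close>, where \<open>g\<close> and \<open>x g'\<close>
    have degree too low to contribute.\<close>
  have s: "2 * gint (herm (Suc n) * (?X * (?X * g))) = (of_nat n + 1) * gint (herm n * (?X * g))"
  proof -
    have "2 * gint (herm (Suc n) * (?X * (?X * g))) = gint (herm n * pderiv (?X * (?X * g)))"
      unfolding gint_herm_Suc_mult by simp
    also have "herm n * pderiv (?X * (?X * g)) = smult 2 (herm n * (?X * g)) + herm n * (?X * (?X * pderiv g))"
      by (rule poly_ext) (simp add: pderiv_mult pderiv_pCons algebra_simps)
    finally have 1: "2 * gint (herm (Suc n) * (?X * (?X * g))) =
        2 * gint (herm n * (?X * g)) + gint (herm n * (?X * (?X * pderiv g)))"
      by (simp only: gint_add gint_smult)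
    have "of_nat (Suc n) * gint (herm n * (?X * g)) = gint (pderiv (herm (Suc n)) * (?X * g))"
      by (simp only: pderiv_herm_Suc mult_smult_left gint_smult)
    also have "\<dots> = gint (herm (Suc n) * ([:0, 2:] * (?X * g) - pderiv (?X * g)))"
      by (rule gint_pderiv_mult)
    also have "herm (Suc n) * ([:0, 2:] * (?X * g) - pderiv (?X * g)) =
        smult 2 (herm (Suc n) * (?X * (?X * g))) - herm (Suc n) * g - herm (Suc n) * (?X * pderiv g)"
      by (rule poly_ext) (simp add: pderiv_mult pderiv_pCons algebra_simps)
    finally have "of_nat (Suc n) * gint (herm n * (?X * g)) = 2 * gint (herm (Suc n) * (?X * (?X * g)))"
      unfolding gint_diff gint_smult zs z[OF S[OF xdg]] by simp
    then show ?thesis by (simp add: add.commute)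
  qed
  show "gint ((eu1 n - pp * ew1 n) * g) = 0"
  proof -
    have eq: "(eu1 n - pp * ew1 n) * g = smult 2 (herm n * g) + smult (ac\<^sup>2 / 4 * (of_nat n + 1)) (pderiv (pderiv (herm n)) * g)
        - (smult (- 2 * ac) (pp * herm (Suc (Suc n)) * g) + smult (- 2 * bc) (pp * herm (Suc n) * g)
           + smult (ac * (of_nat n + 1)) (pp * herm n * g))"
      by (rule poly_ext) (simp add: eu1_def ew1_def algebra_simps)
    show ?thesis
      unfolding eq pp gint_add gint_diff gint_smult d2 zs using s by algebra
  qed
  show "gint ((eu2 n - pp * ew2 n) * g) = 0"
  proof -
    have eq: "(eu2 n - pp * ew2 n) * g = smult (- ac * of_nat n) (herm n * g) + smult bc (pderiv (herm n) * g)
        + smult (ac / 2) (pderiv (pderiv (herm n)) * g)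
        - (smult (ac\<^sup>2 * of_nat n) (pp * herm (Suc (Suc n)) * g) + smult 2 (pp * herm n * g))"
      by (rule poly_ext) (simp add: eu2_def ew2_def algebra_simps)
    show ?thesis
      unfolding eq pp gint_add gint_diff gint_smult d1 d2 zs by algebra
  qed
qed

lemma ip_entry: "ip P Q $ i $ j = gint ((P ** T) $ i $ 1 * map_poly cnj (Q $ j $ 1)
    + (P ** T) $ i $ 2 * (map_poly cnj (Q $ j $ 2) - pp * map_poly cnj (Q $ j $ 1)))"
proof -
  have "map_poly cnj (- pp) = - pp" by (simp add: pp_def map_poly_pCons)
  then show ?thesis
    by (simp add: ip_def gmat_def matrix_mult_entry_2[of "P ** T"] cadjp_def matrix_mult_entry_2[of Q]
        map_poly_cnj_add map_poly_cnj_mult map_poly_cnj_diff algebra_simps)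
qed

sublocale gauss_orthogonal_basis T Ti "W_ab a b" B
proof
  have below: "deg_below (Suc n) (mat (herm n) :: 2 pmat)" for n
    by (simp add: deg_below_def pcoeff_mat coeff_eq_0)
  show "deg_below (Suc n) (B n)" for n
    unfolding B_def by (intro deg_below_dop_act below pdegree_V)
  show "invertible (pcoeff (B n) n)" for n
    by (simp add: B_def pcoeff_dop_act[OF below pdegree_V] pcoeff_mat invertible_dop_lead_V)
  fix n and Q :: "2 pmat" assume Q: "deg_below n Q"
  have d: "map_poly cnj (Q $ j $ k) = 0 \<or> degree (map_poly cnj (Q $ j $ k)) < n" for j k
    using Q leading_coeff_neq_0[of "Q $ j $ k"] by (fastforce simp: deg_below_iff_coeff not_less)
  have e: "gint (w * g2) + gint ((u - pp * w) * g1) = gint (u * g1 + w * (g2 - pp * g1))" for u w g1 g2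
    by (simp add: gint_add[symmetric] algebra_simps)
  have "ip (B n) Q $ i $ j = 0" for i j
  proof -
    have "ip (B n) Q $ i $ j = gint ((B n ** T) $ i $ 1 * map_poly cnj (Q $ j $ 1)
        + (B n ** T) $ i $ 2 * (map_poly cnj (Q $ j $ 2) - pp * map_poly cnj (Q $ j $ 1)))"
      by (rule ip_entry)
    also have "\<dots> = 0"
      using e_orthogonal[OF d] exhaust_2[of i] by (auto simp: e[symmetric] B_T)
    finally show ?thesis .
  qed
  then show "ip (B n) Q = 0" by (simp add: vec_eq_iff)
qed

lemma strong_darboux_ab: "strong_darboux UNIV hermite_weight (W_ab a b)"
proof -
  have "hermite_weight = (\<lambda>x. exp (- x\<^sup>2) *\<^sub>R mat 1)"
    by (simp add: fun_eq_iff hermite_weight_def)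
  then show ?thesis
    using strong_darboux_hermite[of V] degree_preservingI[of V, OF pdegree_V invertible_dop_lead_V] det_lead_V
    by (simp add: B_def)
qed

end

subsection \<open>Conjugation of operators by matrix polynomials\<close>

definition sact :: "('n::finite) dop \<Rightarrow> 'n \<Rightarrow> 'n \<Rightarrow> complex poly \<Rightarrow> complex poly" where
  "sact D k j f = (\<Sum>l\<le>degree D. (pderiv ^^ l) f * coeff D l $ k $ j)"

lemma dop_act_sact: "(P \<cdot>\<^sub>D D) $ i $ j = (\<Sum>k\<in>UNIV. sact D k j (P $ i $ k))"
  unfolding dop_act_entry sact_def by (rule sum.swap)

lemma sact_add: "sact D k j (f + g) = sact D k j f + sact D k j g"
  by (simp add: sact_def higher_pderiv_add distrib_right sum.distrib)

lemma sact_smult: "sact D k j (smult c f) = smult c (sact D k j f)"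
  by (rule poly_ext) (simp add: sact_def higher_pderiv_smult poly_sum sum_distrib_left mult.assoc)

lemma sact_0 [simp]: "sact D k j 0 = 0"
  by (simp add: sact_def)

lemma sact_diff: "sact D k j (f - g) = sact D k j f - sact D k j g"
  using sact_add[of D k j f "smult (-1) g"] by (simp add: sact_smult del: smult_minus_left) simp

lemma sact_minus: "sact D k j (- f) = - sact D k j f"
  using sact_diff[of D k j 0 f] by simp

lemma higher_pderiv_monom_zero: "i < j \<Longrightarrow> (pderiv ^^ j) (monom (c :: complex) i) = 0"
  by (rule poly_eqI) (simp add: coeff_higher_pderiv)

text \<open>The test matrix \<open>x^i I\<close> sees only the coefficients up to index
  \<open>i\<close>, the last one with the nonzero factor \<open>i!\<close>; the coefficients are
  therefore recovered inductively.\<close>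

lemma dop_eqI:
  fixes D E :: "('n::finite) dop"
  assumes "\<And>P. P \<cdot>\<^sub>D D = P \<cdot>\<^sub>D E"
  shows "D = E"
proof (rule poly_eqI)
  fix i
  define N where "N = max (max (degree D) (degree E)) i"
  have act: "(mat ([:0, 1:] ^ i) \<cdot>\<^sub>D F) = (\<Sum>j\<le>i. mat ((pderiv ^^ j) (monom 1 i)) ** coeff F j)"
    if "degree F \<le> N" for F :: "'n dop" and i
  proof -
    have m: "(pmat_deriv ^^ j) (mat p) = mat ((pderiv ^^ j) p)" for j p
      by (induction j) (simp_all add: pmat_deriv_def mat_def vec_eq_iff)
    have "(mat ([:0, 1:] ^ i) \<cdot>\<^sub>D F) = (\<Sum>j\<le>max N i. mat ((pderiv ^^ j) (monom 1 i)) ** coeff F j)"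
      using that by (subst dop_act_bound[of _ "max N i"]) (simp_all add: m monom_altdef)
    also have "\<dots> = (\<Sum>j\<le>i. mat ((pderiv ^^ j) (monom 1 i)) ** coeff F j)"
    proof (rule sum.mono_neutral_right)
      show "\<forall>j\<in>{..max N i} - {..i}. mat ((pderiv ^^ j) (monom 1 i)) ** coeff F j = 0"
        using higher_pderiv_monom_zero by (auto simp: not_le vec_eq_iff mat_mult_entry)
    qed auto
    finally show ?thesis .
  qed
  show "coeff D i = coeff E i"
  proof (induction i rule: less_induct)
    case (less i)
    have "(\<Sum>j\<le>i. mat ((pderiv ^^ j) (monom 1 i)) ** coeff D j) = (\<Sum>j\<le>i. mat ((pderiv ^^ j) (monom 1 i)) ** coeff E j)"
      using assms[of "mat ([:0, 1:] ^ i)"] act[of D i] act[of E i] by (simp add: N_def)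
    moreover have "(\<Sum>j<i. mat ((pderiv ^^ j) (monom 1 i)) ** coeff D j) = (\<Sum>j<i. mat ((pderiv ^^ j) (monom 1 i)) ** coeff E j)"
      using less by simp
    ultimately have "mat ((pderiv ^^ i) (monom 1 i)) ** coeff D i = mat ((pderiv ^^ i) (monom 1 i)) ** coeff E i"
      by (simp add: lessThan_Suc_atMost[symmetric])
    moreover have "(pderiv ^^ i) (monom (1::complex) i) \<noteq> 0"
    proof
      assume "(pderiv ^^ i) (monom (1::complex) i) = 0"
      then have "coeff ((pderiv ^^ i) (monom (1::complex) i)) 0 = 0" by simp
      then have "pochhammer (1::complex) i = 0" by (simp add: coeff_higher_pderiv)
      then show False by (simp add: pochhammer_fact[symmetric])
    qed
    ultimately show ?case by (simp add: vec_eq_iff mat_mult_entry)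
  qed
qed

lemma degree_monom_dop_mult: "degree (monom F 0 \<odot> D) \<le> degree D"
  and degree_dop_mult_monom: "degree (D \<odot> monom F 0) \<le> degree D"
proof -
  have 0: "degree (monom F 0) = 0" using degree_monom_le[of F 0] by simp
  show "degree (monom F 0 \<odot> D) \<le> degree D" "degree (D \<odot> monom F 0) \<le> degree D"
    unfolding dop_mult_def 0
    by (intro degree_sum_le order.trans[OF degree_monom_le]; auto)+
qed

definition dop_conj :: "('n::finite) pmat \<Rightarrow> 'n pmat \<Rightarrow> 'n dop \<Rightarrow> 'n dop" where
  "dop_conj F G D = monom F 0 \<odot> D \<odot> monom G 0"

lemma dop_act_conj: "P \<cdot>\<^sub>D dop_conj F G D = ((P ** F) \<cdot>\<^sub>D D) ** G"
  by (simp add: dop_conj_def dop_act_mult dop_act_monom)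

lemma degree_dop_conj_le: "degree (dop_conj F G D) \<le> degree D"
  unfolding dop_conj_def using degree_monom_dop_mult degree_dop_mult_monom order.trans by blast

text \<open>Conjugation never raises the order and is undone by the inverse conjugation. Orders may
  thus be computed in the coordinates \<open>P ** T\<close>.\<close>

lemma degree_dop_conj:
  assumes "F ** G = mat 1" "G ** F = mat 1"
  shows "degree (dop_conj F G D) = degree D"
proof -
  have "dop_conj G F (dop_conj F G D) = D"
    using assms by (intro dop_eqI) (simp add: dop_act_conj flip: matrix_mul_assoc)
  then show ?thesis
    using degree_dop_conj_le[of F G D] degree_dop_conj_le[of G F "dop_conj F G D"] by simp
qed

subsection \<open>An operator of order six\<close>

context ab_weight begin

text \<open>With the number operator \<open>N\<close> and the creation operator \<open>X = x - \<partial>/2\<close>, these are the rows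
  \<open>(a0(N), 12 a X\<^sup>2)\<close> and \<open>(3 a \<partial>\<^sup>2, e0(N))\<close>, where \<open>e0(m) = 12 m + a\<^sup>2 m (m - 1) (m - 2)\<close> and
  \<open>a0(m) = e0(m + 1) + 6 a\<^sup>2 (m + 1)\<^sup>2\<close>.\<close>

definition D6_hat :: "2 dop" where
  "D6_hat = [: mat2 [:12 + 6 * ac\<^sup>2:] [:- 6 * ac, 0, 12 * ac:] 0 0,
     mat2 [:0, 12 + 18 * ac\<^sup>2:] [:0, - 12 * ac:] 0 [:0, 12:],
     mat2 [:- 27 * ac\<^sup>2 / 2 - 6, 0, 9 * ac\<^sup>2:] [:3 * ac:] [:3 * ac:] [:- 6:],
     mat2 [:0, - 21 * ac\<^sup>2 / 2, 0, ac\<^sup>2:] 0 0 [:0, - 3 * ac\<^sup>2 / 2, 0, ac\<^sup>2:],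
     mat2 [:3 * ac\<^sup>2, 0, - 3 * ac\<^sup>2 / 2:] 0 0 [:3 * ac\<^sup>2 / 4, 0, - 3 * ac\<^sup>2 / 2:],
     mat2 [:0, 3 * ac\<^sup>2 / 4:] 0 0 [:0, 3 * ac\<^sup>2 / 4:],
     mat2 [:- ac\<^sup>2 / 8:] 0 0 [:- ac\<^sup>2 / 8:] :]"

lemma degree_D6_hat: "degree D6_hat = 6"
proof -
  have "mat2 [:- ac\<^sup>2 / 8:] 0 0 [:- ac\<^sup>2 / 8:] \<noteq> 0"
    using a_nz by (simp add: mat2_eq_iff)
  then show ?thesis
    unfolding D6_hat_def degree_pCons_eq_if by simp
qed

definition e6 :: "complex \<Rightarrow> complex" where "e6 m = 12 * m + ac\<^sup>2 * (m * (m - 1) * (m - 2))"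
definition a6 :: "complex \<Rightarrow> complex" where "a6 m = e6 (m + 1) + 6 * ac\<^sup>2 * (m + 1)\<^sup>2"

lemma poly_herm_rules56:
  fixes z :: complex and n :: nat
  defines "h \<equiv> \<lambda>k. poly ((pderiv ^^ k) (herm n)) z"
  shows "h 5 = 2 * (3 * h 3 + z * h 4 - of_nat n * h 3)"
    and "h 6 = 2 * (4 * h 4 + z * h 5 - of_nat n * h 4)"
proof -
  have e: "pderiv (pderiv (herm n)) = smult 2 ([:0, 1:] * pderiv (herm n) - smult (of_nat n) (herm n))"
    unfolding herm_eigen[of n, symmetric] by (simp add: smult_diff_right)
  note d = pderiv_smult pderiv_diff pderiv_add pderiv_mult pderiv_pCons
  have e5: "pderiv (pderiv (pderiv (pderiv (pderiv (herm n))))) = smult 2 (smult 3 (pderiv (pderiv (pderiv (herm n))))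
      + [:0, 1:] * pderiv (pderiv (pderiv (pderiv (herm n)))) - smult (of_nat n) (pderiv (pderiv (pderiv (herm n)))))"
    by (subst e) (rule poly_ext, simp add: d numeral_poly algebra_simps)
  show "h 5 = 2 * (3 * h 3 + z * h 4 - of_nat n * h 3)"
    unfolding h_def pderiv_numeral_pow by (subst e5) simp
  have e6: "pderiv (pderiv (pderiv (pderiv (pderiv (pderiv (herm n)))))) = smult 2 (smult 4 (pderiv (pderiv (pderiv (pderiv (herm n)))))
      + [:0, 1:] * pderiv (pderiv (pderiv (pderiv (pderiv (herm n))))) - smult (of_nat n) (pderiv (pderiv (pderiv (pderiv (herm n))))))"
    by (subst e5) (rule poly_ext, simp add: d numeral_poly algebra_simps)
  show "h 6 = 2 * (4 * h 4 + z * h 5 - of_nat n * h 4)"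
    unfolding h_def pderiv_numeral_pow by (subst e6) simp
qed

lemma sact_D6_hat:
  "sact D6_hat 1 1 (herm n) = smult (a6 (of_nat n)) (herm n)"
  "sact D6_hat 1 2 (herm n) = smult (12 * ac) (herm (Suc (Suc n)))"
  "sact D6_hat 2 1 (herm n) = smult (3 * ac) (pderiv (pderiv (herm n)))"
  "sact D6_hat 2 2 (herm n) = smult (e6 (of_nat n)) (herm n)"
proof -
  have six: "{..6::nat} = {0, 1, 2, 3, 4, 5, 6}" by auto
  have nth: "coeff D6_hat 0 = mat2 [:12 + 6 * ac\<^sup>2:] [:- 6 * ac, 0, 12 * ac:] 0 0"
    "coeff D6_hat (Suc 0) = mat2 [:0, 12 + 18 * ac\<^sup>2:] [:0, - 12 * ac:] 0 [:0, 12:]"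
    "coeff D6_hat 2 = mat2 [:- 27 * ac\<^sup>2 / 2 - 6, 0, 9 * ac\<^sup>2:] [:3 * ac:] [:3 * ac:] [:- 6:]"
    "coeff D6_hat 3 = mat2 [:0, - 21 * ac\<^sup>2 / 2, 0, ac\<^sup>2:] 0 0 [:0, - 3 * ac\<^sup>2 / 2, 0, ac\<^sup>2:]"
    "coeff D6_hat 4 = mat2 [:3 * ac\<^sup>2, 0, - 3 * ac\<^sup>2 / 2:] 0 0 [:3 * ac\<^sup>2 / 4, 0, - 3 * ac\<^sup>2 / 2:]"
    "coeff D6_hat 5 = mat2 [:0, 3 * ac\<^sup>2 / 4:] 0 0 [:0, 3 * ac\<^sup>2 / 4:]"
    "coeff D6_hat 6 = mat2 [:- ac\<^sup>2 / 8:] 0 0 [:- ac\<^sup>2 / 8:]"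
    by (simp_all add: D6_hat_def numeral_eq_Suc)
  note simps = sact_def degree_D6_hat six nth poly_herm_rules56 poly_herm_rules[of n] a6_def e6_def
  note simps' = pderiv_numeral_pow(1,2,3) poly_herm_rules[of n]
  have "poly (sact D6_hat 1 1 (herm n)) z = poly (smult (a6 (of_nat n)) (herm n)) z" for z
    by (simp add: simps) (simp add: simps', simp add: field_simps power2_eq_square power3_eq_cube)
  moreover have "poly (sact D6_hat 1 2 (herm n)) z = poly (smult (12 * ac) (herm (Suc (Suc n)))) z" for z
    by (simp add: simps) (simp add: simps', simp add: field_simps power2_eq_square power3_eq_cube)
  moreover have "poly (sact D6_hat 2 1 (herm n)) z = poly (smult (3 * ac) (pderiv (pderiv (herm n)))) z" for z
    by (simp add: simps pderiv_numeral_pow(1))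
  moreover have "poly (sact D6_hat 2 2 (herm n)) z = poly (smult (e6 (of_nat n)) (herm n)) z" for z
    by (simp add: simps) (simp add: simps', simp add: field_simps power2_eq_square power3_eq_cube)
  ultimately show
    "sact D6_hat 1 1 (herm n) = smult (a6 (of_nat n)) (herm n)"
    "sact D6_hat 1 2 (herm n) = smult (12 * ac) (herm (Suc (Suc n)))"
    "sact D6_hat 2 1 (herm n) = smult (3 * ac) (pderiv (pderiv (herm n)))"
    "sact D6_hat 2 2 (herm n) = smult (e6 (of_nat n)) (herm n)"
    by (simp_all add: poly_ext)
qed

lemma sact_D6_hat_pderiv:
  "sact D6_hat 1 1 (pderiv (herm n)) = smult (a6 (of_nat n - 1)) (pderiv (herm n))"
  "sact D6_hat 1 2 (pderiv (herm n)) = smult (12 * ac * of_nat n) (herm (Suc n))"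
  "sact D6_hat 1 1 (pderiv (pderiv (herm n))) = smult (a6 (of_nat n - 2)) (pderiv (pderiv (herm n)))"
  "sact D6_hat 1 2 (pderiv (pderiv (herm n))) = smult (12 * ac * of_nat n * (of_nat n - 1)) (herm n)"
proof -
  have p1: "pderiv (herm n) = smult (of_nat n) (herm (n - 1))" by (rule pderiv_herm)
  show "sact D6_hat 1 1 (pderiv (herm n)) = smult (a6 (of_nat n - 1)) (pderiv (herm n))"
    unfolding p1 sact_smult sact_D6_hat by (cases n) (auto simp: mult.commute)
  show "sact D6_hat 1 2 (pderiv (herm n)) = smult (12 * ac * of_nat n) (herm (Suc n))"
    unfolding p1 sact_smult sact_D6_hat by (cases n) (auto simp: mult.commute)
  have p2: "pderiv (pderiv (herm n)) = smult (of_nat n * of_nat (n - 1)) (herm (n - 2))"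
    unfolding p1 pderiv_smult pderiv_herm[of "n - 1"] by (simp add: numeral_2_eq_2)
  consider "n = 0" | "n = 1" | m where "n = Suc (Suc m)"
    by (metis One_nat_def not0_implies_Suc)
  then show "sact D6_hat 1 1 (pderiv (pderiv (herm n))) = smult (a6 (of_nat n - 2)) (pderiv (pderiv (herm n)))"
    unfolding p2 sact_smult sact_D6_hat by cases (auto simp: mult_ac)
  consider "n = 0" | "n = 1" | m where "n = Suc (Suc m)"
    by (metis One_nat_def not0_implies_Suc)
  then show "sact D6_hat 1 2 (pderiv (pderiv (herm n))) = smult (12 * ac * of_nat n * (of_nat n - 1)) (herm n)"
    unfolding p2 sact_smult sact_D6_hat by cases (auto simp: mult_ac)
qed

text \<open>The diagonal entries are cubic in \<open>n\<close> and the others linear: an operator of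
  order six just reaches the growth that the lower bound excludes for order five.\<close>

lemma D6_hat_B: "(B n ** T) \<cdot>\<^sub>D D6_hat = pconst (mat2 (e6 (of_nat n + 1)) (- 6 * ac * (of_nat n + 1))
    (- 6 * ac * of_nat n) (e6 (of_nat n + 2) - 24)) ** (B n ** T)"
proof -
  have dd: "pderiv (pderiv (herm (Suc (Suc n)))) = smult ((of_nat n + 2) * (of_nat n + 1)) (herm n)"
    "pderiv (pderiv (herm (Suc n))) = smult (of_nat n + 1) (pderiv (herm n))"
    by (simp_all only: pderiv_herm_Suc pderiv_smult) (simp_all add: add.commute mult.commute)
  note s = dop_act_sact sum_2 matrix_mult_entry_2 pconst_def B_T eu1_def ew1_def eu2_def ew2_def sact_add sact_diff sact_minus sact_smult
      sact_D6_hat sact_D6_hat_pderiv dd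
  let ?L = "(B n ** T) \<cdot>\<^sub>D D6_hat" and ?R = "pconst (mat2 (e6 (of_nat n + 1)) (- 6 * ac * (of_nat n + 1))
    (- 6 * ac * of_nat n) (e6 (of_nat n + 2) - 24)) ** (B n ** T)"
  note r = e6_def a6_def power2_eq_square power3_eq_cube field_simps
  have "poly (?L $ 1 $ 1) z = poly (?R $ 1 $ 1) z" for z
    by (simp add: s) (simp add: r)
  moreover have "poly (?L $ 1 $ 2) z = poly (?R $ 1 $ 2) z" for z
    by (simp add: s) (simp add: r)
  moreover have "poly (?L $ 2 $ 1) z = poly (?R $ 2 $ 1) z" for z
    by (simp add: s) (simp add: r)
  moreover have "poly (?L $ 2 $ 2) z = poly (?R $ 2 $ 2) z" for z
    by (simp add: s) (simp add: r)
  ultimately show ?thesis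
    unfolding mat2_eq_iff by (intro conjI poly_ext) auto
qed

definition D6 :: "2 dop" where "D6 = dop_conj T Ti D6_hat"

lemma D6_order: "degree D6 = 6"
  unfolding D6_def by (simp add: degree_dop_conj T_Ti Ti_T degree_D6_hat)

lemma D6_bochner: "D6 \<in> bochner_algebra UNIV (W_ab a b)"
  unfolding bochner_algebra_iff D6_def dop_act_conj D6_hat_B
  by (auto simp: T_Ti simp flip: matrix_mul_assoc)

end

subsection \<open>Matrix elements of an operator and of its adjoint\<close>

text \<open>Left and right multiplication of an array of matrix elements by \<open>a x\<^sup>2 + b x\<close> in the Hermite basis.\<close>

definition pl :: "complex \<Rightarrow> complex \<Rightarrow> (nat \<Rightarrow> nat \<Rightarrow> complex) \<Rightarrow> nat \<Rightarrow> nat \<Rightarrow> complex" where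
  "pl a b X m n = a * X (Suc (Suc m)) n + b * X (Suc m) n + a * (of_nat m + 1/2) * X m n
     + b * (of_nat m / 2) * X (m - 1) n + a * (of_nat m * (of_nat m - 1) / 4) * X (m - 2) n"

definition pr :: "complex \<Rightarrow> complex \<Rightarrow> (nat \<Rightarrow> nat \<Rightarrow> complex) \<Rightarrow> nat \<Rightarrow> nat \<Rightarrow> complex" where
  "pr a b X m n = a * X m (Suc (Suc n)) + b * X m (Suc n) + a * (of_nat n + 1/2) * X m n
     + b * (of_nat n / 2) * X m (n - 1) + a * (of_nat n * (of_nat n - 1) / 4) * X m (n - 2)"

text \<open>\<open>4 * qq a n\<close> is the determinant \<open>4 + a^2 n (n + 1)\<close> formed by
  the Hermite components of index \<open>n\<close> in the two rows of
  \<open>B n ** T\<close>.\<close>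

definition qq :: "complex \<Rightarrow> complex \<Rightarrow> complex" where "qq a n = 1 + a\<^sup>2 * n * (n + 1) / 4"

text \<open>The shapes imposed by \<open>F1\<close>--\<open>F4\<close> say that an operator with entries \<open>A, B, C, E\<close>, in the coordinates
  \<open>(u, v) T\<close>, does not raise degrees; \<open>G1\<close>--\<open>G4\<close> say the same of its adjoint.\<close>

locale filtered_arrays =
  fixes a b :: complex and A B C E :: "nat \<Rightarrow> nat \<Rightarrow> complex"
  assumes F1: "m > n \<Longrightarrow> C m n = 0"
    and F2: "m > n \<Longrightarrow> E m n = - pl a b C m n"
    and F3: "m > n \<Longrightarrow> A m n = pr a b C m n"
    and F4: "m > n \<Longrightarrow> B m n = pr a b E m n - pl a b A m n + pl a b (pr a b C) m n"
    and G1: "m < n \<Longrightarrow> B m n = 0"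
    and G2: "m < n \<Longrightarrow> A m n = pl a b B m n"
    and G3: "m < n \<Longrightarrow> E m n = - pr a b B m n"
    and G4: "m < n \<Longrightarrow> C m n = pl a b E m n - pr a b A m n + pl a b (pr a b B) m n"
begin

text \<open>\<open>F4\<close> two places below the diagonal, with the entries of \<open>A\<close>
  and \<open>E\<close> below the diagonal expressed through \<open>C\<close>; the bound on
  \<open>n\<close> keeps the predecessor indices from truncating.\<close>

lemma second_diagonal:
  assumes "n \<ge> 2"
  shows "B (Suc (Suc n)) n = a * (E (Suc (Suc n)) (Suc (Suc n)) - (of_nat n + 1) * (of_nat n + 2) / 4 * A n n)
     - b\<^sup>2 * (of_nat n + 2) / 2 * C (Suc n) (Suc n) + a\<^sup>2 * (of_nat n + 1) * (of_nat n + 2) / 4 * C n (Suc (Suc n))"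
proof -
  obtain k where n: "n = Suc (Suc k)" using assms by (auto dest!: le_Suc_ex)
  show ?thesis
    unfolding n
    by (subst F4, simp) (simp add: pl_def pr_def F1 F2 F3, simp add: field_simps power2_eq_square)
qed

text \<open>\<open>G4\<close> three places above the diagonal; it removes the one entry of
  \<open>C\<close> that would otherwise remain in \<open>first_diagonal\<close>.\<close>

lemma third_diagonal:
  assumes "n \<ge> 3"
  shows "C (n - 1) (Suc (Suc n)) = - (a * b * (of_nat n + 2) / 2 * (B (Suc n) (Suc n) + (of_nat n + 1) / 2 * B n n)
     + a\<^sup>2 * ((of_nat n + 1) * (of_nat n + 2)) / 4 * B (Suc n) n)"
proof -
  obtain k where n: "n = Suc (Suc (Suc k))" using assms by (auto dest!: le_Suc_ex simp: numeral_3_eq_3)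
  show ?thesis
    unfolding n
    by (subst G4, simp) (simp add: pl_def pr_def G1 G2 G3, simp add: field_simps power2_eq_square)
qed

text \<open>After the eliminations \<open>B (Suc n) n\<close> occurs on both sides of
  \<open>F4\<close>; collecting it produces the product of two consecutive values of
  \<open>qq\<close>.\<close>

lemma first_diagonal:
  assumes "n \<ge> 3"
  shows "qq a (of_nat n) * qq a (of_nat n + 1) * B (Suc n) n =
     b * (E (Suc n) (Suc n) - (of_nat n + 1) / 2 * A n n) + b\<^sup>2 * (of_nat n + 1) / 2 * C n (Suc n)
     + a * b * (of_nat n + 1) / 2 * (of_nat n / 2 * C (n - 1) (Suc n) + C n (Suc (Suc n)))
     - a * b * ((of_nat n + 2) / 2 * qq a (of_nat n) * B (Suc n) (Suc n)
        + of_nat n / 2 * ((of_nat n + 1) / 2) * qq a (of_nat n + 1) * B n n)"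
proof -
  obtain k where n: "n = Suc (Suc (Suc k))" using assms by (auto dest!: le_Suc_ex simp: numeral_3_eq_3)
  note c = third_diagonal[OF assms, unfolded n, simplified]
  have "qq a (of_nat n) * qq a (of_nat n + 1) * B (Suc n) n -
     (b * (E (Suc n) (Suc n) - (of_nat n + 1) / 2 * A n n) + b\<^sup>2 * (of_nat n + 1) / 2 * C n (Suc n)
     + a * b * (of_nat n + 1) / 2 * (of_nat n / 2 * C (n - 1) (Suc n) + C n (Suc (Suc n)))
     - a * b * ((of_nat n + 2) / 2 * qq a (of_nat n) * B (Suc n) (Suc n)
        + of_nat n / 2 * ((of_nat n + 1) / 2) * qq a (of_nat n + 1) * B n n)) =
     B (Suc n) n - (pr a b E (Suc n) n - pl a b A (Suc n) n + pl a b (pr a b C) (Suc n) n)"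
    unfolding n qq_def
    by (simp add: pl_def pr_def F1 F2 F3 G1 G2 G3 c) (simp add: field_simps power2_eq_square)
  also have "\<dots> = 0"
    using F4[of n "Suc n"] by simp
  finally show ?thesis by simp
qed

text \<open>In this and the next identities named \<open>diagonal\<close>, the left side is the
  Hermite component of index \<open>n\<close> of an entry of \<open>gm n\<close> after the operator
  has acted. On the right, the off-diagonal entries of \<open>E\<close> or \<open>A\<close> are
  eliminated.\<close>

lemma diagonal_12: "qq a (of_nat n) * B n n - a * b / 4 * (of_nat n + 1) * of_nat n * B n (n - 1)
    - a * qq a (of_nat n) * E n (Suc (Suc n)) - b * E n (Suc n)
    = B n n * (qq a (of_nat n) * qq a (of_nat n + 1) + b\<^sup>2 * (of_nat n + 1) / 2)"
  by (simp add: pr_def G1 G3 qq_def) (simp add: field_simps power2_eq_square)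

lemma diagonal_22: "b / 2 * of_nat n * B n (n - 1) + a * qq a (of_nat n) / 4 * of_nat n * (of_nat n - 1) * B n (n - 2)
    - a * b / 2 * of_nat n * E n (Suc n) + qq a (of_nat n) * E n n
    = qq a (of_nat n) * (E n n + a * of_nat n * (of_nat n - 1) / 4 * B n (n - 2) + b * of_nat n / 2 * B n (n - 1))
      + a * b\<^sup>2 * of_nat n * (of_nat n + 1) / 4 * B n n"
  by (simp add: pr_def G1 G3 qq_def) (simp add: field_simps power2_eq_square)

text \<open>The factors \<open>n\<close> and \<open>n (n - 1)\<close> make the truncated indices for
  \<open>n = 0\<close> and \<open>n = 1\<close> harmless.\<close>

lemma nat_mult_A:
  "of_nat n * A n (n - 1) = of_nat n * (a * C n (Suc n) + b * C n n)"
  "of_nat n * (of_nat n - 1) * A n (n - 2) = of_nat n * (of_nat n - 1) * (a * C n n)"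
proof -
  consider "n = 0" | "n = 1" | k where "n = Suc (Suc k)"
    by (metis One_nat_def not0_implies_Suc)
  note c = this
  show "of_nat n * A n (n - 1) = of_nat n * (a * C n (Suc n) + b * C n n)"
    using c by cases (simp_all add: F3 F1 pr_def)
  show "of_nat n * (of_nat n - 1) * A n (n - 2) = of_nat n * (of_nat n - 1) * (a * C n n)"
    using c by cases (simp_all add: F3 F1 pr_def)
qed

lemma diagonal_11: "qq a (of_nat n) * A n n - a * b / 4 * (of_nat n + 1) * (of_nat n * A n (n - 1))
    - a * qq a (of_nat n) * C n (Suc (Suc n)) - b * C n (Suc n)
    = qq a (of_nat n) * (A n n - a * C n (Suc (Suc n)) - b * C n (Suc n)) - a * b\<^sup>2 * of_nat n * (of_nat n + 1) / 4 * C n n"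
  unfolding nat_mult_A by (simp add: qq_def field_simps power2_eq_square)

lemma diagonal_21: "b / 2 * (of_nat n * A n (n - 1)) + a * qq a (of_nat n) / 4 * (of_nat n * (of_nat n - 1) * A n (n - 2))
    - a * b / 2 * of_nat n * C n (Suc n) + qq a (of_nat n) * C n n
    = C n n * (qq a (of_nat n) * qq a (of_nat n - 1) + b\<^sup>2 * of_nat n / 2)"
  unfolding nat_mult_A by (simp add: qq_def field_simps power2_eq_square)

text \<open>Transposition for the Gaussian form interchanges degree bounds and orthogonality, hence
  \<open>F\<close> with \<open>G\<close> and \<open>B\<close> with \<open>C\<close>. Every relation
  derived in this locale therefore has a dual.\<close>

lemma transpose: "filtered_arrays a b (\<lambda>m n. A n m) (\<lambda>m n. C n m) (\<lambda>m n. B n m) (\<lambda>m n. E n m)"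
proof -
  have t: "pl a b (\<lambda>m n. X n m) m n = pr a b X n m" "pr a b (\<lambda>m n. X n m) m n = pl a b X n m" for X m n
    by (simp_all add: pl_def pr_def)
  have tt: "pl a b (pr a b (\<lambda>m n. X n m)) m n = pl a b (pr a b X) n m" for X m n
  proof -
    \<comment> \<open>Left and right multiplication commute; with the coefficients named, the claim
      is a mere rearrangement of products.\<close>
    define c1 where "c1 = a * (of_nat m + 1/2)"
    define c2 where "c2 = b * (of_nat m / 2)"
    define c3 where "c3 = a * (of_nat m * (of_nat m - 1) / 4)"
    define d1 where "d1 = a * (of_nat n + 1/2)"
    define d2 where "d2 = b * (of_nat n / 2)"
    define d3 where "d3 = a * (of_nat n * (of_nat n - 1) / 4)"
    show ?thesis
      unfolding pl_def pr_def c1_def[symmetric] c2_def[symmetric] c3_def[symmetric]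
        d1_def[symmetric] d2_def[symmetric] d3_def[symmetric]
      by (simp only: distrib_left add_ac mult_ac)
  qed
  show ?thesis
    by unfold_locales (simp_all add: t[of A] t[of B] t[of C] t[of E] tt[of B] tt[of C] F1 F2 F3 G1 G2 G3 F4 G4)
qed

end

section \<open>Translation of the bochner algebra conditions into arrays\<close>

definition arr :: "(complex poly \<Rightarrow> complex poly) \<Rightarrow> nat \<Rightarrow> nat \<Rightarrow> complex" where
  "arr L m n = gint (herm m * L (herm n))"

context ab_weight begin

lemma pp_herm: "pp * herm m = smult ac (herm (Suc (Suc m))) + smult bc (herm (Suc m)) + smult (ac * (of_nat m + 1/2)) (herm m)
    + smult (bc * (of_nat m / 2)) (herm (m - 1)) + smult (ac * (of_nat m * (of_nat m - 1) / 4)) (herm (m - 2))"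
proof -
  have 1: "smult (of_nat m / 2) ([:0, 1:] * herm (m - 1)) = smult (of_nat m / 2) (herm m) + smult (of_nat m * (of_nat m - 1) / 4) (herm (m - 2))"
  proof (cases m)
    case (Suc k)
    then show ?thesis
      unfolding x_herm[of "m - 1"] by (simp add: smult_add_right numeral_2_eq_2)
  qed simp
  have "pp * herm m = smult ac ([:0, 1:] * ([:0, 1:] * herm m)) + smult bc ([:0, 1:] * herm m)"
    by (rule poly_ext) (simp add: pp_def algebra_simps)
  also have "[:0, 1:] * herm m = herm (Suc m) + smult (of_nat m / 2) (herm (m - 1))"
    by (rule x_herm)
  also have "[:0, 1:] * (herm (Suc m) + smult (of_nat m / 2) (herm (m - 1))) =
      herm (Suc (Suc m)) + smult ((of_nat m + 1) / 2) (herm m) + smult (of_nat m / 2) ([:0, 1:] * herm (m - 1))"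
    unfolding distrib_left x_herm[of "Suc m"] by (simp add: add.commute)
  finally show ?thesis
    unfolding 1 by (intro poly_ext) (simp add: field_simps)
qed

lemma gint_herm_pp: "gint (herm m * (pp * L (herm n))) = pl ac bc (arr L) m n"
proof -
  have "gint (herm m * (pp * L (herm n))) = gint ((pp * herm m) * L (herm n))"
    by (simp only: mult_ac)
  also have "\<dots> = pl ac bc (arr L) m n"
    unfolding pp_herm by (simp add: distrib_right gint_add gint_smult pl_def arr_def)
  finally show ?thesis .
qed

lemma gint_herm_sact_pp: "gint (herm m * sact D r s (pp * herm n)) = pr ac bc (arr (sact D r s)) m n"
  unfolding pp_herm by (simp add: sact_add sact_smult distrib_left gint_add gint_smult pr_def arr_def)

lemma gint_herm_pp_sact_pp:
  "gint (herm m * (pp * sact D r s (pp * herm n))) = pl ac bc (pr ac bc (arr (sact D r s))) m n"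
proof -
  have "gint (herm m * (pp * sact D r s (pp * herm n))) = gint ((pp * herm m) * sact D r s (pp * herm n))"
    by (simp only: mult_ac)
  also have "\<dots> = pl ac bc (pr ac bc (arr (sact D r s))) m n"
    unfolding pp_herm[of m]
    by (simp add: distrib_right gint_add gint_smult gint_herm_sact_pp pl_def)
  finally show ?thesis .
qed

text \<open>A single row with prescribed coordinates after \<open>T\<close>, padded by a zero row
  because operators act on square matrices.\<close>

definition row :: "complex poly \<Rightarrow> complex poly \<Rightarrow> 2 pmat" where
  "row u w = mat2 u w 0 0 ** Ti"

lemma row_T: "row u w ** T = mat2 u w 0 0"
  by (simp add: row_def Ti_T flip: matrix_mul_assoc)

text \<open>The counterpart of a degree bound: \<open>f\<close> is Gaussian-orthogonal to all
  polynomials of degree below \<open>n\<close>.\<close>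

definition val :: "nat \<Rightarrow> complex poly \<Rightarrow> bool" where
  "val n f \<longleftrightarrow> (\<forall>k<n. gint (herm k * f) = 0)"

definition hat :: "2 dop \<Rightarrow> 2 dop" where "hat D = dop_conj Ti T D"

lemma degree_hat: "degree (hat D) = degree D"
  unfolding hat_def by (simp add: degree_dop_conj T_Ti Ti_T)

lemma row_act: "(row u w \<cdot>\<^sub>D D) ** T = mat2 u w 0 0 \<cdot>\<^sub>D hat D"
  by (simp add: hat_def dop_act_conj row_def)

lemma mat2_act:
  "(mat2 u w 0 0 \<cdot>\<^sub>D F) $ 1 $ 1 = sact F 1 1 u + sact F 2 1 w"
  "(mat2 u w 0 0 \<cdot>\<^sub>D F) $ 1 $ 2 = sact F 1 2 u + sact F 2 2 w"
  by (simp_all add: dop_act_sact sum_2)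

text \<open>The second entry of \<open>row u w\<close> is \<open>w + pp * u\<close>, which explains
  the shape of the second hypothesis and of the second conclusion.\<close>

lemma
  assumes D: "D \<in> bochner_algebra UNIV (W_ab a b)"
    and u: "degree u \<le> n" and w: "degree (w + pp * u) \<le> n"
  shows filter_degree: "degree (sact (hat D) 1 1 u + sact (hat D) 2 1 w) \<le> n"
    and filter_degree': "degree (sact (hat D) 1 2 u + sact (hat D) 2 2 w
        + pp * (sact (hat D) 1 1 u + sact (hat D) 2 1 w)) \<le> n"
proof -
  have "pdegree (row u w) \<le> n"
    unfolding pdegree_le_iff row_def using u w
    by (simp add: forall_2 matrix_mult_entry_2 mult.commute add.commute)
  then have d: "pdegree (row u w \<cdot>\<^sub>D D) \<le> n"
    unfolding pdegree_le_iff_below by (rule bochner_deg_below[OF D])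
  have R: "row u w \<cdot>\<^sub>D D = (mat2 u w 0 0 \<cdot>\<^sub>D hat D) ** Ti"
    by (simp add: T_Ti flip: row_act matrix_mul_assoc)
  have "(row u w \<cdot>\<^sub>D D) $ 1 $ 1 = sact (hat D) 1 1 u + sact (hat D) 2 1 w"
    unfolding R by (simp add: matrix_mult_entry_2[of _ Ti] mat2_act)
  then show "degree (sact (hat D) 1 1 u + sact (hat D) 2 1 w) \<le> n"
    using d unfolding pdegree_le_iff by metis
  have "(row u w \<cdot>\<^sub>D D) $ 1 $ 2 = sact (hat D) 1 2 u + sact (hat D) 2 2 w
        + pp * (sact (hat D) 1 1 u + sact (hat D) 2 1 w)"
    unfolding R by (simp add: matrix_mult_entry_2[of _ Ti] mat2_act algebra_simps)
  then show "degree (sact (hat D) 1 2 u + sact (hat D) 2 2 w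
        + pp * (sact (hat D) 1 1 u + sact (hat D) 2 1 w)) \<le> n"
    using d unfolding pdegree_le_iff by metis
qed

text \<open>The pairing with a row of low degree splits into \<open>u - pp * w\<close> against its
  first and \<open>w\<close> against its second entry. Testing the image on rows with the single
  entry \<open>herm k\<close> recovers the two parts.\<close>

lemma
  assumes D: "D \<in> bochner_algebra UNIV (W_ab a b)"
    and w: "val n w" and u: "val n (u - pp * w)"
  shows filter_val: "val n (sact (hat D) 1 2 u + sact (hat D) 2 2 w)"
    and filter_val': "val n (sact (hat D) 1 1 u + sact (hat D) 2 1 w - pp * (sact (hat D) 1 2 u + sact (hat D) 2 2 w))"
proof -
  have low: "gint (f * map_poly cnj g) = 0" if "val n f" "\<forall>k\<ge>n. coeff g k = 0" for f g
  proof (cases "g = 0")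
    case False
    then have "degree g < n"
      using that(2) False by (meson leading_coeff_0_iff not_le)
    then show ?thesis
      using gint_lower_eq_0[of n f "map_poly cnj g"] that(1) by (simp add: val_def mult.commute)
  qed simp
  have "ip (row u w) Q = 0" if "deg_below n Q" for Q
  proof -
    have "ip (row u w) Q $ i $ j = 0" for i j
    proof (cases "i = 1")
      case True
      have "ip (row u w) Q $ i $ j = gint ((u - pp * w) * map_poly cnj (Q $ j $ 1)) + gint (w * map_poly cnj (Q $ j $ 2))"
        unfolding ip_entry row_T True gint_add[symmetric] by (simp add: algebra_simps)
      then show ?thesis using low[OF u] low[OF w] that by (simp add: deg_below_iff_coeff)
    next
      case False
      then have "i = 2" using exhaust_2 by blast
      then show ?thesis unfolding ip_entry row_T by simp
    qed
    then show ?thesis by (simp add: vec_eq_iff)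
  qed
  then have orth: "ip (row u w \<cdot>\<^sub>D D) Q = 0" if "deg_below n Q" for Q
    using bochner_orthogonal[OF D _ that] by blast
  have below: "deg_below n (mat2 f g 0 0)" if "\<And>k. k \<ge> n \<Longrightarrow> coeff f k = 0" "\<And>k. k \<ge> n \<Longrightarrow> coeff g k = 0" for f g
    using that by (auto simp: deg_below_iff_coeff forall_2)
  show "val n (sact (hat D) 1 2 u + sact (hat D) 2 2 w)"
    unfolding val_def
  proof (intro allI impI)
    fix k assume "k < n"
    then have "deg_below n (mat2 0 (herm k) 0 0)" by (intro below) (auto simp: coeff_eq_0)
    from orth[OF this] have "ip (row u w \<cdot>\<^sub>D D) (mat2 0 (herm k) 0 0) $ 1 $ 1 = 0" by simp
    then show "gint (herm k * (sact (hat D) 1 2 u + sact (hat D) 2 2 w)) = 0"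
      unfolding ip_entry row_act mat2_act by (simp add: mult.commute)
  qed
  show "val n (sact (hat D) 1 1 u + sact (hat D) 2 1 w - pp * (sact (hat D) 1 2 u + sact (hat D) 2 2 w))"
    unfolding val_def
  proof (intro allI impI)
    fix k assume "k < n"
    then have "deg_below n (mat2 (herm k) 0 0 0)" by (intro below) (auto simp: coeff_eq_0)
    from orth[OF this] have "ip (row u w \<cdot>\<^sub>D D) (mat2 (herm k) 0 0 0) $ 1 $ 1 = 0" by simp
    then show "gint (herm k * (sact (hat D) 1 1 u + sact (hat D) 2 1 w - pp * (sact (hat D) 1 2 u + sact (hat D) 2 2 w))) = 0"
      unfolding ip_entry row_act mat2_act by (simp add: algebra_simps)
  qed
qed

lemma filtered_arrays_hat:
  assumes D: "D \<in> bochner_algebra UNIV (W_ab a b)"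
  shows "filtered_arrays ac bc (arr (sact (hat D) 1 1)) (arr (sact (hat D) 1 2))
    (arr (sact (hat D) 2 1)) (arr (sact (hat D) 2 2))"
proof -
  let ?A = "sact (hat D) 1 1" and ?B = "sact (hat D) 1 2" and ?C = "sact (hat D) 2 1" and ?E = "sact (hat D) 2 2"
  note dist = distrib_left right_diff_distrib gint_add gint_diff gint_minus mult_minus_right minus_mult_right[symmetric]
    sact_minus gint_herm_pp gint_herm_sact_pp gint_herm_pp_sact_pp arr_def[symmetric]
  have val_herm: "val n (herm n)" for n
    by (simp add: val_def gint_herm_herm)
  \<comment> \<open>The test rows are \<open>(0, herm n)\<close> and
    \<open>(herm n, - pp * herm n)\<close>, the images under \<open>T\<close> of
    \<open>(0, herm n)\<close> and \<open>(herm n, 0)\<close>.\<close>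
  have F: "degree (?C (herm n)) \<le> n" "degree (?E (herm n) + pp * ?C (herm n)) \<le> n"
    "degree (?A (herm n) - ?C (pp * herm n)) \<le> n"
    "degree (?B (herm n) - ?E (pp * herm n) + pp * (?A (herm n) - ?C (pp * herm n))) \<le> n" for n
    using filter_degree[OF D, of 0 n "herm n"] filter_degree'[OF D, of 0 n "herm n"]
      filter_degree[OF D, of "herm n" n "- (pp * herm n)"] filter_degree'[OF D, of "herm n" n "- (pp * herm n)"]
    by (simp_all add: sact_minus)
  \<comment> \<open>The test rows are \<open>(herm n, 0)\<close> and
    \<open>(pp * herm n, herm n)\<close>; in both, \<open>w\<close> and \<open>u - pp * w\<close>
    have no component below \<open>n\<close>.\<close>
  have G: "val n (?B (herm n))" "val n (?A (herm n) - pp * ?B (herm n))"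
    "val n (?B (pp * herm n) + ?E (herm n))"
    "val n (?A (pp * herm n) + ?C (herm n) - pp * (?B (pp * herm n) + ?E (herm n)))" for n
    using filter_val[OF D, of n 0 "herm n"] filter_val'[OF D, of n 0 "herm n"]
      filter_val[OF D, of n "herm n" "pp * herm n"] filter_val'[OF D, of n "herm n" "pp * herm n"] val_herm[of n]
    by (simp_all add: val_def)
  show ?thesis
  proof
    fix m n :: nat assume mn: "m > n"
    have z: "degree f \<le> n \<Longrightarrow> gint (herm m * f) = 0" for f
      using mn by (simp add: degree_le_iff_gint)
    show "arr ?C m n = 0" using z[OF F(1)] by (simp add: arr_def)
    show "arr ?E m n = - pl ac bc (arr ?C) m n" using z[OF F(2)[of]]
      unfolding dist by (simp add: eq_neg_iff_add_eq_0)
    show "arr ?A m n = pr ac bc (arr ?C) m n" using z[OF F(3)[of]] unfolding dist by simp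
    show "arr ?B m n = pr ac bc (arr ?E) m n - pl ac bc (arr ?A) m n + pl ac bc (pr ac bc (arr ?C)) m n"
      using z[OF F(4)[of]] unfolding dist by (simp add: algebra_simps)
  next
    fix m n :: nat assume mn: "m < n"
    have z: "val n f \<Longrightarrow> gint (herm m * f) = 0" for f
      using mn by (simp add: val_def)
    show "arr ?B m n = 0" using z[OF G(1)] by (simp add: arr_def)
    show "arr ?A m n = pl ac bc (arr ?B) m n" using z[OF G(2)[of]] unfolding dist by simp
    show "arr ?E m n = - pr ac bc (arr ?B) m n" using z[OF G(3)[of]]
      unfolding dist by (simp add: eq_neg_iff_add_eq_0 add.commute)
    show "arr ?C m n = pl ac bc (arr ?E) m n - pr ac bc (arr ?A) m n + pl ac bc (pr ac bc (arr ?B)) m n"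
      using z[OF G(4)[of]] unfolding dist by (simp add: algebra_simps)
  qed
qed

text \<open>The basis of the rows of \<open>B n ** T\<close> whose Hermite components of index \<open>n\<close> are \<open>(q, 0)\<close> and
  \<open>(0, q)\<close> with \<open>q = qq ac n\<close>, so that the action of \<open>hat D\<close> can be read off these components.\<close>

definition gm :: "nat \<Rightarrow> 2 pmat" where
  "gm n = pconst (mat2 (1/2) (- ac * (of_nat n + 1) / 4) (ac * of_nat n / 4) (1/2)) ** (B n ** T)"

lemma gm_entries:
  fixes n :: nat
  defines "q \<equiv> qq ac (of_nat n)"
  shows "gm n $ 1 $ 1 = smult q (herm n) - smult (ac * bc / 4 * (of_nat n + 1)) (pderiv (herm n))"
    and "gm n $ 1 $ 2 = smult (- ac * q) (herm (Suc (Suc n))) - smult bc (herm (Suc n))"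
    and "gm n $ 2 $ 1 = smult (bc / 2) (pderiv (herm n)) + smult (ac * q / 4) (pderiv (pderiv (herm n)))"
    and "gm n $ 2 $ 2 = smult (- ac * bc / 2 * of_nat n) (herm (Suc n)) + smult q (herm n)"
  unfolding gm_def B_T matrix_mult_entry_2
  by (rule poly_ext,
      simp add: q_def qq_def pconst_def eu1_def eu2_def ew1_def ew2_def,
      simp add: field_simps power2_eq_square)+

lemma qq_real: "qq ac (of_nat n) = of_real (1 + a\<^sup>2 * real n * (real n + 1) / 4)"
  by (simp add: qq_def)

lemma qq_nz: "qq ac (of_nat n) \<noteq> 0"
proof -
  have "1 + a\<^sup>2 * real n * (real n + 1) / 4 > 0"
    by (intro add_pos_nonneg) auto
  then show ?thesis unfolding qq_real by (simp only: of_real_eq_0_iff)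
qed

lemma B_T_gm: "\<exists>U. B n ** T = pconst U ** gm n"
proof -
  let ?U = "mat2 (1/2) (- ac * (of_nat n + 1) / 4) (ac * of_nat n / 4) (1/2)"
  have "det ?U = qq ac (of_nat n) / 4"
    by (simp add: det_2 qq_def field_simps power2_eq_square)
  then have "det ?U \<noteq> 0" using qq_nz[of n] by (simp only: divide_eq_0_iff) simp
  then have "invertible ?U" by (simp only: invertible_det_nz not_False_eq_True)
  then have "pconst (matrix_inv ?U ** ?U) ** (B n ** T) = B n ** T"
    by (simp only: matrix_inv_mult pconst_mat1 matrix_mul_lid)
  then have "B n ** T = pconst (matrix_inv ?U) ** gm n"
    by (simp only: gm_def pconst_mult matrix_mul_assoc)
  then show ?thesis ..
qed

lemma gm_act:
  assumes "D \<in> bochner_algebra UNIV (W_ab a b)"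
  shows "\<exists>K. gm n \<cdot>\<^sub>D hat D = pconst K ** gm n"
proof -
  obtain M where M: "B n \<cdot>\<^sub>D D = pconst M ** B n"
    using assms unfolding bochner_algebra_iff by blast
  have BT: "(B n ** T) \<cdot>\<^sub>D hat D = pconst M ** (B n ** T)"
    by (simp add: hat_def dop_act_conj M T_Ti flip: matrix_mul_assoc)
  obtain U where U: "B n ** T = pconst U ** gm n" using B_T_gm by blast
  obtain U' where U': "gm n = pconst U' ** (B n ** T)" by (auto simp: gm_def)
  have BT': "(B n ** T) \<cdot>\<^sub>D hat D = pconst M ** (pconst U ** gm n)"
    unfolding BT by (simp only: U)
  have "gm n \<cdot>\<^sub>D hat D = pconst U' ** (pconst M ** (pconst U ** gm n))"
    by (subst U') (simp only: dop_act_pconst_mult BT')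
  also have "\<dots> = pconst (U' ** M ** U) ** gm n"
    by (simp only: pconst_mult matrix_mul_assoc)
  finally show ?thesis by blast
qed

end

subsection \<open>Polynomial growth along the even integers\<close>

text \<open>The variable \<open>m\<close> parametrises the even index \<open>n = 2 * m + 4\<close>;
  the base \<open>m + 1\<close> is at least 1, so the bounds increase with \<open>k\<close>.\<close>

definition grow :: "nat \<Rightarrow> (nat \<Rightarrow> complex) \<Rightarrow> bool" where
  "grow k f \<longleftrightarrow> (\<exists>C. \<forall>m. cmod (f m) \<le> C * (real m + 1) ^ k)"

lemma growE:
  assumes "grow k f" obtains C where "C \<ge> 0" "\<And>m. cmod (f m) \<le> C * (real m + 1) ^ k"
proof -
  obtain C where C: "\<And>m. cmod (f m) \<le> C * (real m + 1) ^ k" using assms by (auto simp: grow_def)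
  have "C \<ge> 0" using order.trans[OF norm_ge_zero C[of 0]] by simp
  then show thesis using that C by blast
qed

lemma grow_mono: "grow k f \<Longrightarrow> k \<le> l \<Longrightarrow> grow l f"
proof -
  assume "grow k f" "k \<le> l"
  then obtain C where C: "C \<ge> 0" "\<And>m. cmod (f m) \<le> C * (real m + 1) ^ k" by (auto elim: growE)
  have "C * (real m + 1) ^ k \<le> C * (real m + 1) ^ l" for m
    using C(1) \<open>k \<le> l\<close> by (intro mult_left_mono power_increasing) auto
  then show ?thesis unfolding grow_def using C(2) order.trans by blast
qed

lemma grow_add: "grow k f \<Longrightarrow> grow k g \<Longrightarrow> grow k (\<lambda>m. f m + g m)"
proof -
  assume "grow k f" "grow k g"
  then obtain C C' where "\<And>m. cmod (f m) \<le> C * (real m + 1) ^ k" "\<And>m. cmod (g m) \<le> C' * (real m + 1) ^ k"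
    by (auto simp: grow_def)
  then have "cmod (f m + g m) \<le> (C + C') * (real m + 1) ^ k" for m
    unfolding distrib_right by (intro norm_triangle_mono)
  then show ?thesis unfolding grow_def by blast
qed

lemma grow_mult: "grow k f \<Longrightarrow> grow l g \<Longrightarrow> grow (k + l) (\<lambda>m. f m * g m)"
proof -
  assume "grow k f" "grow l g"
  then obtain C C' where C: "C \<ge> 0" "C' \<ge> 0"
    "\<And>m. cmod (f m) \<le> C * (real m + 1) ^ k" "\<And>m. cmod (g m) \<le> C' * (real m + 1) ^ l"
    by (metis growE)
  then have "cmod (f m * g m) \<le> (C * (real m + 1) ^ k) * (C' * (real m + 1) ^ l)" for m
    unfolding norm_mult by (intro mult_mono) auto
  then have "cmod (f m * g m) \<le> (C * C') * (real m + 1) ^ (k + l)" for m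
    by (simp add: power_add mult_ac)
  then show ?thesis unfolding grow_def by blast
qed

lemma grow_const [simp]: "grow k (\<lambda>m. c)"
  by (rule grow_mono[of 0]) (auto simp: grow_def)

lemma grow_cmult: "grow k f \<Longrightarrow> grow k (\<lambda>m. c * f m)"
  using grow_mult[of 0 "\<lambda>m. c" k f] by simp

lemma grow_cmult_right: "grow k f \<Longrightarrow> grow k (\<lambda>m. f m * c)"
  using grow_cmult[of k f c] by (simp add: mult.commute)

lemma grow_minus: "grow k f \<Longrightarrow> grow k (\<lambda>m. - f m)"
  using grow_cmult[of k f "-1"] by simp

lemma grow_diff: "grow k f \<Longrightarrow> grow k g \<Longrightarrow> grow k (\<lambda>m. f m - g m)"
  using grow_add[of k f "\<lambda>m. - g m"] grow_minus[of k g] by simp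

lemma grow_sum: "(\<And>x. x \<in> S \<Longrightarrow> grow k (f x)) \<Longrightarrow> grow k (\<lambda>m. \<Sum>x\<in>S. f x m)"
  by (induction S rule: infinite_finite_induct) (auto intro: grow_add)

lemma grow_power: "grow 1 f \<Longrightarrow> grow j (\<lambda>m. f m ^ j)"
  by (induction j) (use grow_mult[of 1] in auto)

lemma grow_linear: "grow 1 (\<lambda>m. of_nat (2 * m + 4) + c)"
proof -
  have "cmod (of_nat (2 * m + 4) + c) \<le> (4 + cmod c) * (real m + 1) ^ 1" for m
  proof -
    have "cmod (of_nat (2 * m + 4) + c) \<le> real (2 * m + 4) + cmod c"
      by (metis norm_of_nat norm_triangle_ineq)
    also have "\<dots> \<le> (4 + cmod c) * (real m + 1)"
      using mult_nonneg_nonneg[of "cmod c" "real m"] by (simp add: algebra_simps)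
    finally show ?thesis by simp
  qed
  then show ?thesis unfolding grow_def by blast
qed

lemma grow_poly:
  assumes "degree p \<le> k"
  shows "grow k (\<lambda>m. poly p (of_nat (2 * m + 4) + c))"
  unfolding poly_altdef
  by (intro grow_sum grow_cmult grow_mono[OF grow_power[OF grow_linear]]) (use assms in auto)

lemma grow_cancel:
  assumes "grow (k + j) (\<lambda>m. w m * f m)" "c > 0" "\<And>m. cmod (w m) \<ge> c * (real m + 1) ^ j"
  shows "grow k f"
proof -
  obtain C where C: "\<And>m. cmod (w m * f m) \<le> C * (real m + 1) ^ (k + j)"
    using assms(1) by (auto simp: grow_def)
  have "cmod (f m) \<le> C / c * (real m + 1) ^ k" for m
  proof -
    have "c * (real m + 1) ^ j * cmod (f m) \<le> cmod (w m) * cmod (f m)"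
      by (intro mult_right_mono assms) auto
    also have "\<dots> \<le> C * (real m + 1) ^ (k + j)" using C[of m] by (simp add: norm_mult)
    finally have "(real m + 1) ^ j * (c * cmod (f m)) \<le> (real m + 1) ^ j * (C * (real m + 1) ^ k)"
      by (simp add: power_add mult_ac)
    then have "c * cmod (f m) \<le> C * (real m + 1) ^ k"
      by (rule mult_left_le_imp_le) simp
    then show ?thesis using \<open>c > 0\<close> by (simp add: field_simps)
  qed
  then show ?thesis unfolding grow_def by blast
qed

lemma inverse_bound_zero:
  assumes "\<And>m. x \<le> C / (real m + 1)" "x \<ge> 0" shows "x = (0::real)"
proof (rule ccontr)
  assume "x \<noteq> 0"
  then have x: "x > 0" using assms(2) by simp
  obtain m :: nat where "C / x < real m" using reals_Archimedean2 by blast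
  then have "C < x * (real m + 1)" using x by (simp add: field_simps)
  then show False using assms(1)[of m] x by (simp add: field_simps)
qed

text \<open>Divided by the power of \<open>n\<close> given by its degree, \<open>p\<close> tends to
  its leading coefficient along the even integers; slower growth would make that coefficient
  zero.\<close>

lemma degree_le_grow:
  assumes "grow k (\<lambda>m. poly p (of_nat (2 * m + 4)))"
  shows "degree p \<le> k"
proof (rule ccontr)
  assume "\<not> degree p \<le> k"
  define d where "d = degree p"
  have d: "d > k" using \<open>\<not> degree p \<le> k\<close> by (simp add: d_def)
  obtain C where C: "C \<ge> 0" "\<And>m. cmod (poly p (of_nat (2 * m + 4))) \<le> C * (real m + 1) ^ k"
    using assms by (auto elim: growE)
  have "filterlim (\<lambda>m. of_nat (2 * m + 4) :: complex) at_infinity sequentially"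
    by (rule filterlim_compose[OF tendsto_of_nat])
      (auto intro!: filterlim_at_top_mono[OF filterlim_ident])
  from filterlim_compose[OF poly_divide_tendsto_aux this]
  have lim: "(\<lambda>m. poly p (of_nat (2 * m + 4)) / of_nat (2 * m + 4) ^ d) \<longlonglongrightarrow> lead_coeff p"
    by (simp add: d_def)
  have "(\<lambda>m. poly p (of_nat (2 * m + 4)) / of_nat (2 * m + 4) ^ d) \<longlonglongrightarrow> 0"
  proof (rule Lim_null_comparison)
    show "(\<lambda>m. C * inverse (real (Suc m))) \<longlonglongrightarrow> 0"
      using tendsto_mult_left[OF LIMSEQ_inverse_real_of_nat, of C] by simp
    have "norm (poly p (of_nat (2 * m + 4)) / of_nat (2 * m + 4) ^ d) \<le> C * inverse (real (Suc m))" for m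
    proof -
      have "(real m + 1) ^ Suc k \<le> (real m + 1) ^ d"
        using d by (intro power_increasing) auto
      also have "\<dots> \<le> real (2 * m + 4) ^ d" by (intro power_mono) auto
      finally have le: "(real m + 1) ^ Suc k \<le> real (2 * m + 4) ^ d" .
      have "norm (poly p (of_nat (2 * m + 4)) / of_nat (2 * m + 4) ^ d)
          = cmod (poly p (of_nat (2 * m + 4))) / real (2 * m + 4) ^ d"
        unfolding norm_divide norm_power norm_of_nat ..
      also have "\<dots> \<le> C * (real m + 1) ^ k / (real m + 1) ^ Suc k"
        using C le by (intro frac_le) auto
      also have "\<dots> = C * inverse (real (Suc m))"
        unfolding power_Suc2 by (simp add: divide_inverse add.commute)
      finally show ?thesis .
    qed
    then show "\<forall>\<^sub>F m in sequentially. norm (poly p (of_nat (2 * m + 4)) / of_nat (2 * m + 4) ^ d) \<le> C * inverse (real (Suc m))"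
      by simp
  qed
  then have "lead_coeff p = 0" using lim LIMSEQ_unique by blast
  then show False using d by (simp add: d_def)
qed

text \<open>The device of all later degree comparisons. When the multiplier alone outgrows the
  bound, \<open>p\<close> is \<open>O(1/m)\<close> along the sequence and hence zero, which accounts
  for the first alternative.\<close>

lemma grow_cancel_poly:
  assumes g: "grow k (\<lambda>m. w m * poly p (of_nat (2 * m + 4)))"
    and c: "c > 0" "\<And>m. cmod (w m) \<ge> c * (real m + 1) ^ j"
  shows "p = 0 \<or> degree p + j \<le> k"
proof (cases "k < j")
  case True
  define i where "i = j - Suc k"
  have "(real m + 1) ^ Suc k \<le> (real m + 1) ^ j" for m
    using True by (intro power_increasing) auto
  then have w: "cmod (w m) \<ge> c * (real m + 1) ^ Suc k" for m
    using c order.trans mult_left_mono[of _ _ c] by (metis less_imp_le)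
  obtain C where C: "\<And>m. cmod (w m * poly p (of_nat (2 * m + 4))) \<le> C * (real m + 1) ^ k"
    using g unfolding grow_def by blast
  have b: "cmod (poly p (of_nat (2 * m + 4))) \<le> C / c / (real m + 1)" for m
  proof -
    have "c * (real m + 1) ^ Suc k * cmod (poly p (of_nat (2 * m + 4))) \<le> C * (real m + 1) ^ k"
      using mult_right_mono[OF w norm_ge_zero] C[of m] order.trans unfolding norm_mult by blast
    then have "(real m + 1) ^ k * (c * (real m + 1) * cmod (poly p (of_nat (2 * m + 4)))) \<le> (real m + 1) ^ k * C"
      by (simp add: mult_ac)
    then have "c * (real m + 1) * cmod (poly p (of_nat (2 * m + 4))) \<le> C"
      by (rule mult_left_le_imp_le) simp
    then have "cmod (poly p (of_nat (2 * m + 4))) * (c * (real m + 1)) \<le> C" by (simp only: mult_ac)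
    moreover have "c * (real m + 1) > 0" using c by simp
    ultimately have "cmod (poly p (of_nat (2 * m + 4))) \<le> C / (c * (real m + 1))"
      by (simp only: pos_le_divide_eq)
    then show ?thesis by simp
  qed
  have "C / c \<ge> 0" using order.trans[OF norm_ge_zero b[of 0]] by simp
  then have "C / c / (real m + 1) \<le> C / c" for m
    using divide_left_mono[of 1 "real m + 1" "C / c"] by simp
  then have "grow 0 (\<lambda>m. poly p (of_nat (2 * m + 4)))"
    unfolding grow_def using b order.trans by (intro exI[of _ "C / c"]) (simp, blast)
  then have "degree p = 0" using degree_le_grow by fastforce
  then obtain z where z: "p = [:z:]" by (auto elim: degree_eq_zeroE)
  have "cmod z = 0" using b by (intro inverse_bound_zero[of _ "C / c"]) (simp_all add: z)
  then show ?thesis using z by simp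
next
  case False
  then have "grow ((k - j) + j) (\<lambda>m. w m * poly p (of_nat (2 * m + 4)))" using g by simp
  then have "grow (k - j) (\<lambda>m. poly p (of_nat (2 * m + 4)))" by (rule grow_cancel[OF _ c])
  then have "degree p \<le> k - j" by (rule degree_le_grow)
  then have "degree p + j \<le> k" using False by linarith
  then show ?thesis ..
qed

lemma poly_eq_0_even:
  assumes "\<And>m. poly p (of_nat (2 * m + 4) :: complex) = 0" shows "p = 0"
proof -
  have "grow 0 (\<lambda>m. of_nat (Suc m) * poly p (of_nat (2 * m + 4)))"
    unfolding assms by simp
  moreover have "cmod (of_nat (Suc m)) \<ge> 1 * (real m + 1) ^ 1" for m
    unfolding norm_of_nat by simp
  ultimately show ?thesis using grow_cancel_poly[of 0 _ p 1 1] by fastforce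
qed

subsection \<open>Matrix elements are polynomials along diagonals\<close>

text \<open>The norm of the larger index is split off on both sides of the diagonal. Above it this
  is a strong form: each lowering step of \<open>x\<close> or \<partial> brings a factor of its
  index, and these factors are absorbed by the larger norm.\<close>

definition diag_poly :: "(nat \<Rightarrow> nat \<Rightarrow> complex) \<Rightarrow> bool" where
  "diag_poly X \<longleftrightarrow> (\<forall>k. (\<exists>q. \<forall>n. X (n + k) n = of_real (herm_norm (n + k)) * poly q (of_nat n)) \<and>
     (\<exists>q. \<forall>n. X n (n + k) = of_real (herm_norm (n + k)) * poly q (of_nat n)))"

lemma diag_poly_id: "diag_poly (arr (\<lambda>f. f))"
  unfolding diag_poly_def
proof
  fix k
  have "arr (\<lambda>f. f) (n + k) n = of_real (herm_norm (n + k)) * poly (if k = 0 then 1 else 0) (of_nat n)"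
    "arr (\<lambda>f. f) n (n + k) = of_real (herm_norm (n + k)) * poly (if k = 0 then 1 else 0) (of_nat n)" for n
    by (simp_all add: arr_def gint_herm_herm)
  then show "(\<exists>q. \<forall>n. arr (\<lambda>f. f) (n + k) n = of_real (herm_norm (n + k)) * poly q (of_nat n)) \<and>
     (\<exists>q. \<forall>n. arr (\<lambda>f. f) n (n + k) = of_real (herm_norm (n + k)) * poly q (of_nat n))"
    by blast
qed

lemma diag_poly_add:
  assumes "diag_poly X" "diag_poly Y" shows "diag_poly (\<lambda>m n. X m n + Y m n)"
  unfolding diag_poly_def
proof (intro allI conjI)
  fix k
  obtain q r where "\<And>n. X (n + k) n = of_real (herm_norm (n + k)) * poly q (of_nat n)"
    "\<And>n. Y (n + k) n = of_real (herm_norm (n + k)) * poly r (of_nat n)"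
    using assms unfolding diag_poly_def by metis
  then show "\<exists>q. \<forall>n. X (n + k) n + Y (n + k) n = of_real (herm_norm (n + k)) * poly q (of_nat n)"
    by (intro exI[of _ "q + r"]) (simp add: distrib_left)
  obtain q r where "\<And>n. X n (n + k) = of_real (herm_norm (n + k)) * poly q (of_nat n)"
    "\<And>n. Y n (n + k) = of_real (herm_norm (n + k)) * poly r (of_nat n)"
    using assms unfolding diag_poly_def by metis
  then show "\<exists>q. \<forall>n. X n (n + k) + Y n (n + k) = of_real (herm_norm (n + k)) * poly q (of_nat n)"
    by (intro exI[of _ "q + r"]) (simp add: distrib_left)
qed

lemma diag_poly_cmult:
  assumes "diag_poly X" shows "diag_poly (\<lambda>m n. c * X m n)"
  unfolding diag_poly_def
proof (intro allI conjI)
  fix k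
  obtain q where "\<And>n. X (n + k) n = of_real (herm_norm (n + k)) * poly q (of_nat n)"
    using assms unfolding diag_poly_def by metis
  then show "\<exists>q. \<forall>n. c * X (n + k) n = of_real (herm_norm (n + k)) * poly q (of_nat n)"
    by (intro exI[of _ "smult c q"]) simp
  obtain q where "\<And>n. X n (n + k) = of_real (herm_norm (n + k)) * poly q (of_nat n)"
    using assms unfolding diag_poly_def by metis
  then show "\<exists>q. \<forall>n. c * X n (n + k) = of_real (herm_norm (n + k)) * poly q (of_nat n)"
    by (intro exI[of _ "smult c q"]) simp
qed

lemma diag_poly_0: "diag_poly (\<lambda>m n. 0)"
  using diag_poly_cmult[OF diag_poly_id, of 0] by simp

text \<open>Multiplication by \<open>x\<close> is moved to \<open>herm m\<close> and mixes the
  neighbouring diagonals. For \<open>k = 0\<close> one of them lies below and the other above the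
  main diagonal.\<close>

lemma diag_poly_x:
  assumes "diag_poly X"
  shows "diag_poly (\<lambda>m n. X (Suc m) n + of_nat m / 2 * X (m - 1) n)"
  unfolding diag_poly_def
proof (intro allI)
  fix k
  have "\<forall>k. \<exists>q. \<forall>n. X (n + k) n = of_real (herm_norm (n + k)) * poly q (of_nat n)"
    "\<forall>k. \<exists>r. \<forall>n. X n (n + k) = of_real (herm_norm (n + k)) * poly r (of_nat n)"
    using assms by (auto simp: diag_poly_def)
  then obtain q r where q: "\<And>k n. X (n + k) n = of_real (herm_norm (n + k)) * poly (q k) (of_nat n)"
    and r: "\<And>k n. X n (n + k) = of_real (herm_norm (n + k)) * poly (r k) (of_nat n)"
    by metis
  show "(\<exists>q. \<forall>n. X (Suc (n + k)) n + of_nat (n + k) / 2 * X (n + k - 1) n = of_real (herm_norm (n + k)) * poly q (of_nat n)) \<and>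
      (\<exists>q. \<forall>n. X (Suc n) (n + k) + of_nat n / 2 * X (n - 1) (n + k) = of_real (herm_norm (n + k)) * poly q (of_nat n))"
  proof (cases k)
    case 0
    have "X (Suc n) n + of_nat n / 2 * X (n - 1) n = of_real (herm_norm n) *
        poly ([:1/2, 1/2:] * q 1 + [:0, 1/2:] * pcompose (r 1) [:-1, 1:]) (of_nat n)" for n
    proof -
      have 1: "X (Suc n) n = of_real (herm_norm n) * ((of_nat n + 1) / 2 * poly (q 1) (of_nat n))"
        using q[of n 1] by (simp add: herm_norm_Suc add.commute)
      have 2: "of_nat n / 2 * X (n - 1) n = of_real (herm_norm n) * (of_nat n / 2 * poly (r 1) (of_nat n - 1))"
        using r[of "n - 1" 1] by (cases n) auto
      show ?thesis unfolding 1 2 by (simp add: poly_pcompose) (simp add: field_simps)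
    qed
    then show ?thesis unfolding 0 add_0_right by blast
  next
    case (Suc j)
    have "X (Suc (n + k)) n + of_nat (n + k) / 2 * X (n + k - 1) n = of_real (herm_norm (n + k)) *
        poly ([:(of_nat k + 1)/2, 1/2:] * q (Suc k) + q j) (of_nat n)" for n
      using q[of n "Suc k"] q[of n j] by (simp add: Suc herm_norm_Suc field_simps)
    moreover have "X (Suc n) (n + k) + of_nat n / 2 * X (n - 1) (n + k) = of_real (herm_norm (n + k)) *
        poly (pcompose (r j) [:1, 1:] + [:0, 1/2:] * pcompose (r (Suc k)) [:-1, 1:]) (of_nat n)" for n
      using r[of "Suc n" j] r[of "n - 1" "Suc k"]
      by (cases n) (simp_all add: Suc poly_pcompose field_simps)
    ultimately show ?thesis by blast
  qed
qed

lemma diag_poly_pderiv: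
  assumes "diag_poly X"
  shows "diag_poly (\<lambda>m n. of_nat n * X m (n - 1))"
  unfolding diag_poly_def
proof (intro allI)
  fix k
  have "\<forall>k. \<exists>q. \<forall>n. X (n + k) n = of_real (herm_norm (n + k)) * poly q (of_nat n)"
    "\<forall>k. \<exists>r. \<forall>n. X n (n + k) = of_real (herm_norm (n + k)) * poly r (of_nat n)"
    using assms by (auto simp: diag_poly_def)
  then obtain q r where q: "\<And>k n. X (n + k) n = of_real (herm_norm (n + k)) * poly (q k) (of_nat n)"
    and r: "\<And>k n. X n (n + k) = of_real (herm_norm (n + k)) * poly (r k) (of_nat n)"
    by metis
  have 1: "of_nat n * X (n + k) (n - 1) = of_real (herm_norm (n + k)) *
      poly ([:0, 1:] * pcompose (q (Suc k)) [:-1, 1:]) (of_nat n)" for n k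
    using q[of "n - 1" "Suc k"] by (cases n) (simp_all add: poly_pcompose)
  have "\<exists>q. \<forall>n. of_nat (n + k) * X n (n + k - 1) = of_real (herm_norm (n + k)) * poly q (of_nat n)"
  proof (cases k)
    case 0
    then show ?thesis using 1[of _ 0] unfolding 0 add_0_right by blast
  next
    case (Suc j)
    have "of_nat (n + k) * X n (n + k - 1) = of_real (herm_norm (n + k)) * poly (smult 2 (r j)) (of_nat n)" for n
      using r[of n j] by (simp add: Suc herm_norm_Suc)
    then show ?thesis by blast
  qed
  then show "(\<exists>q. \<forall>n. of_nat n * X (n + k) (n - 1) = of_real (herm_norm (n + k)) * poly q (of_nat n)) \<and>
      (\<exists>q. \<forall>n. of_nat (n + k) * X n (n + k - 1) = of_real (herm_norm (n + k)) * poly q (of_nat n))"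
    using 1[of _ k] by blast
qed

lemma diag_poly_higher_pderiv: "diag_poly (arr (pderiv ^^ l))"
proof (induction l)
  case 0
  then show ?case using diag_poly_id by (simp add: id_def)
next
  case (Suc l)
  have eq: "arr (pderiv ^^ Suc l) = (\<lambda>m n. of_nat n * arr (pderiv ^^ l) m (n - 1))"
    by (simp add: fun_eq_iff arr_def funpow_Suc_right pderiv_herm higher_pderiv_smult gint_smult del: funpow.simps)
  show ?case unfolding eq by (rule diag_poly_pderiv[OF Suc])
qed

lemma diag_poly_higher_pderiv_mult: "diag_poly (arr (\<lambda>f. (pderiv ^^ l) f * g))"
proof (induction g)
  case 0
  then show ?case using diag_poly_0 by (simp add: arr_def)
next
  case (pCons c g)
  have "arr (\<lambda>f. (pderiv ^^ l) f * pCons c g) m n = c * arr (pderiv ^^ l) m n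
      + (arr (\<lambda>f. (pderiv ^^ l) f * g) (Suc m) n + of_nat m / 2 * arr (\<lambda>f. (pderiv ^^ l) f * g) (m - 1) n)" for m n
  proof -
    let ?y = "(pderiv ^^ l) (herm n)"
    have "herm m * (?y * pCons c g) = smult c (herm m * ?y) + ([:0, 1:] * herm m) * (?y * g)"
      by (rule poly_ext) (simp add: algebra_simps)
    then show ?thesis
      unfolding x_herm by (simp add: arr_def gint_add gint_smult distrib_right)
  qed
  then show ?case
    using diag_poly_add[OF diag_poly_cmult[OF diag_poly_higher_pderiv] diag_poly_x[OF pCons.IH]] by presburger
qed

lemma diag_poly_sact: "diag_poly (arr (sact D r s))"
proof -
  have "diag_poly (\<lambda>m n. \<Sum>l\<in>S. arr (\<lambda>f. (pderiv ^^ l) f * coeff D l $ r $ s) m n)" if "finite S" for S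
    using that by (induction S) (auto intro: diag_poly_0 diag_poly_add diag_poly_higher_pderiv_mult)
  moreover have "arr (sact D r s) = (\<lambda>m n. \<Sum>l\<le>degree D. arr (\<lambda>f. (pderiv ^^ l) f * coeff D l $ r $ s) m n)"
    by (simp add: fun_eq_iff arr_def sact_def gint_sum sum_distrib_left)
  ultimately show ?thesis by simp
qed

subsection \<open>Growth of the eigenvalue matrices\<close>

text \<open>The eigenvalue relation is evaluated at the point 0. For even \<open>n\<close> the \<open>l\<close>-th derivative of
  \<open>herm n\<close> there is only \<open>O(n powr (l/2))\<close> times the value, so that an operator of order at most five
  contributes a factor of growth \<open>n\<^sup>2\<close>, although its eigenvalues have degree up to five in \<open>n\<close> a priori.\<close>

lemma higher_pderiv_herm_at_0:
  "poly ((pderiv ^^ (l + 2)) (herm n)) 0 = 2 * (of_nat l - of_nat n) * poly ((pderiv ^^ l) (herm n)) 0"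
proof -
  have "(pderiv ^^ (l + 2)) (herm n) = smult 2 ([:0, 1:] * (pderiv ^^ Suc l) (herm n)
      + smult (of_nat l - of_nat n) ((pderiv ^^ l) (herm n)))"
  proof (induction l)
    case 0
    have "pderiv (pderiv (herm n)) = smult 2 ([:0, 1:] * pderiv (herm n) - smult (of_nat n) (herm n))"
      unfolding herm_eigen[of n, symmetric] by (simp add: smult_diff_right)
    then show ?case by (simp add: numeral_2_eq_2)
  next
    case (Suc l)
    have "(pderiv ^^ (Suc l + 2)) (herm n) = pderiv ((pderiv ^^ (l + 2)) (herm n))" by simp
    then show ?case
      unfolding Suc by (intro poly_ext) (simp add: pderiv_smult pderiv_add pderiv_mult pderiv_pCons algebra_simps)
  qed
  then show ?thesis by simp
qed

lemma herm_odd_at_0: "poly (herm (2 * m + 1)) 0 = 0"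
proof (induction m)
  case (Suc m)
  then show ?case using poly_herm_rules(5)[of "2 * m + 1" 0] by simp
qed (simp add: herm.simps)

lemma herm_even_at_0: "poly (herm (2 * m)) 0 \<noteq> 0"
proof (induction m)
  case (Suc m)
  have "(of_nat (2 * m) + 1 :: complex) \<noteq> 0"
    by (metis of_nat_Suc add.commute of_nat_neq_0)
  then show ?case using Suc poly_herm_rules(5)[of "2 * m" 0] by simp
qed simp

text \<open>Each two steps contribute a factor linear in \<open>m\<close>, and the odd members
  vanish with the first of them. The constant \<open>c\<close> accommodates a shift of the Hermite
  index.\<close>

lemma grow_two_step:
  assumes "grow k (r 0)" "\<And>m. r (Suc 0) m = 0"
    and "\<And>l m. r (l + 2) m = 2 * (of_nat l - (of_nat (2 * m + 4) + c)) * r l m"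
  shows "grow (k + l div 2) (r l)"
proof (induction l rule: nat_induct2)
  case 0
  then show ?case using assms(1) by simp
next
  case 1
  have "r (Suc 0) = (\<lambda>m. 0)" using assms(2) by (simp add: fun_eq_iff)
  then show ?case by simp
next
  case (step l)
  have "grow (1 + (k + l div 2)) (\<lambda>m. 2 * (of_nat l - (of_nat (2 * m + 4) + c)) * r l m)"
    using step by (intro grow_mult grow_cmult grow_diff grow_linear grow_const)
  then show ?case using assms(3) by (simp add: fun_eq_iff)
qed

lemma poly_sact_at_0: "poly (sact F r s f) 0 = (\<Sum>l\<le>degree F. poly ((pderiv ^^ l) f) 0 * poly (coeff F l $ r $ s) 0)"
  by (simp add: sact_def poly_sum)

section \<open>Operators of order at most five: eigenvalue matrices and their growth\<close>

locale low_order = ab_weight +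
  fixes D :: "2 dop"
  assumes D: "D \<in> bochner_algebra UNIV (W_ab a b)" and order: "degree D \<le> 5"
begin

abbreviation "mA \<equiv> arr (sact (hat D) 1 1)"
abbreviation "mB \<equiv> arr (sact (hat D) 1 2)"
abbreviation "mC \<equiv> arr (sact (hat D) 2 1)"
abbreviation "mE \<equiv> arr (sact (hat D) 2 2)"

sublocale arrays: filtered_arrays ac bc mA mB mC mE
  by (rule filtered_arrays_hat[OF D])

definition K :: "nat \<Rightarrow> 2 cmat" where
  "K n = (SOME K. gm n \<cdot>\<^sub>D hat D = pconst K ** gm n)"

lemma K_act: "gm n \<cdot>\<^sub>D hat D = pconst (K n) ** gm n"
  unfolding K_def by (rule someI_ex[OF gm_act[OF D]])

lemma K_entry: "sact (hat D) 1 s (gm n $ r $ 1) + sact (hat D) 2 s (gm n $ r $ 2)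
    = smult (K n $ r $ 1) (gm n $ 1 $ s) + smult (K n $ r $ 2) (gm n $ 2 $ s)"
  using arg_cong[OF K_act[of n], of "\<lambda>P. P $ r $ s"]
  by (simp add: dop_act_sact sum_2 pconst_mult_entry)

lemma gint_herm_pderiv_herm:
  "gint (herm n * pderiv (herm n)) = 0" "gint (herm n * pderiv (pderiv (herm n))) = 0"
proof -
  have "pderiv (herm n) = 0 \<or> degree (pderiv (herm n)) < n"
    "pderiv (pderiv (herm n)) = 0 \<or> degree (pderiv (pderiv (herm n))) < n"
    by (cases n; force simp: degree_pderiv)+
  then show "gint (herm n * pderiv (herm n)) = 0" "gint (herm n * pderiv (pderiv (herm n))) = 0"
    by (auto intro: gint_herm_eq_0)
qed

lemma pderiv2_herm: "pderiv (pderiv (herm n)) = smult (of_nat n * (of_nat n - 1)) (herm (n - 2))"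
  unfolding pderiv_herm[of n] pderiv_smult pderiv_herm[of "n - 1"]
  by (cases n) (simp_all add: numeral_2_eq_2)

lemma gint_gm:
  "gint (herm n * gm n $ 1 $ 1) = qq ac (of_nat n) * of_real (herm_norm n)"
  "gint (herm n * gm n $ 1 $ 2) = 0" "gint (herm n * gm n $ 2 $ 1) = 0"
  "gint (herm n * gm n $ 2 $ 2) = qq ac (of_nat n) * of_real (herm_norm n)"
  unfolding gm_entries
  by (simp_all add: right_diff_distrib distrib_left gint_diff gint_add gint_minus gint_smult gint_herm_herm gint_herm_pderiv_herm)

text \<open>The Hermite components of index \<open>n\<close> of \<open>gm n\<close> form a multiple
  of the identity, so pairing the eigenvalue relation with \<open>herm n\<close> isolates single
  entries of \<open>K n\<close>.\<close>

lemma K_arrays: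
  fixes n :: nat
  defines "q \<equiv> qq ac (of_nat n)" and "h \<equiv> of_real (herm_norm n) :: complex"
  shows K11: "q * h * K n $ 1 $ 1 = q * (mA n n - ac * mC n (Suc (Suc n)) - bc * mC n (Suc n))
      - ac * bc\<^sup>2 * of_nat n * (of_nat n + 1) / 4 * mC n n"
    and K12: "q * h * K n $ 1 $ 2 = mB n n * (q * qq ac (of_nat n + 1) + bc\<^sup>2 * (of_nat n + 1) / 2)"
    and K21: "q * h * K n $ 2 $ 1 = mC n n * (q * qq ac (of_nat n - 1) + bc\<^sup>2 * of_nat n / 2)"
    and K22: "q * h * K n $ 2 $ 2 = q * (mE n n + ac * of_nat n * (of_nat n - 1) / 4 * mB n (n - 2) + bc * of_nat n / 2 * mB n (n - 1))
      + ac * bc\<^sup>2 * of_nat n * (of_nat n + 1) / 4 * mB n n"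
proof -
  have e: "gint (herm n * (sact (hat D) 1 s (gm n $ r $ 1) + sact (hat D) 2 s (gm n $ r $ 2)))
      = K n $ r $ 1 * gint (herm n * gm n $ 1 $ s) + K n $ r $ 2 * gint (herm n * gm n $ 2 $ s)" for r s
    unfolding K_entry by (simp add: distrib_left gint_add gint_smult)
  note lin = pderiv_herm[of n] sact_add sact_diff sact_minus sact_smult distrib_left right_diff_distrib mult_smult_right
    gint_add gint_diff gint_minus gint_smult arr_def[symmetric]
  show "q * h * K n $ 1 $ 1 = q * (mA n n - ac * mC n (Suc (Suc n)) - bc * mC n (Suc n))
      - ac * bc\<^sup>2 * of_nat n * (of_nat n + 1) / 4 * mC n n"
    using e[of 1 1] unfolding gint_gm arrays.diagonal_11[symmetric] q_def h_def
    unfolding gm_entries pderiv2_herm unfolding lin by (simp add: algebra_simps)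
  show "q * h * K n $ 1 $ 2 = mB n n * (q * qq ac (of_nat n + 1) + bc\<^sup>2 * (of_nat n + 1) / 2)"
    using e[of 2 1] unfolding gint_gm arrays.diagonal_12[symmetric] q_def h_def
    unfolding gm_entries pderiv2_herm unfolding lin by (simp add: algebra_simps)
  show "q * h * K n $ 2 $ 1 = mC n n * (q * qq ac (of_nat n - 1) + bc\<^sup>2 * of_nat n / 2)"
    using e[of 1 2] unfolding gint_gm arrays.diagonal_21[symmetric] q_def h_def
    unfolding gm_entries pderiv2_herm unfolding lin by (simp add: algebra_simps)
  show "q * h * K n $ 2 $ 2 = q * (mE n n + ac * of_nat n * (of_nat n - 1) / 4 * mB n (n - 2) + bc * of_nat n / 2 * mB n (n - 1))
      + ac * bc\<^sup>2 * of_nat n * (of_nat n + 1) / 4 * mB n n"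
    using e[of 2 2] unfolding gint_gm arrays.diagonal_22[symmetric] q_def h_def
    unfolding gm_entries pderiv2_herm unfolding lin by (simp add: algebra_simps)
qed

text \<open>Division by this nonzero value removes the factorial growth of Hermite polynomials at
  0.\<close>

definition y :: "nat \<Rightarrow> complex" where "y m = poly (herm (2 * m + 4)) 0"

lemma y_nz: "y m \<noteq> 0"
proof -
  have "2 * m + 4 = 2 * (m + 2)" by simp
  then show ?thesis unfolding y_def using herm_even_at_0 by metis
qed

lemma herm_odd: "poly (herm (2 * m + 5)) 0 = 0" "poly (herm (2 * m + 3)) 0 = 0"
proof -
  have "2 * m + 5 = 2 * (m + 2) + 1" "2 * m + 3 = 2 * (m + 1) + 1" by simp_all
  then show "poly (herm (2 * m + 5)) 0 = 0" "poly (herm (2 * m + 3)) 0 = 0"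
    using herm_odd_at_0 by metis+
qed

lemma pderiv_herm_even: "poly (pderiv (herm (2 * m + 4))) 0 = 0"
  using herm_odd(2)[of m] by (simp add: pderiv_herm numeral_eq_Suc)

lemma herm_even_Suc_Suc: "poly (herm (Suc (Suc (2 * m + 4)))) 0 = - (of_nat (2 * m + 4) + 1) / 2 * y m"
  using poly_herm_rules(5)[of "2 * m + 4" 0] by (simp only: y_def mult_zero_left) (simp add: pderiv_herm_even field_simps)

lemma grow_herm: "grow (l div 2) (\<lambda>m. poly ((pderiv ^^ l) (herm (2 * m + 4))) 0 / y m)"
  using grow_two_step[of 0 "\<lambda>l m. poly ((pderiv ^^ l) (herm (2 * m + 4))) 0 / y m" 0 l]
  by (simp only: higher_pderiv_herm_at_0) (simp add: pderiv_herm_even y_nz flip: y_def)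

text \<open>The additional power comes from the ratio \<open>-(n + 1)/2\<close> of the values of
  \<open>herm (n + 2)\<close> and \<open>herm n\<close> at 0.\<close>

lemma grow_herm_Suc_Suc: "grow (1 + l div 2) (\<lambda>m. poly ((pderiv ^^ l) (herm (Suc (Suc (2 * m + 4))))) 0 / y m)"
proof (rule grow_two_step[of 1 "\<lambda>l m. poly ((pderiv ^^ l) (herm (Suc (Suc (2 * m + 4))))) 0 / y m" 2 l])
  have "grow 1 (\<lambda>m. (of_nat (2 * m + 4) + 1) * (- 1 / 2))"
    by (intro grow_cmult_right grow_linear)
  also have "(\<lambda>m. (of_nat (2 * m + 4) + 1) * (- 1 / 2)) = (\<lambda>m. poly ((pderiv ^^ 0) (herm (Suc (Suc (2 * m + 4))))) 0 / y m)"
    unfolding funpow_0 herm_even_Suc_Suc using y_nz by (simp add: fun_eq_iff field_simps)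
  finally show "grow 1 (\<lambda>m. poly ((pderiv ^^ 0) (herm (Suc (Suc (2 * m + 4))))) 0 / y m)" .
  show "poly ((pderiv ^^ Suc 0) (herm (Suc (Suc (2 * m + 4))))) 0 / y m = 0" for m
    using herm_odd(1)[of m] by (simp add: pderiv_herm numeral_eq_Suc)
  show "poly ((pderiv ^^ (l + 2)) (herm (Suc (Suc (2 * m + 4))))) 0 / y m =
      2 * (of_nat l - (of_nat (2 * m + 4) + 2)) * (poly ((pderiv ^^ l) (herm (Suc (Suc (2 * m + 4))))) 0 / y m)" for l m
    unfolding higher_pderiv_herm_at_0 by simp
qed

text \<open>One derivative is spent on \<open>herm (n + 1)' = (n + 1) herm n\<close>; for
  \<open>l = 0\<close> the value at 0 vanishes.\<close>

lemma grow_herm_Suc: "grow (1 + (l - 1) div 2) (\<lambda>m. poly ((pderiv ^^ l) (herm (Suc (2 * m + 4)))) 0 / y m)"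
proof (cases l)
  case 0
  then show ?thesis using herm_odd(1) by (simp add: numeral_eq_Suc)
next
  case (Suc j)
  have "grow (1 + j div 2) (\<lambda>m. (of_nat (2 * m + 4) + 1) * (poly ((pderiv ^^ j) (herm (2 * m + 4))) 0 / y m))"
    by (intro grow_mult grow_linear grow_herm)
  also have "(\<lambda>m. (of_nat (2 * m + 4) + 1) * (poly ((pderiv ^^ j) (herm (2 * m + 4))) 0 / y m)) =
      (\<lambda>m. poly ((pderiv ^^ l) (herm (Suc (2 * m + 4)))) 0 / y m)"
    unfolding Suc funpow_Suc_right o_def pderiv_herm_Suc higher_pderiv_smult by (simp add: fun_eq_iff)
  finally show ?thesis using Suc by simp
qed

lemma grow_sact:
  assumes "\<And>l. l \<le> 5 \<Longrightarrow> grow k (\<lambda>m. poly ((pderiv ^^ l) (f m)) 0 / y m)"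
  shows "grow k (\<lambda>m. poly (sact (hat D) r s (f m)) 0 / y m)"
proof -
  have "grow k (\<lambda>m. \<Sum>l\<le>degree (hat D). (poly ((pderiv ^^ l) (f m)) 0 / y m) * poly (coeff (hat D) l $ r $ s) 0)"
    using order by (intro grow_sum grow_cmult_right assms) (simp add: degree_hat)
  then show ?thesis by (simp add: poly_sact_at_0 sum_divide_distrib)
qed

text \<open>Here the order enters: \<open>l <= 5\<close> gives \<open>5 div 2 = 2\<close> for
  \<open>herm n\<close> itself, and 3 for the shifted or differentiated polynomials occurring in
  \<open>gm\<close>.\<close>

lemma grow_sact_herm:
  "grow 2 (\<lambda>m. poly (sact (hat D) r s (herm (2 * m + 4))) 0 / y m)"
  "grow 3 (\<lambda>m. poly (sact (hat D) r s (pderiv (herm (2 * m + 4)))) 0 / y m)"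
  "grow 3 (\<lambda>m. poly (sact (hat D) r s (pderiv (pderiv (herm (2 * m + 4))))) 0 / y m)"
  "grow 3 (\<lambda>m. poly (sact (hat D) r s (herm (Suc (2 * m + 4)))) 0 / y m)"
  "grow 3 (\<lambda>m. poly (sact (hat D) r s (herm (Suc (Suc (2 * m + 4))))) 0 / y m)"
proof -
  show "grow 2 (\<lambda>m. poly (sact (hat D) r s (herm (2 * m + 4))) 0 / y m)"
    by (rule grow_sact, rule grow_mono[OF grow_herm]) simp
  show "grow 3 (\<lambda>m. poly (sact (hat D) r s (pderiv (herm (2 * m + 4)))) 0 / y m)"
  proof (rule grow_sact)
    fix l :: nat assume "l \<le> 5"
    then have "grow 3 (\<lambda>m. poly ((pderiv ^^ Suc l) (herm (2 * m + 4))) 0 / y m)"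
      by (intro grow_mono[OF grow_herm]) simp
    then show "grow 3 (\<lambda>m. poly ((pderiv ^^ l) (pderiv (herm (2 * m + 4)))) 0 / y m)"
      by (simp only: funpow_Suc_right o_def)
  qed
  show "grow 3 (\<lambda>m. poly (sact (hat D) r s (pderiv (pderiv (herm (2 * m + 4))))) 0 / y m)"
  proof (rule grow_sact)
    fix l :: nat assume "l \<le> 5"
    then have "grow 3 (\<lambda>m. poly ((pderiv ^^ Suc (Suc l)) (herm (2 * m + 4))) 0 / y m)"
      by (intro grow_mono[OF grow_herm]) simp
    then show "grow 3 (\<lambda>m. poly ((pderiv ^^ l) (pderiv (pderiv (herm (2 * m + 4))))) 0 / y m)"
      by (simp only: funpow_Suc_right o_def)
  qed
  show "grow 3 (\<lambda>m. poly (sact (hat D) r s (herm (Suc (2 * m + 4)))) 0 / y m)"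
    by (rule grow_sact, rule grow_mono[OF grow_herm_Suc]) simp
  show "grow 3 (\<lambda>m. poly (sact (hat D) r s (herm (Suc (Suc (2 * m + 4))))) 0 / y m)"
    by (rule grow_sact, rule grow_mono[OF grow_herm_Suc_Suc]) simp
qed

definition qe :: "nat \<Rightarrow> complex" where "qe m = qq ac (of_nat (2 * m + 4))"

lemma grow_qe: "grow 2 qe"
proof -
  have "grow 2 (\<lambda>m. poly [:1, ac\<^sup>2 / 4, ac\<^sup>2 / 4:] (of_nat (2 * m + 4) + 0))"
    by (rule grow_poly) simp
  also have "(\<lambda>m. poly [:1, ac\<^sup>2 / 4, ac\<^sup>2 / 4:] (of_nat (2 * m + 4) + 0)) = qe"
    unfolding qe_def qq_def fun_eq_iff by (simp add: field_simps)
  finally show ?thesis .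
qed

text \<open>The eigenvalue relation at the point 0, seen from the side of the operator.\<close>

definition Z :: "2 \<Rightarrow> 2 \<Rightarrow> nat \<Rightarrow> complex" where
  "Z r s m = poly (sact (hat D) 1 s (gm (2 * m + 4) $ r $ 1) + sact (hat D) 2 s (gm (2 * m + 4) $ r $ 2)) 0 / y m"

lemma grow_Z: "grow 5 (Z r s)"
proof -
  let ?S = "\<lambda>r f m. poly (sact (hat D) r s (f m)) 0 / y m"
  let ?H = "\<lambda>m. herm (2 * m + 4)"
  have lin: "grow 1 (\<lambda>m. of_nat (2 * m + 4) + 1)" "grow 1 (\<lambda>m. of_nat (2 * m + 4))"
    using grow_linear[of 1] grow_linear[of 0] by simp_all
  have m: "grow 5 (\<lambda>m. f m * g m)" if "grow k f" "grow l g" "k + l \<le> 5" for k l f g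
    using grow_mono[OF grow_mult[OF that(1,2)] that(3)] .
  have c: "grow 5 f" if "grow 3 f" for f using that by (rule grow_mono) simp
  have 1: "Z 1 s = (\<lambda>m. qe m * ?S 1 ?H m - ac * bc / 4 * ((of_nat (2 * m + 4) + 1) * ?S 1 (\<lambda>m. pderiv (?H m)) m)
      - ac * (qe m * ?S 2 (\<lambda>m. herm (Suc (Suc (2 * m + 4)))) m) - bc * ?S 2 (\<lambda>m. herm (Suc (2 * m + 4))) m)"
    unfolding Z_def gm_entries qe_def
    by (simp add: fun_eq_iff sact_add sact_diff sact_minus sact_smult add_divide_distrib diff_divide_distrib mult.assoc)
  have 2: "Z 2 s = (\<lambda>m. bc / 2 * ?S 1 (\<lambda>m. pderiv (?H m)) m + ac / 4 * (qe m * ?S 1 (\<lambda>m. pderiv (pderiv (?H m))) m)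
      - ac * bc / 2 * (of_nat (2 * m + 4) * ?S 2 (\<lambda>m. herm (Suc (2 * m + 4))) m) + qe m * ?S 2 ?H m)"
    unfolding Z_def gm_entries qe_def
    by (simp add: fun_eq_iff sact_add sact_diff sact_minus sact_smult add_divide_distrib diff_divide_distrib mult.assoc)
  have "grow 5 (Z 1 s)"
    unfolding 1
    by (intro grow_add grow_diff grow_cmult m[OF grow_qe grow_sact_herm(1)] m[OF lin(1) grow_sact_herm(2)]
        m[OF grow_qe grow_sact_herm(5)] c[OF grow_sact_herm(4)]) simp_all
  moreover have "grow 5 (Z 2 s)"
    unfolding 2
    by (intro grow_add grow_diff grow_cmult m[OF grow_qe grow_sact_herm(1)] c[OF grow_sact_herm(2)]
        m[OF grow_qe grow_sact_herm(3)] m[OF lin(2) grow_sact_herm(4)]) simp_all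
  ultimately show ?thesis using exhaust_2[of r] by auto
qed

lemma qe_bound: "\<exists>c>0. \<forall>m. cmod (qe m) \<ge> c * (real m + 1)\<^sup>2"
proof -
  have "cmod (qe m) \<ge> a\<^sup>2 / 4 * (real m + 1)\<^sup>2" for m
  proof -
    have "qe m = of_real (1 + a\<^sup>2 * real (2 * m + 4) * (real (2 * m + 4) + 1) / 4)"
      unfolding qe_def by (rule qq_real)
    then have "cmod (qe m) = 1 + a\<^sup>2 * real (2 * m + 4) * (real (2 * m + 4) + 1) / 4"
      by (simp only: norm_of_real) (intro abs_of_nonneg add_nonneg_nonneg, auto)
    moreover have "a\<^sup>2 / 4 * ((real m + 1) * (real m + 1)) \<le> a\<^sup>2 / 4 * (real (2 * m + 4) * (real (2 * m + 4) + 1))"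
      by (intro mult_left_mono mult_mono) auto
    ultimately show ?thesis by (simp add: power2_eq_square)
  qed
  then show ?thesis using a_nz by (intro exI[of _ "a\<^sup>2 / 4"]) simp
qed

lemma grow_qe_cancel: "grow (k + 2) (\<lambda>m. qe m * f m) \<Longrightarrow> grow k f"
  using grow_cancel[of k 2 qe f] qe_bound by blast

text \<open>At 0 the matrix \<open>gm n\<close> is \<open>qe * y\<close> times a matrix with rows
  \<open>(1, a (n + 1)/2)\<close> and \<open>(- a n/2, 1)\<close>, whose determinant is again
  \<open>qe\<close>. Cramer's rule adds one power to the growth 5 of \<open>Z\<close>, and dividing
  by \<open>qe\<close> twice removes four.\<close>

lemma grow_K: "grow 2 (\<lambda>m. K (2 * m + 4) $ r $ s)"
proof -
  let ?n = "\<lambda>m. of_nat (2 * m + 4) :: complex" and ?K = "\<lambda>m. K (2 * m + 4)"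
  have g: "poly (gm (2 * m + 4) $ 1 $ 1) 0 = qe m * y m"
    "poly (gm (2 * m + 4) $ 1 $ 2) 0 = ac * qe m * (?n m + 1) / 2 * y m"
    "poly (gm (2 * m + 4) $ 2 $ 1) 0 = - ac * qe m * ?n m / 2 * y m"
    "poly (gm (2 * m + 4) $ 2 $ 2) 0 = qe m * y m" for m
  proof -
    have s: "poly (herm (Suc (2 * m + 4))) 0 = 0" using herm_odd(1)[of m] by (simp add: numeral_eq_Suc)
    have d: "poly (pderiv (pderiv (herm (2 * m + 4)))) 0 = - 2 * ?n m * y m"
      using higher_pderiv_herm_at_0[of 0 "2 * m + 4"]
      by (simp only: add_0 funpow_0 pderiv_numeral_pow y_def of_nat_0 diff_0) simp
    show "poly (gm (2 * m + 4) $ 1 $ 1) 0 = qe m * y m"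
      "poly (gm (2 * m + 4) $ 1 $ 2) 0 = ac * qe m * (?n m + 1) / 2 * y m"
      "poly (gm (2 * m + 4) $ 2 $ 1) 0 = - ac * qe m * ?n m / 2 * y m"
      "poly (gm (2 * m + 4) $ 2 $ 2) 0 = qe m * y m"
      unfolding gm_entries poly_diff poly_add poly_smult s d herm_even_Suc_Suc pderiv_herm_even
        y_def[symmetric] qe_def[symmetric]
      by (simp_all add: field_simps)
  qed
  have Z: "Z r 1 m = qe m * (?K m $ r $ 1 - ac * ?n m / 2 * ?K m $ r $ 2)"
    "Z r 2 m = qe m * (?K m $ r $ 2 + ac * (?n m + 1) / 2 * ?K m $ r $ 1)" for m
    unfolding Z_def K_entry poly_add poly_smult g using y_nz[of m] by (simp_all add: field_simps)
  have qe: "qe m = 1 + ac\<^sup>2 * ?n m * (?n m + 1) / 4" for m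
    by (simp add: qe_def qq_def)
  have alg: "q * (k - c * n / 2 * l) + c / 2 * (n * (q * (l + c * (n + 1) / 2 * k))) = q * ((1 + c\<^sup>2 * n * (n + 1) / 4) * k)"
    "q * (l + c * (n + 1) / 2 * k) - c / 2 * ((n + 1) * (q * (k - c * n / 2 * l))) = q * ((1 + c\<^sup>2 * n * (n + 1) / 4) * l)"
    for q k l n c :: complex
    by (simp_all add: field_simps power2_eq_square)
  have k1: "qe m * (qe m * ?K m $ r $ 1) = Z r 1 m + ac / 2 * (?n m * Z r 2 m)" for m
  proof -
    have "Z r 1 m + ac / 2 * (?n m * Z r 2 m) = qe m * ((1 + ac\<^sup>2 * ?n m * (?n m + 1) / 4) * ?K m $ r $ 1)"
      unfolding Z by (rule alg)
    then show ?thesis by (simp only: qe)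
  qed
  have k2: "qe m * (qe m * ?K m $ r $ 2) = Z r 2 m - ac / 2 * ((?n m + 1) * Z r 1 m)" for m
  proof -
    have "Z r 2 m - ac / 2 * ((?n m + 1) * Z r 1 m) = qe m * ((1 + ac\<^sup>2 * ?n m * (?n m + 1) / 4) * ?K m $ r $ 2)"
      unfolding Z by (rule alg)
    then show ?thesis by (simp only: qe)
  qed
  have nZ: "grow 6 (\<lambda>m. (?n m + c) * Z r s m)" for c s
    using grow_mult[OF grow_linear grow_Z] by simp
  have "grow (2 + 2 + 2) (\<lambda>m. qe m * (qe m * ?K m $ r $ 1))"
    unfolding k1 using nZ[of 0] by (intro grow_add grow_cmult grow_mono[OF grow_Z]) simp_all
  then have 1: "grow 2 (\<lambda>m. ?K m $ r $ 1)" by (rule grow_qe_cancel[OF grow_qe_cancel])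
  have "grow (2 + 2 + 2) (\<lambda>m. qe m * (qe m * ?K m $ r $ 2))"
    unfolding k2 using nZ[of 1] by (intro grow_diff grow_cmult grow_mono[OF grow_Z]) simp_all
  then have 2: "grow 2 (\<lambda>m. ?K m $ r $ 2)" by (rule grow_qe_cancel[OF grow_qe_cancel])
  show ?thesis using 1 2 exhaust_2[of s] by auto
qed

end

section \<open>Comparison of degrees along the diagonals\<close>

lemma grow_cong: "grow k f \<Longrightarrow> (\<And>m. g m = f m) \<Longrightarrow> grow k g"
  by (simp add: grow_def)

lemma grow_poly_0: "degree p \<le> k \<Longrightarrow> grow k (\<lambda>m. poly p (of_nat (2 * m + 4)))"
  using grow_poly[of p k 0] by simp

lemma grow_Suc: assumes "grow k f" shows "grow k (\<lambda>m. f (Suc m))"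
proof -
  obtain C where C: "C \<ge> 0" "\<And>m. cmod (f m) \<le> C * (real m + 1) ^ k"
    using assms by (auto elim: growE)
  have "cmod (f (Suc m)) \<le> (C * 2 ^ k) * (real m + 1) ^ k" for m
  proof -
    have "C * (real (Suc m) + 1) ^ k \<le> C * (2 * (real m + 1)) ^ k"
      using C(1) by (intro mult_left_mono power_mono) auto
    also have "\<dots> = (C * 2 ^ k) * (real m + 1) ^ k" by (simp only: power_mult_distrib mult.assoc)
    finally show ?thesis using C(2)[of "Suc m"] by linarith
  qed
  then show ?thesis unfolding grow_def by blast
qed

lemma poly_degree_2: "degree p \<le> 2 \<Longrightarrow> p = [:coeff p 0, coeff p 1, coeff p 2:]"
  by (rule poly_eqI) (auto simp: coeff_pCons coeff_eq_0 numeral_2_eq_2 split: nat.split)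

context low_order begin

text \<open>All these multipliers are sums of nonnegative reals, so nothing cancels and one dominant
  product already gives the bound.\<close>

lemma weight_lower_bounds:
  fixes m :: nat
  defines "N \<equiv> complex_of_nat (2 * m + 4)"
  shows "a\<^sup>2 / 4 * (real m + 1) ^ 2 \<le> cmod (qq ac (N + 1))"
    and "a ^ 4 / 16 * (real m + 1) ^ 4 \<le> cmod (qq ac N * qq ac (N + 1))"
    and "a ^ 4 / 16 * (real m + 1) ^ 4 \<le> cmod (qq ac N * qq ac (N + 1) + bc\<^sup>2 * (N + 1) / 2)"
    and "a ^ 4 / 16 * (real m + 1) ^ 4 \<le> cmod (qq ac N * qq ac (N - 1) + bc\<^sup>2 * N / 2)"
    and "a\<^sup>2 / 4 * (real m + 1) ^ 3 \<le> cmod ((N + 2) / 2 * qq ac N + N / 2 * qq ac (N + 1))"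
proof -
  define x where "x = real m + 1"
  have x: "x \<ge> 1" by (simp add: x_def)
  have N: "N = of_real (2 * x + 2)" by (simp add: N_def x_def)
  define r where "r u = 1 + a\<^sup>2 * u * (u + 1) / 4" for u
  have q: "qq ac (of_real u) = of_real (r u)" for u by (simp add: qq_def r_def)
  have lb: "a\<^sup>2 / 4 * x\<^sup>2 \<le> r u" if "u \<ge> x" for u
  proof -
    have "x * x \<le> u * (u + 1)" using that x by (intro mult_mono) auto
    then have "a\<^sup>2 / 4 * (x * x) \<le> a\<^sup>2 / 4 * (u * (u + 1))" by (intro mult_left_mono) auto
    moreover have "r u = 1 + a\<^sup>2 / 4 * (u * (u + 1))" by (simp add: r_def)
    ultimately show ?thesis by (simp add: power2_eq_square)
  qed
  have pos: "r u \<ge> 0" if "u \<ge> x" for u using lb[OF that] by (rule order.trans[rotated]) simp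
  have bq: "b\<^sup>2 * u / 2 \<ge> 0" if "u \<ge> x" for u using that x by simp
  have lb2: "a ^ 4 / 16 * x ^ 4 \<le> r u * r v" if "u \<ge> x" "v \<ge> x" for u v
  proof -
    have "(a\<^sup>2 / 4 * x\<^sup>2) * (a\<^sup>2 / 4 * x\<^sup>2) \<le> r u * r v"
      using lb[OF that(1)] lb[OF that(2)] pos[OF that(1)] by (intro mult_mono) auto
    then show ?thesis by (simp add: power2_eq_square power4_eq_xxxx mult_ac)
  qed
  have c: "cmod (of_real t) \<ge> s" if "t \<ge> s" for s t :: real
    using that by simp
  have ge: "2 * x + 2 \<ge> x" "2 * x + 3 \<ge> x" using x by simp_all
  have N1: "N + 1 = of_real (2 * x + 3)" "N - 1 = of_real (2 * x + 1)" "N + 2 = of_real (2 * x + 4)"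
    by (simp_all add: N)
  show "a\<^sup>2 / 4 * (real m + 1) ^ 2 \<le> cmod (qq ac (N + 1))"
    unfolding N1 q x_def[symmetric] using x by (intro c lb) simp
  have "cmod (qq ac N * qq ac (N + 1)) = cmod (of_real (r (2 * x + 2) * r (2 * x + 3)))"
    unfolding N1 unfolding N q by simp
  also have "\<dots> \<ge> a ^ 4 / 16 * x ^ 4" using x by (intro c lb2) simp_all
  finally show "a ^ 4 / 16 * (real m + 1) ^ 4 \<le> cmod (qq ac N * qq ac (N + 1))"
    unfolding x_def .
  have "cmod (qq ac N * qq ac (N + 1) + bc\<^sup>2 * (N + 1) / 2)
      = cmod (of_real (r (2 * x + 2) * r (2 * x + 3) + b\<^sup>2 * (2 * x + 3) / 2))"
    unfolding N1 unfolding N q by simp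
  also have "\<dots> \<ge> a ^ 4 / 16 * x ^ 4"
    using x lb2[of "2 * x + 2" "2 * x + 3"] bq[of "2 * x + 3", OF ge(2)] by (intro c) linarith
  finally show "a ^ 4 / 16 * (real m + 1) ^ 4 \<le> cmod (qq ac N * qq ac (N + 1) + bc\<^sup>2 * (N + 1) / 2)"
    unfolding x_def .
  have "cmod (qq ac N * qq ac (N - 1) + bc\<^sup>2 * N / 2)
      = cmod (of_real (r (2 * x + 2) * r (2 * x + 1) + b\<^sup>2 * (2 * x + 2) / 2))"
    unfolding N1 unfolding N q by simp
  also have "\<dots> \<ge> a ^ 4 / 16 * x ^ 4"
    using x lb2[of "2 * x + 2" "2 * x + 1"] bq[of "2 * x + 2", OF ge(1)] by (intro c) linarith
  finally show "a ^ 4 / 16 * (real m + 1) ^ 4 \<le> cmod (qq ac N * qq ac (N - 1) + bc\<^sup>2 * N / 2)"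
    unfolding x_def .
  have "(N + 2) / 2 * qq ac N + N / 2 * qq ac (N + 1)
      = of_real ((x + 2) * r (2 * x + 2) + (x + 1) * r (2 * x + 3))"
    unfolding N1 unfolding N q by (simp add: field_simps)
  then have "cmod ((N + 2) / 2 * qq ac N + N / 2 * qq ac (N + 1))
      = cmod (of_real ((x + 2) * r (2 * x + 2) + (x + 1) * r (2 * x + 3)))"
    by (simp only:)
  also have "\<dots> \<ge> a\<^sup>2 / 4 * x ^ 3"
  proof (rule c)
    have "x * (a\<^sup>2 / 4 * x\<^sup>2) \<le> (x + 2) * r (2 * x + 2)"
      using x by (intro mult_mono lb pos) auto
    moreover have "(x + 1) * r (2 * x + 3) \<ge> 0"
      using x by (intro mult_nonneg_nonneg pos) auto
    ultimately show "a\<^sup>2 / 4 * x ^ 3 \<le> (x + 2) * r (2 * x + 2) + (x + 1) * r (2 * x + 3)"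
      by (simp add: power2_eq_square power3_eq_cube mult_ac)
  qed
  finally show "a\<^sup>2 / 4 * (real m + 1) ^ 3 \<le> cmod ((N + 2) / 2 * qq ac N + N / 2 * qq ac (N + 1))"
    unfolding x_def .
qed

lemma a_pos: "a\<^sup>2 / 4 > 0" "a ^ 4 / 16 > 0"
  using a_nz by simp_all

lemma hn_Suc: "complex_of_real (herm_norm (Suc n)) = (of_nat n + 1) / 2 * of_real (herm_norm n)"
  by (simp add: herm_norm_Suc add.commute)

lemma hn_nz: "complex_of_real (herm_norm n) \<noteq> 0"
  by simp

lemma diagonals:
  obtains qA qE qb qt qp qc qg qk where
    "\<And>n. mA n n = of_real (herm_norm n) * poly qA (of_nat n)"
    "\<And>n. mE n n = of_real (herm_norm n) * poly qE (of_nat n)"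
    "\<And>n. mB n n = of_real (herm_norm n) * poly qb (of_nat n)"
    "\<And>n. mB (Suc n) n = of_real (herm_norm (Suc n)) * poly qt (of_nat n)"
    "\<And>n. mB (Suc (Suc n)) n = of_real (herm_norm (Suc (Suc n))) * poly qp (of_nat n)"
    "\<And>n. mC n n = of_real (herm_norm n) * poly qc (of_nat n)"
    "\<And>n. mC n (Suc n) = of_real (herm_norm (Suc n)) * poly qg (of_nat n)"
    "\<And>n. mC n (Suc (Suc n)) = of_real (herm_norm (Suc (Suc n))) * poly qk (of_nat n)"
proof -
  have lo: "\<exists>q. \<forall>n. arr (sact (hat D) r s) (n + k) n = of_real (herm_norm (n + k)) * poly q (of_nat n)"
    and up: "\<exists>q. \<forall>n. arr (sact (hat D) r s) n (n + k) = of_real (herm_norm (n + k)) * poly q (of_nat n)" for r s k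
    using diag_poly_sact[of "hat D" r s] unfolding diag_poly_def by blast+
  obtain qA where qA: "\<And>n. mA n n = of_real (herm_norm n) * poly qA (of_nat n)"
    using lo[of 1 1 0] unfolding add_0_right add_Suc_right by blast
  obtain qE where qE: "\<And>n. mE n n = of_real (herm_norm n) * poly qE (of_nat n)"
    using lo[of 2 2 0] unfolding add_0_right add_Suc_right by blast
  obtain qb where qb: "\<And>n. mB n n = of_real (herm_norm n) * poly qb (of_nat n)"
    using lo[of 1 2 0] unfolding add_0_right add_Suc_right by blast
  obtain qt where qt: "\<And>n. mB (Suc n) n = of_real (herm_norm (Suc n)) * poly qt (of_nat n)"
    using lo[of 1 2 "Suc 0"] unfolding add_0_right add_Suc_right by blast
  obtain qp where qp: "\<And>n. mB (Suc (Suc n)) n = of_real (herm_norm (Suc (Suc n))) * poly qp (of_nat n)"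
    using lo[of 1 2 "Suc (Suc 0)"] unfolding add_0_right add_Suc_right by blast
  obtain qc where qc: "\<And>n. mC n n = of_real (herm_norm n) * poly qc (of_nat n)"
    using up[of 2 1 0] unfolding add_0_right add_Suc_right by blast
  obtain qg where qg: "\<And>n. mC n (Suc n) = of_real (herm_norm (Suc n)) * poly qg (of_nat n)"
    using up[of 2 1 "Suc 0"] unfolding add_0_right add_Suc_right by blast
  obtain qk where qk: "\<And>n. mC n (Suc (Suc n)) = of_real (herm_norm (Suc (Suc n))) * poly qk (of_nat n)"
    using up[of 2 1 "Suc (Suc 0)"] unfolding add_0_right add_Suc_right by blast
  show thesis by (rule that[OF qA qE qb qt qp qc qg qk])
qed

text \<open>Each pair of dual relations (\<open>r1\<close>, \<open>r1'\<close> and \<open>r3\<close>, \<open>r3'\<close>) says that the difference of two dual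
  diagonals is annihilated, up to lower order, by a multiplier growing with \<open>n\<close>; since all diagonals are
  polynomials in \<open>n\<close>, the growth of \<open>K\<close> then forces them to vanish or to be constant, one after the other.\<close>

lemma K_scalar: "\<exists>x. \<forall>n. K n = mat x"
proof -
  obtain qA qE qb qt qp qc qg qk where d:
    "\<And>n. mA n n = of_real (herm_norm n) * poly qA (of_nat n)"
    "\<And>n. mE n n = of_real (herm_norm n) * poly qE (of_nat n)"
    "\<And>n. mB n n = of_real (herm_norm n) * poly qb (of_nat n)"
    "\<And>n. mB (Suc n) n = of_real (herm_norm (Suc n)) * poly qt (of_nat n)"
    "\<And>n. mB (Suc (Suc n)) n = of_real (herm_norm (Suc (Suc n))) * poly qp (of_nat n)"
    "\<And>n. mC n n = of_real (herm_norm n) * poly qc (of_nat n)"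
    "\<And>n. mC n (Suc n) = of_real (herm_norm (Suc n)) * poly qg (of_nat n)"
    "\<And>n. mC n (Suc (Suc n)) = of_real (herm_norm (Suc (Suc n))) * poly qk (of_nat n)"
    using diagonals by blast
  \<comment> \<open>The transposed arrays supply the primed relations, in which \<open>qb\<close>
    and \<open>qc\<close>, \<open>qt\<close> and \<open>qg\<close>, \<open>qp\<close> and
    \<open>qk\<close> change places.\<close>
  interpret dual: filtered_arrays ac bc "\<lambda>m n. mA n m" "\<lambda>m n. mC n m" "\<lambda>m n. mB n m" "\<lambda>m n. mE n m"
    by (rule arrays.transpose)
  let ?h = "\<lambda>n. complex_of_real (herm_norm n)"
  have S: "of_nat (Suc n) = of_nat n + (1::complex)" "of_nat (Suc (Suc n)) = of_nat n + (2::complex)" for n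
    by simp_all
  have h: "?h (Suc n) = (of_nat n + 1) / 2 * ?h n" "?h (Suc (Suc n)) = (of_nat n + 2) / 2 * ((of_nat n + 1) / 2 * ?h n)" for n
    by (simp_all only: hn_Suc) simp
  have nz: "of_nat n + 1 \<noteq> (0::complex)" "of_nat n + 2 \<noteq> (0::complex)" for n
    using of_nat_neq_0[of n, where 'a = complex] of_nat_neq_0[of "Suc n", where 'a = complex]
    by (simp_all add: add.commute)
  have two: "x + 1 + 1 = x + 2" for x :: complex by simp
  \<comment> \<open>Removal of the Hermite norms, with \<open>z = n + 1\<close>,
    \<open>w = n + 2\<close> and \<open>x\<close> the norm of index \<open>n\<close>.\<close>
  have r0: "f = \<alpha> * (e - l) - \<beta> * c + \<gamma> * z * w / 4 * k"
    if "w / 2 * (z / 2 * x) * f = \<alpha> * (w / 2 * (z / 2 * x) * e - z * w / 4 * (x * l)) - \<beta> * w / 2 * (z / 2 * x * c)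
        + \<gamma> * z * w / 4 * (w / 2 * (z / 2 * x) * k)" "z \<noteq> 0" "w \<noteq> 0" "x \<noteq> 0" for f e l c k z w x \<alpha> \<beta> \<gamma> :: complex
  proof -
    note that(1)
    also have "\<alpha> * (w / 2 * (z / 2 * x) * e - z * w / 4 * (x * l)) - \<beta> * w / 2 * (z / 2 * x * c)
        + \<gamma> * z * w / 4 * (w / 2 * (z / 2 * x) * k) = w / 2 * (z / 2 * x) * (\<alpha> * (e - l) - \<beta> * c + \<gamma> * z * w / 4 * k)"
      by (simp add: field_simps)
    finally show ?thesis using that(2-) by simp
  qed
  have r0': "q * q' * t = \<beta> * (e - l) + \<beta>\<^sup>2 * z / 2 * g + \<alpha> * \<beta> * z / 2 * (n / 2 * k' + w / 2 * k) - \<alpha> * \<beta> * (w / 2 * q * u + n / 2 * q' * v)"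
    if "q * q' * (z / 2 * x * t) = \<beta> * (z / 2 * x * e - z / 2 * (x * l)) + \<beta>\<^sup>2 * z / 2 * (z / 2 * x * g)
        + \<alpha> * \<beta> * z / 2 * (n / 2 * (z / 2 * x * k') + w / 2 * (z / 2 * x) * k)
        - \<alpha> * \<beta> * (w / 2 * q * (z / 2 * x * u) + n / 2 * (z / 2) * q' * (x * v))" "z \<noteq> 0" "x \<noteq> 0"
    for q q' t e l g k k' u v n z w x \<alpha> \<beta> :: complex
  proof -
    have "(z / 2 * x) * (q * q' * t) = q * q' * (z / 2 * x * t)" by simp
    also note that(1)
    also have "\<beta> * (z / 2 * x * e - z / 2 * (x * l)) + \<beta>\<^sup>2 * z / 2 * (z / 2 * x * g)
        + \<alpha> * \<beta> * z / 2 * (n / 2 * (z / 2 * x * k') + w / 2 * (z / 2 * x) * k)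
        - \<alpha> * \<beta> * (w / 2 * q * (z / 2 * x * u) + n / 2 * (z / 2) * q' * (x * v))
      = (z / 2 * x) * (\<beta> * (e - l) + \<beta>\<^sup>2 * z / 2 * g + \<alpha> * \<beta> * z / 2 * (n / 2 * k' + w / 2 * k) - \<alpha> * \<beta> * (w / 2 * q * u + n / 2 * q' * v))"
      by (simp add: field_simps)
    finally show ?thesis using that(2-) by simp
  qed
  have r1: "poly qp (of_nat n) = ac * (poly qE (of_nat n + 2) - poly qA (of_nat n)) - bc\<^sup>2 * poly qc (of_nat n + 1)
      + ac\<^sup>2 * (of_nat n + 1) * (of_nat n + 2) / 4 * poly qk (of_nat n)"
    and r1': "poly qk (of_nat n) = ac * (poly qE (of_nat n + 2) - poly qA (of_nat n)) - bc\<^sup>2 * poly qb (of_nat n + 1)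
      + ac\<^sup>2 * (of_nat n + 1) * (of_nat n + 2) / 4 * poly qp (of_nat n)"
    if "n \<ge> 2" for n
    using r0[OF arrays.second_diagonal[OF that, unfolded d S h, unfolded two] nz hn_nz]
      r0[OF dual.second_diagonal[OF that, unfolded d S h, unfolded two] nz hn_nz] .
  have r3: "qq ac (of_nat n) * qq ac (of_nat n + 1) * poly qt (of_nat n) = bc * (poly qE (of_nat n + 1) - poly qA (of_nat n))
      + bc\<^sup>2 * (of_nat n + 1) / 2 * poly qg (of_nat n)
      + ac * bc * (of_nat n + 1) / 2 * (of_nat n / 2 * poly qk (of_nat n - 1) + (of_nat n + 2) / 2 * poly qk (of_nat n))
      - ac * bc * ((of_nat n + 2) / 2 * qq ac (of_nat n) * poly qb (of_nat n + 1) + of_nat n / 2 * qq ac (of_nat n + 1) * poly qb (of_nat n))"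
    and r3': "qq ac (of_nat n) * qq ac (of_nat n + 1) * poly qg (of_nat n) = bc * (poly qE (of_nat n + 1) - poly qA (of_nat n))
      + bc\<^sup>2 * (of_nat n + 1) / 2 * poly qt (of_nat n)
      + ac * bc * (of_nat n + 1) / 2 * (of_nat n / 2 * poly qp (of_nat n - 1) + (of_nat n + 2) / 2 * poly qp (of_nat n))
      - ac * bc * ((of_nat n + 2) / 2 * qq ac (of_nat n) * poly qc (of_nat n + 1) + of_nat n / 2 * qq ac (of_nat n + 1) * poly qc (of_nat n))"
    if n3: "n \<ge> 3" for n
  proof -
    obtain k where k: "n = Suc k" using n3 by (cases n) auto
    have prev: "mC (n - 1) (Suc n) = ?h (Suc n) * poly qk (of_nat n - 1)"
      "mB (Suc n) (n - 1) = ?h (Suc n) * poly qp (of_nat n - 1)"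
      using d(8)[of k] d(5)[of k] by (simp_all add: k)
    have E: "of_nat n + (1::complex) = of_nat (Suc n)" by simp
    show "qq ac (of_nat n) * qq ac (of_nat n + 1) * poly qt (of_nat n) = bc * (poly qE (of_nat n + 1) - poly qA (of_nat n))
      + bc\<^sup>2 * (of_nat n + 1) / 2 * poly qg (of_nat n)
      + ac * bc * (of_nat n + 1) / 2 * (of_nat n / 2 * poly qk (of_nat n - 1) + (of_nat n + 2) / 2 * poly qk (of_nat n))
      - ac * bc * ((of_nat n + 2) / 2 * qq ac (of_nat n) * poly qb (of_nat n + 1) + of_nat n / 2 * qq ac (of_nat n + 1) * poly qb (of_nat n))"
      by (rule r0'[OF arrays.first_diagonal[OF n3, unfolded prev d S h, unfolded two] nz(1) hn_nz])
    show "qq ac (of_nat n) * qq ac (of_nat n + 1) * poly qg (of_nat n) = bc * (poly qE (of_nat n + 1) - poly qA (of_nat n))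
      + bc\<^sup>2 * (of_nat n + 1) / 2 * poly qt (of_nat n)
      + ac * bc * (of_nat n + 1) / 2 * (of_nat n / 2 * poly qp (of_nat n - 1) + (of_nat n + 2) / 2 * poly qp (of_nat n))
      - ac * bc * ((of_nat n + 2) / 2 * qq ac (of_nat n) * poly qc (of_nat n + 1) + of_nat n / 2 * qq ac (of_nat n + 1) * poly qc (of_nat n))"
      by (rule r0'[OF dual.first_diagonal[OF n3, unfolded prev d S h, unfolded two] nz(1) hn_nz])
  qed
  have k11: "qq ac (of_nat n) * K n $ 1 $ 1 = qq ac (of_nat n) * (poly qA (of_nat n)
        - ac * (of_nat n + 1) * (of_nat n + 2) / 4 * poly qk (of_nat n) - bc * (of_nat n + 1) / 2 * poly qg (of_nat n))
      - ac * bc\<^sup>2 * of_nat n * (of_nat n + 1) / 4 * poly qc (of_nat n)" for n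
  proof -
    have "q * k = q * (l - \<alpha> * z * w / 4 * u - \<beta> * z / 2 * g) - \<alpha> * \<beta>\<^sup>2 * y * z / 4 * v"
      if "q * x * k = q * (x * l - \<alpha> * (w / 2 * (z / 2 * x) * u) - \<beta> * (z / 2 * x * g)) - \<alpha> * \<beta>\<^sup>2 * y * z / 4 * (x * v)" "x \<noteq> 0"
      for q k l z w u g v x y \<alpha> \<beta> :: complex
    proof -
      have "x * (q * k) = q * x * k" by simp
      also note that(1)
      also have "q * (x * l - \<alpha> * (w / 2 * (z / 2 * x) * u) - \<beta> * (z / 2 * x * g)) - \<alpha> * \<beta>\<^sup>2 * y * z / 4 * (x * v)
          = x * (q * (l - \<alpha> * z * w / 4 * u - \<beta> * z / 2 * g) - \<alpha> * \<beta>\<^sup>2 * y * z / 4 * v)"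
        by (simp add: field_simps)
      finally show ?thesis using that(2) by simp
    qed
    from this[OF K11[of n, unfolded d S h, unfolded two] hn_nz] show ?thesis .
  qed
  have kc: "q * k = p * w" if "q * x * k = x * p * w" "x \<noteq> 0" for q k p w x :: complex
  proof -
    have "x * (q * k) = x * (p * w)" using that(1) by (simp only: mult_ac)
    then show ?thesis using that(2) by simp
  qed
  have k12: "qq ac (of_nat n) * K n $ 1 $ 2 = poly qb (of_nat n) * (qq ac (of_nat n) * qq ac (of_nat n + 1) + bc\<^sup>2 * (of_nat n + 1) / 2)" for n
    by (rule kc[OF K12[of n, unfolded d] hn_nz])
  have k21: "qq ac (of_nat n) * K n $ 2 $ 1 = poly qc (of_nat n) * (qq ac (of_nat n) * qq ac (of_nat n - 1) + bc\<^sup>2 * of_nat n / 2)" for n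
    by (rule kc[OF K21[of n, unfolded d] hn_nz])
  have k22: "qq ac (of_nat n) * K n $ 2 $ 2 = qq ac (of_nat n) * (poly qE (of_nat n)
        + ac * of_nat n * (of_nat n - 1) / 4 * poly qp (of_nat n - 2) + bc * of_nat n / 2 * poly qt (of_nat n - 1))
      + ac * bc\<^sup>2 * of_nat n * (of_nat n + 1) / 4 * poly qb (of_nat n)" for n
  proof -
    have 1: "of_nat n * mB n (n - 1) = of_nat n * (?h n * poly qt (of_nat n - 1))"
      using d(4)[of "n - 1"] by (cases n) auto
    have 2: "of_nat n * (of_nat n - 1) * mB n (n - 2) = of_nat n * (of_nat n - 1) * (?h n * poly qp (of_nat n - 2))"
    proof -
      consider "n = 0" | "n = 1" | k where "n = Suc (Suc k)" by (metis One_nat_def not0_implies_Suc)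
      then show ?thesis using d(5)[of "n - 2"] by cases auto
    qed
    have "?h n * (qq ac (of_nat n) * K n $ 2 $ 2) = qq ac (of_nat n) * ?h n * K n $ 2 $ 2" by simp
    also have "\<dots> = qq ac (of_nat n) * (?h n * poly qE (of_nat n)
        + ac / 4 * (of_nat n * (of_nat n - 1) * (?h n * poly qp (of_nat n - 2))) + bc / 2 * (of_nat n * (?h n * poly qt (of_nat n - 1))))
      + ac * bc\<^sup>2 * of_nat n * (of_nat n + 1) / 4 * (?h n * poly qb (of_nat n))"
      unfolding 1[symmetric] 2[symmetric] using K22[of n] unfolding d(2,3) by (simp add: mult.assoc)
    also have "\<dots> = ?h n * (qq ac (of_nat n) * (poly qE (of_nat n)
        + ac * of_nat n * (of_nat n - 1) / 4 * poly qp (of_nat n - 2) + bc * of_nat n / 2 * poly qt (of_nat n - 1))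
      + ac * bc\<^sup>2 * of_nat n * (of_nat n + 1) / 4 * poly qb (of_nat n))"
      by (simp add: field_simps)
    finally show ?thesis using hn_nz[of n] by (simp only: mult_cancel_left) simp
  qed
  define N where "N m = complex_of_nat (2 * m + 4)" for m
  have N_Suc: "N (Suc m) = N m + 2" for m by (simp add: N_def)
  have qe: "qe m = qq ac (N m)" for m by (simp add: qe_def N_def)
  have gp: "grow k (\<lambda>m. poly p (N m + c))" if "degree p \<le> k" for p k c
    unfolding N_def by (rule grow_poly[OF that])
  have gp0: "grow k (\<lambda>m. poly p (N m))" if "degree p \<le> k" for p k
    unfolding N_def by (rule grow_poly_0[OF that])
  have gm: "grow k (\<lambda>m. poly p (N m - c))" if "degree p \<le> k" for p k c
    using gp[OF that, of "- c"] by simp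
  have gN: "grow 1 (\<lambda>m. N m + c)" for c unfolding N_def by (rule grow_linear)
  have gN0: "grow 1 N" using gN[of 0] by simp
  have gN': "grow 1 (\<lambda>m. N m - c)" for c using gN[of "- c"] by simp
  have mul: "grow k (\<lambda>m. f m * g m)" if "grow i f" "grow j g" "i + j \<le> k" for i j k f g
    using grow_mono[OF grow_mult[OF that(1,2)] that(3)] .
  have gQ: "grow 2 (\<lambda>m. qq ac (N m))" using grow_qe by (rule grow_cong) (simp add: qe)
  have gQ1: "grow 2 (\<lambda>m. qq ac (N m + 1))"
    using gp[of "[:1, ac\<^sup>2 / 4, ac\<^sup>2 / 4:]" 2 1]
    by (rule grow_cong) (simp_all add: qq_def field_simps)
  have deg: "degree p \<le> k" if "grow k (\<lambda>m. poly p (N m))" for p k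
    using that unfolding N_def by (rule degree_le_grow)
  have canc: "p = 0 \<or> degree p + j \<le> k"
    if "grow k (\<lambda>m. w m * poly p (N m))" "c > 0" "\<And>m. c * (real m + 1) ^ j \<le> cmod (w m)" for k w p c j
    using grow_cancel_poly[of k w p c j] that unfolding N_def by blast
  have zero: "p = 0" if "\<And>m. poly p (N m) = 0" for p
    using that unfolding N_def by (rule poly_eq_0_even)
  have gK: "grow 4 (\<lambda>m. qq ac (N m) * K (2 * m + 4) $ r $ s)" for r s
    by (rule mul[OF gQ grow_K]) simp

  \<comment> \<open>The product of \<open>qq\<close> with an entry of \<open>K\<close> has growth
    four, which the multipliers of \<open>qb\<close> and \<open>qc\<close> alone already reach; both
    polynomials are constant.\<close>
  have "grow 4 (\<lambda>m. (qq ac (N m) * qq ac (N m + 1) + bc\<^sup>2 * (N m + 1) / 2) * poly qb (N m))"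
    using gK[of 1 2] by (rule grow_cong) (simp only: N_def k12 mult.commute)
  from canc[OF this a_pos(2) weight_lower_bounds(3)[folded N_def]] have "degree qb = 0" by auto
  then obtain \<beta> where qb: "qb = [:\<beta>:]" by (auto elim: degree_eq_zeroE)
  have "grow 4 (\<lambda>m. (qq ac (N m) * qq ac (N m - 1) + bc\<^sup>2 * N m / 2) * poly qc (N m))"
    using gK[of 2 1] by (rule grow_cong) (simp only: N_def k21 mult.commute)
  from canc[OF this a_pos(2) weight_lower_bounds(4)[folded N_def]] have "degree qc = 0" by auto
  then obtain c where qc: "qc = [:c:]" by (auto elim: degree_eq_zeroE)

  have R1: "poly qp (N m) = ac * (poly qE (N m + 2) - poly qA (N m)) - bc\<^sup>2 * c
      + ac\<^sup>2 * (N m + 1) * (N m + 2) / 4 * poly qk (N m)"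
    and R1': "poly qk (N m) = ac * (poly qE (N m + 2) - poly qA (N m)) - bc\<^sup>2 * \<beta>
      + ac\<^sup>2 * (N m + 1) * (N m + 2) / 4 * poly qp (N m)" for m
    using r1[of "2 * m + 4"] r1'[of "2 * m + 4"] unfolding N_def[symmetric] qb qc by simp_all
  have q1: "qq ac (N m + 1) = 1 + ac\<^sup>2 * (N m + 1) * (N m + 2) / 4" for m
    by (simp add: qq_def)
  \<comment> \<open>Subtracting the dual relations cancels \<open>qE\<close> and \<open>qA\<close>.
    A quadratic weight times \<open>qp - qk\<close> is then constant, so this difference is
    zero.\<close>
  have diff: "qq ac (N m + 1) * poly (qp - qk) (N m) = bc\<^sup>2 * (\<beta> - c)" for m
  proof -
    have "f - k = bc\<^sup>2 * (\<beta> - c) - t * (f - k)" if "f = u - bc\<^sup>2 * c + t * k" "k = u - bc\<^sup>2 * \<beta> + t * f" for f k u t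
      using that by algebra
    from this[OF R1[of m] R1'[of m]] show ?thesis unfolding q1 by (simp add: algebra_simps)
  qed
  have "grow 0 (\<lambda>m. qq ac (N m + 1) * poly (qp - qk) (N m))" unfolding diff by simp
  from canc[OF this a_pos(1) weight_lower_bounds(1)[folded N_def]] have qk: "qk = qp" by auto
  have \<beta>: "\<beta> = c" using diff[of 0] b_nz by (simp add: qk)

  have R3: "qq ac (N m) * qq ac (N m + 1) * poly qt (N m) = bc * (poly qE (N m + 1) - poly qA (N m))
      + bc\<^sup>2 * (N m + 1) / 2 * poly qg (N m)
      + ac * bc * (N m + 1) / 2 * (N m / 2 * poly qp (N m - 1) + (N m + 2) / 2 * poly qp (N m))
      - ac * bc * ((N m + 2) / 2 * qq ac (N m) * c + N m / 2 * qq ac (N m + 1) * c)"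
    and R3': "qq ac (N m) * qq ac (N m + 1) * poly qg (N m) = bc * (poly qE (N m + 1) - poly qA (N m))
      + bc\<^sup>2 * (N m + 1) / 2 * poly qt (N m)
      + ac * bc * (N m + 1) / 2 * (N m / 2 * poly qp (N m - 1) + (N m + 2) / 2 * poly qp (N m))
      - ac * bc * ((N m + 2) / 2 * qq ac (N m) * c + N m / 2 * qq ac (N m + 1) * c)" for m
    using r3[of "2 * m + 4"] r3'[of "2 * m + 4"] unfolding N_def[symmetric] qb qc qk \<beta> by simp_all
  \<comment> \<open>The same subtraction for the first diagonals leaves no inhomogeneous term, and
    the weight never vanishes.\<close>
  have "poly (qt - qg) (N m) = 0" for m
  proof -
    have "(qq ac (N m) * qq ac (N m + 1) + bc\<^sup>2 * (N m + 1) / 2) * poly (qt - qg) (N m) = 0"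
    proof -
      have "(w + s) * (t - g) = 0" if "w * t = u + s * g + v - z" "w * g = u + s * t + v - z" for w s t g u v z :: complex
        using that by algebra
      from this[OF R3[of m] R3'[of m]] show ?thesis by simp
    qed
    moreover have "0 < a ^ 4 / 16 * (real m + 1) ^ 4" using a_pos(2) by (intro mult_pos_pos) auto
    then have "qq ac (N m) * qq ac (N m + 1) + bc\<^sup>2 * (N m + 1) / 2 \<noteq> 0"
      using weight_lower_bounds(3)[of m, folded N_def] by (metis norm_zero not_le)
    ultimately show ?thesis by (simp only: mult_eq_0_iff) blast
  qed
  then have qg: "qg = qt" using zero[of "qt - qg"] by simp

  \<comment> \<open>\<open>P1\<close> and \<open>P2\<close> are the diagonal entries of
    \<open>K\<close> up to a term whose product with \<open>qq\<close> has growth at most four; both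
    therefore have growth two.\<close>
  define P1 where "P1 m = poly qA (N m) - ac * (N m + 1) * (N m + 2) / 4 * poly qp (N m)
      - bc * (N m + 1) / 2 * poly qt (N m)" for m
  define P2 where "P2 m = poly qE (N m) + ac * N m * (N m - 1) / 4 * poly qp (N m - 2)
      + bc * N m / 2 * poly qt (N m - 1)" for m
  have P1_eq: "qq ac (N m) * P1 m = qq ac (N m) * K (2 * m + 4) $ 1 $ 1 + ac * bc\<^sup>2 * N m * (N m + 1) / 4 * c" for m
    using k11[of "2 * m + 4"] unfolding N_def[symmetric] qc qk qg P1_def by simp
  have P2_eq: "qq ac (N m) * P2 m = qq ac (N m) * K (2 * m + 4) $ 2 $ 2 - ac * bc\<^sup>2 * N m * (N m + 1) / 4 * c" for m
    using k22[of "2 * m + 4"] unfolding N_def[symmetric] qb \<beta> P2_def by simp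
  have gNN: "grow 4 (\<lambda>m. ac * bc\<^sup>2 * N m * (N m + 1) / 4 * c)"
  proof -
    have "grow 4 (\<lambda>m. (ac * bc\<^sup>2 * c / 4) * (N m * (N m + 1)))"
      by (intro grow_cmult mul[OF gN0 gN]) simp
    then show ?thesis by (rule grow_cong) simp
  qed
  have "grow 4 (\<lambda>m. qq ac (N m) * P1 m)"
    using grow_add[OF gK[of 1 1] gNN]
    by (rule grow_cong) (rule P1_eq)
  then have gP1: "grow 2 P1" using grow_qe_cancel[of 2 P1] by (simp add: qe)
  have "grow 4 (\<lambda>m. qq ac (N m) * P2 m)"
    using grow_diff[OF gK[of 2 2] gNN]
    by (rule grow_cong) (rule P2_eq)
  then have gP2: "grow 2 P2" using grow_qe_cancel[of 2 P2] by (simp add: qe)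

  define t where "t = degree qt"
  have gt: "grow t (\<lambda>m. poly qt (N m))" "grow t (\<lambda>m. poly qt (N m + 1))" "grow t (\<lambda>m. poly qt (N m - 1))"
    by (intro gp0 gp gm; simp add: t_def)+
  \<comment> \<open>The step to \<open>Suc m\<close> shifts \<open>N\<close> by 2 and matches the
    argument \<open>N m + 2\<close> in \<open>R1\<close>, so \<open>qE\<close> and \<open>qA\<close>
    can be eliminated in favour of \<open>P2\<close> and \<open>P1\<close>.\<close>
  have step: "qq ac (N m + 1) * poly qp (N m) = ac * (P2 (Suc m) - P1 m)
      - ac * bc / 2 * ((N m + 2) * poly qt (N m + 1) + (N m + 1) * poly qt (N m)) - bc\<^sup>2 * c" for m
  proof -
    have P: "P2 (Suc m) = poly qE (N m + 2) + ac * (N m + 2) * (N m + 1) / 4 * poly qp (N m)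
        + bc * (N m + 2) / 2 * poly qt (N m + 1)"
      unfolding P2_def N_Suc by (simp add: add.commute[of 1])
    have "ac * (P2 (Suc m) - P1 m) - ac * bc / 2 * ((N m + 2) * poly qt (N m + 1) + (N m + 1) * poly qt (N m)) - bc\<^sup>2 * c
        = (ac * (poly qE (N m + 2) - poly qA (N m)) - bc\<^sup>2 * c
            + ac\<^sup>2 * (N m + 1) * (N m + 2) / 4 * poly qp (N m)) + ac\<^sup>2 * (N m + 1) * (N m + 2) / 4 * poly qp (N m)"
      unfolding P P1_def by (simp add: field_simps power2_eq_square)
    also have "\<dots> = poly qp (N m) + ac\<^sup>2 * (N m + 1) * (N m + 2) / 4 * poly qp (N m)"
      using R1[of m] unfolding qk by simp
    finally show ?thesis unfolding q1 by (simp add: algebra_simps)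
  qed
  \<comment> \<open>Dividing by the quadratic weight leaves degree at most
    \<open>max 2 (t + 1) - 2\<close>, which is at most \<open>t - 1\<close> also for
    \<open>t = 0\<close> with truncated subtraction.\<close>
  have "grow (max 2 (t + 1)) (\<lambda>m. qq ac (N m + 1) * poly qp (N m))"
    unfolding step
    by (intro grow_add grow_diff grow_cmult grow_const mul[OF gN gt(1)] mul[OF gN gt(2)]
        grow_mono[OF gP1] grow_mono[OF grow_Suc[OF gP2]]) auto
  from canc[OF this a_pos(1) weight_lower_bounds(1)[folded N_def]] have qp: "degree qp \<le> t - 1"
    by auto
  have gq: "grow (t - 1) (\<lambda>m. poly qp (N m))" "grow (t - 1) (\<lambda>m. poly qp (N m - 1))" "grow (t - 1) (\<lambda>m. poly qp (N m - 2))"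
    using qp by (auto intro: gp0 gm)
  have gNt: "grow (max 2 (t + 1)) (\<lambda>m. (f m * g m) * poly qp (h m))"
    if "grow 1 f" "grow 1 g" "grow (t - 1) (\<lambda>m. poly qp (h m))" for f g h
    by (rule mul[OF mul[OF that(1,2), of 2] that(3)]) auto
  have gA: "grow (max 2 (t + 1)) (\<lambda>m. poly qA (N m))"
  proof -
    have "grow (max 2 (t + 1)) (\<lambda>m. P1 m + ac / 4 * (((N m + 1) * (N m + 2)) * poly qp (N m)) + bc / 2 * ((N m + 1) * poly qt (N m)))"
      by (intro grow_add grow_cmult grow_mono[OF gP1] gNt[OF gN gN gq(1)] mul[OF gN gt(1)]) auto
    then show ?thesis by (rule grow_cong) (simp add: P1_def)
  qed
  have "grow (max 2 (t + 1)) (\<lambda>m. P2 m - ac / 4 * ((N m * (N m - 1)) * poly qp (N m - 2)) - bc / 2 * (N m * poly qt (N m - 1)))"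
    by (intro grow_diff grow_cmult grow_mono[OF gP2] gNt[OF gN0 gN' gq(3)] mul[OF gN0 gt(3)]) auto
  then have "grow (max 2 (t + 1)) (\<lambda>m. poly qE (N m))"
    by (rule grow_cong) (simp add: P2_def)
  then have dE: "degree qE \<le> max 2 (t + 1)" by (rule deg)
  have cubic: "grow 3 (\<lambda>m. (N m + 2) / 2 * qq ac (N m) + N m / 2 * qq ac (N m + 1))"
  proof -
    have "grow 3 (\<lambda>m. 1 / 2 * ((N m + 2) * qq ac (N m)) + 1 / 2 * (N m * qq ac (N m + 1)))"
      by (intro grow_add grow_cmult mul[OF gN gQ] mul[OF gN0 gQ1]) auto
    then show ?thesis by (rule grow_cong) simp
  qed
  \<comment> \<open>In \<open>R3\<close> the polynomial \<open>qt\<close> of degree \<open>t\<close>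
    has a multiplier of degree four, while the other side grows only like
    \<open>max 3 (t + 1)\<close>; hence \<open>qt = 0\<close>.\<close>
  have "grow (max 3 (t + 1)) (\<lambda>m. bc * (poly qE (N m + 1) - poly qA (N m)) + bc\<^sup>2 / 2 * ((N m + 1) * poly qt (N m))
      + ac * bc / 4 * (((N m + 1) * N m) * poly qp (N m - 1) + ((N m + 1) * (N m + 2)) * poly qp (N m))
      - ac * bc * c * ((N m + 2) / 2 * qq ac (N m) + N m / 2 * qq ac (N m + 1)))"
    by (intro grow_add grow_diff grow_cmult grow_mono[OF gp[OF dE]] grow_mono[OF gA] mul[OF gN gt(1)]
        grow_mono[OF gNt[OF gN gN0 gq(2)]] grow_mono[OF gNt[OF gN gN gq(1)]] grow_mono[OF cubic]) auto
  then have "grow (max 3 (t + 1)) (\<lambda>m. (qq ac (N m) * qq ac (N m + 1)) * poly qt (N m))"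
    by (rule grow_cong) (simp only: R3 qg, simp add: field_simps)
  from canc[OF this a_pos(2) weight_lower_bounds(2)[folded N_def]] have qt: "qt = 0"
    by (auto simp: t_def)
  then have t: "t = 0" by (simp add: t_def)
  then obtain \<phi> where qp: "qp = [:\<phi>:]" using qp by (auto elim: degree_eq_zeroE)
  have dE: "degree qE \<le> 2" using dE t by simp
  have e1: "(ac * bc * c) * ((N m + 2) / 2 * qq ac (N m) + N m / 2 * qq ac (N m + 1))
      = bc * (poly qE (N m + 1) - poly qA (N m)) + ac * bc * \<phi> / 2 * ((N m + 1) * (N m + 1))" for m
  proof -
    have "0 = bc * (poly qE (N m + 1) - poly qA (N m)) + ac * bc * (N m + 1) / 2 * (N m / 2 * \<phi> + (N m + 2) / 2 * \<phi>)
        - ac * bc * ((N m + 2) / 2 * qq ac (N m) * c + N m / 2 * qq ac (N m + 1) * c)"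
      using R3[of m] unfolding qg qt qp by simp
    also have "\<dots> = bc * (poly qE (N m + 1) - poly qA (N m)) + ac * bc * \<phi> / 2 * ((N m + 1) * (N m + 1))
        - (ac * bc * c) * ((N m + 2) / 2 * qq ac (N m) + N m / 2 * qq ac (N m + 1))"
      by (simp add: field_simps)
    finally show ?thesis by simp
  qed
  \<comment> \<open>With \<open>t = 0\<close> one side of \<open>e1\<close> is quadratic, whereas
    \<open>c\<close> is multiplied by a cubic weight and by \<open>a\<close> and
    \<open>b\<close>.\<close>
  have "grow 2 (\<lambda>m. bc * (poly qE (N m + 1) - poly qA (N m)) + ac * bc * \<phi> / 2 * ((N m + 1) * (N m + 1)))"
    by (intro grow_add grow_diff grow_cmult gp[OF dE] grow_mono[OF gA] mul[OF gN gN]) (simp_all add: t)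
  then have "grow 2 (\<lambda>m. ((N m + 2) / 2 * qq ac (N m) + N m / 2 * qq ac (N m + 1)) * poly [:ac * bc * c:] (N m))"
    by (rule grow_cong) (simp only: e1[symmetric], simp add: mult.commute)
  from canc[OF this a_pos(1) weight_lower_bounds(5)[folded N_def]] have c: "c = 0"
    using a_nz b_nz by auto
  define y0 y1 y2 where "y0 = coeff qE 0" and "y1 = coeff qE 1" and "y2 = coeff qE 2"
  have qE: "qE = [:y0, y1, y2:]" unfolding y0_def y1_def y2_def using poly_degree_2[OF dE] .
  have e2: "poly qE (N m + 2) - poly qA (N m) = \<phi> / ac - ac * (N m + 1) * (N m + 2) / 4 * \<phi>" for m
    using R1[of m] a_nz unfolding qk qp c by (simp add: field_simps power2_eq_square)
  have e1': "poly qE (N m + 1) - poly qA (N m) = - (ac * \<phi> / 2 * ((N m + 1) * (N m + 1)))" for m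
  proof -
    have "bc * (poly qE (N m + 1) - poly qA (N m) + ac * \<phi> / 2 * ((N m + 1) * (N m + 1))) = 0"
      using e1[of m] unfolding c by (simp add: algebra_simps)
    then have "poly qE (N m + 1) - poly qA (N m) + ac * \<phi> / 2 * ((N m + 1) * (N m + 1)) = 0"
      using b_nz by simp
    then show ?thesis by (simp only: eq_neg_iff_add_eq_0)
  qed
  \<comment> \<open>The two expressions for differences of \<open>qE\<close> and \<open>qA\<close>
    are subtracted: an increment of the quadratic \<open>qE\<close> is linear, but \<open>qq\<close>
    is quadratic, so its factor \<phi> must vanish.\<close>
  have e3: "qq ac (N m) * \<phi> = ac * (y1 + y2 * (2 * N m + 3))" for m
  proof -
    have "y1 + y2 * (2 * N m + 3) = (poly qE (N m + 2) - poly qA (N m)) - (poly qE (N m + 1) - poly qA (N m))"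
      unfolding qE by (simp add: algebra_simps)
    also have "ac * \<dots> = qq ac (N m) * \<phi>"
      unfolding e1' e2 qq_def using a_nz by (simp add: field_simps power2_eq_square)
    finally show ?thesis by simp
  qed
  have "grow 1 (\<lambda>m. ac * (y1 + 2 * y2 * (N m + 3 / 2)))"
    by (intro grow_add grow_cmult gN grow_const)
  then have "grow 1 (\<lambda>m. qq ac (N m) * \<phi>)"
    by (rule grow_cong) (simp only: e3, simp add: field_simps)
  then have "grow 1 (\<lambda>m. qe m * poly [:\<phi>:] (N m))" by (simp add: qe)
  then have \<phi>: "\<phi> = 0" using canc[of 1 qe "[:\<phi>:]" _ 2] qe_bound by fastforce
  have y: "y1 + y2 * (2 * N m + 3) = 0" for m
    using e3[of m] a_nz by (simp add: \<phi>)
  have "(y1 + y2 * (2 * N 1 + 3)) - (y1 + y2 * (2 * N 0 + 3)) = 4 * y2"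
    by (simp add: N_def algebra_simps)
  then have y2: "y2 = 0" by (simp only: y) simp
  with y[of 0] have y1: "y1 = 0" by simp
  have "poly (qA - [:y0:]) (N m) = 0" for m
    using e1'[of m] unfolding qE y1 y2 \<phi> by simp
  then have qA: "qA = [:y0:]" using zero[of "qA - [:y0:]"] by simp
  have z: "qb = 0" "qc = 0" "qp = 0" "qk = 0" "qt = 0" "qg = 0"
    using qb qc \<beta> c qp \<phi> qk qt qg by simp_all
  have "K n = mat y0" for n
    using k11[of n] k12[of n] k21[of n] k22[of n] qq_nz[of n]
    unfolding z qE qA y1 y2 by (simp add: mat2_eq_iff)
  then show ?thesis by blast
qed

text \<open>One scalar serving every \<open>n\<close> makes \<open>D\<close> agree with
  multiplication by that scalar on a basis, and the action determines the operator.\<close>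

lemma order_eq_0: "degree D = 0"
proof -
  obtain x where K: "\<And>n. K n = mat x" using K_scalar by blast
  have pm: "pconst (mat x) = (mat [:x:] :: 2 pmat)"
    by (simp add: mat2_eq_iff pconst_def)
  have B: "B n \<cdot>\<^sub>D D = mat [:x:] ** B n" for n
  proof -
    obtain U where U: "B n ** T = pconst U ** gm n" using B_T_gm by blast
    have "(B n \<cdot>\<^sub>D D) ** T = (B n ** T) \<cdot>\<^sub>D hat D"
      by (simp add: hat_def dop_act_conj T_Ti flip: matrix_mul_assoc)
    also have "\<dots> = pconst U ** (mat [:x:] ** gm n)"
      unfolding U dop_act_pconst_mult K_act K pm ..
    also have "\<dots> = mat [:x:] ** (B n ** T)"
      unfolding mat_mult_commute U ..
    finally have "(B n \<cdot>\<^sub>D D) ** T ** Ti = mat [:x:] ** (B n ** T) ** Ti" by simp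
    then show ?thesis by (simp add: T_Ti flip: matrix_mul_assoc)
  qed
  have "D = monom (mat [:x:]) 0"
  proof (rule dop_eqI)
    fix P :: "2 pmat"
    obtain n c where P: "P = (\<Sum>k<n. pconst (c k) ** B k)"
      using deg_below_bound[of P] deg_below_expansion[OF B_degree B_lead] by blast
    have "P \<cdot>\<^sub>D D = mat [:x:] ** P"
      unfolding P by (simp add: dop_act_sum_left dop_act_pconst_mult B mat_mult_commute matrix_mult_sum_right)
    then show "P \<cdot>\<^sub>D D = P \<cdot>\<^sub>D monom (mat [:x:]) 0"
      by (simp add: dop_act_monom mat_mult_right[of P])
  qed
  then show ?thesis using degree_monom_le[of "mat [:x:] :: 2 pmat" 0] by simp
qed

end

theorem mainTheorem14:
  fixes a b :: real
  assumes "a \<noteq> 0" and "b \<noteq> 0"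
  shows "strong_darboux UNIV hermite_weight (W_ab a b)
    \<and> (\<exists>D \<in> bochner_algebra UNIV (W_ab a b). dop_order D = 6)
    \<and> \<not> (\<exists>D \<in> bochner_algebra UNIV (W_ab a b). 0 < dop_order D \<and> dop_order D < 6)
    \<and> \<not> matrix_bochner_solution UNIV (W_ab a b)"
proof -
  interpret ab_weight a b
    by unfold_locales (use assms in auto)
  have low: "\<not> (0 < dop_order D \<and> dop_order D < 6)" if "D \<in> bochner_algebra UNIV (W_ab a b)" for D
  proof
    assume nontrivial: "0 < dop_order D \<and> dop_order D < 6"
    then interpret low_order a b D
      by unfold_locales (use that nontrivial in auto)
    show False using nontrivial order_eq_0 by simp
  qed
  then have "\<not> matrix_bochner_solution UNIV (W_ab a b)"
    unfolding matrix_bochner_solution_def by fastforce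
  with low strong_darboux_ab D6_order D6_bochner show ?thesis by blast
qed

end
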